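(* Let $\alpha\in\mathbb{N}_0^N$ with $\ell(\alpha)=m<N$ and $T\in\mathcal{Y}(\tau)$. Then $$\mathcal{D}_m\zeta_{\alpha,T}=\frac{\|\zeta_{\alpha,T}\|^2}{\|\zeta_{\widehat{\alpha},T}\|^2}\,\theta_m^{-1}\zeta_{\widehat{\alpha},T},$$ where $\widehat{\alpha}=(\alpha_m-1,\alpha_1,\alpha_2,\dots,\alpha_{m-1},0,\dots,0)$.
   Context: $\tau$ is a partition of $N$; $\mathcal{Y}(\tau)$ is the set of reverse standard Young tableaux (fillings of the Ferrers diagram of $\tau$ with $1,\dots,N$ decreasing along rows and columns); $c(i,T)=\operatorname{col}(i,T)-\operatorname{row}(i,T)$. $V_\tau$ is the $\mathbb{R}(\kappa)$-space ($\kappa$ an indeterminate) with basis $\mathcal{Y}(\tau)$ carrying the representation $\tau$ of $\mathcal{S}_N$ given on $s_i=(i,i+1)$ by: $\tau(s_i)T=T$ if $i,i+1$ are in the same row of $T$; $-T$ if in the same column; $T^{(i)}+\frac1bT$ if $b=c(i,T)-c(i+1,T)\ge2$; $(1-\frac1{b^2})T^{(i)}+\frac1bT$ if $b\le-2$ ($T^{(i)}$: $i,i+1$ interchanged). $\langle T,T'\rangle_0=\delta_{T,T'}\prod_{i<j,\ c(i,T)\le c(j,T)-2}\big(1-(c(i,T)-c(j,T))^{-2}\big)$. $\mathcal{P}_\tau=\mathcal{P}\otimes V_\tau$ with $\mathcal{S}_N$-action $w(x^\alpha\otimes T)=(xw)^\alpha\otimes\tau(w)T$, $(xw)_i=x_{w(i)}$.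 Dunkl operators $\mathcal{D}_i(p\otimes T)=\frac{\partial p}{\partial x_i}\otimes T+\kappa\sum_{j\ne i}\frac{p(x)-p(x(i,j))}{x_i-x_j}\otimes\tau((i,j))T$ and $\mathcal{U}_i(p\otimes T)=\mathcal{D}_i(x_ip\otimes T)-\kappa\sum_{j<i}p(x(i,j))\otimes\tau((i,j))T$. For $\alpha\in\mathbb{N}_0^N$: $\ell(\alpha)=\max\{i\colon\alpha_i>0\}$, $\alpha^+$ its nonincreasing rearrangement, rank $r_\alpha(i)=\#\{j\colon\alpha_j>\alpha_i\}+\#\{j\le i\colon\alpha_j=\alpha_i\}$ (a permutation). $\alpha\prec\beta$ iff $\alpha\ne\beta$ and all partial sums satisfy $\sum_{j\le i}\alpha_j\le\sum_{j\le i}\beta_j$; $\alpha\lhd\beta$ iff $|\alpha|=|\beta|$ and ($\alpha^+\prec\beta^+$ or ($\alpha^+=\beta^+$ and $\alpha\prec\beta$)). $\zeta_{\alpha,T}$ is the unique element of $\mathcal{P}_\tau$ of the form $x^\alpha\otimes\tau(r_\alpha^{-1})T+\sum_{\beta\lhd\alpha}x^\beta\otimes t_{\alpha\beta}(\kappa)$ with $\mathcal{U}_i\zeta_{\alpha,T}=(\alpha_i+1+\kappa c(r_\alpha(i),T))\zeta_{\alpha,T}$ for all $i$. $\langle\cdot,\cdot\rangle_\kappa$ is the unique bilinear symmetric $\mathcal{S}_N$-invariant form on $\mathcal{P}_\tau$ with $\langle1\otimes T,1\otimes T'\rangle_\kappa=\langle T,T'\rangle_0$ and $\langle\mathcal{D}_if,g\rangle_\kappa=\langle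 f,x_ig\rangle_\kappa$; $\|f\|^2:=\langle f,f\rangle_\kappa$ (for generic $\kappa$). $\theta_m=s_1s_2\cdots s_{m-1}\in\mathcal{S}_N$ (the cycle $(1\,2\,\dots\,m)$, $\theta_1=1$), acting on $\mathcal{P}_\tau$ via the $\mathcal{S}_N$-action. *)

theory Defs
  imports Main "HOL-Library.Poly_Mapping" "HOL-Computational_Algebra.Polynomial"
    "HOL-Computational_Algebra.Fraction_Field" "HOL-Combinatorics.Permutations"
begin

type_synonym K = "real poly fract"

definition kappa :: K where "kappa = Fract [:0, 1:] 1"

text \<open>A partition is a nonincreasing list of positive naturals; it is a partition of sum_list.
  Cells are (row, column), 0-based.  A tableau is a map from cells to entries, with entry 0
  outside the diagram.\<close>

type_synonym tab = "nat \<times> nat \<Rightarrow> nat"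

definition is_partition :: "nat list \<Rightarrow> bool" where
  "is_partition tau \<longleftrightarrow> sorted_wrt (\<ge>) tau \<and> 0 \<notin> set tau"

definition ferrers :: "nat list \<Rightarrow> (nat \<times> nat) set" where
  "ferrers tau = {(r, c). r < length tau \<and> c < tau ! r}"

definition RSYT :: "nat list \<Rightarrow> tab set" where
  "RSYT tau = {T. bij_betw T (ferrers tau) {1..sum_list tau}
      \<and> (\<forall>x. x \<notin> ferrers tau \<longrightarrow> T x = 0)
      \<and> (\<forall>r c. (r, Suc c) \<in> ferrers tau \<longrightarrow> T (r, Suc c) < T (r, c))
      \<and> (\<forall>r c. (Suc r, c) \<in> ferrers tau \<longrightarrow> T (Suc r, c) < T (r, c))}"

definition cell :: "tab \<Rightarrow> nat \<Rightarrow> nat \<times> nat" where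
  "cell T i = (THE x. T x = i)"

definition rowT :: "nat \<Rightarrow> tab \<Rightarrow> nat" where "rowT i T = fst (cell T i)"
definition colT :: "nat \<Rightarrow> tab \<Rightarrow> nat" where "colT i T = snd (cell T i)"

definition content :: "nat \<Rightarrow> tab \<Rightarrow> int" where
  "content i T = int (colT i T) - int (rowT i T)"

definition swapT :: "nat \<Rightarrow> tab \<Rightarrow> tab" where
  "swapT i T = Transposition.transpose i (Suc i) \<circ> T"

text \<open>Vectors in V_tau are coefficient functions on tableaux (supported on RSYT tau).
  sgen_coeff tau i T T' is the coefficient of T' in tau(s_i) T.\<close>

type_synonym vec = "tab \<Rightarrow> K"

definition sgen_coeff :: "nat \<Rightarrow> tab \<Rightarrow> tab \<Rightarrow> K" where
  "sgen_coeff i T T' =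
    (if rowT i T = rowT (Suc i) T then (if T' = T then 1 else 0)
     else if colT i T = colT (Suc i) T then (if T' = T then -1 else 0)
     else (let b = content i T - content (Suc i) T in
       if b \<ge> 2 then (if T' = swapT i T then 1 else 0) + (if T' = T then 1 / of_int b else 0)
       else (if T' = swapT i T then 1 - 1 / (of_int b)\<^sup>2 else 0)
              + (if T' = T then 1 / of_int b else 0)))"

definition tau_gen :: "nat list \<Rightarrow> nat \<Rightarrow> vec \<Rightarrow> vec" where
  "tau_gen tau i v = (\<lambda>T'. \<Sum>T\<in>RSYT tau. v T * sgen_coeff i T T')"

definition word_perm :: "nat list \<Rightarrow> nat \<Rightarrow> nat" where
  "word_perm ws = foldr (\<lambda>i acc. Transposition.transpose i (Suc i) \<circ> acc) ws id"

definition tau_word :: "nat list \<Rightarrow> nat list \<Rightarrow> vec \<Rightarrow> vec" where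
  "tau_word tau ws v = foldr (tau_gen tau) ws v"

text \<open>tau(w) for w a permutation of {1..N}: computed from any word in the generators
  s_1,...,s_{N-1} representing w (independent of the word since tau is a representation).\<close>
definition tau_perm :: "nat list \<Rightarrow> (nat \<Rightarrow> nat) \<Rightarrow> vec \<Rightarrow> vec" where
  "tau_perm tau w = tau_word tau
     (SOME ws. set ws \<subseteq> {1..<sum_list tau} \<and> word_perm ws = w)"

definition basisv :: "tab \<Rightarrow> vec" where
  "basisv T = (\<lambda>S. if S = T then 1 else 0)"

definition form0 :: "nat list \<Rightarrow> tab \<Rightarrow> tab \<Rightarrow> K" where
  "form0 tau T T' = (if T = T' then
     (\<Prod>(i, j) \<in> {(i, j). i \<in> {1..sum_list tau} \<and> j \<in> {1..sum_list tau} \<and> i < j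
                       \<and> content i T \<le> content j T - 2}.
        1 - 1 / (of_int (content i T - content j T))\<^sup>2)
   else 0)"

text \<open>Polynomials over K: finitely supported maps from exponent vectors (finitely supported nat-valued maps,
  variable x_i has index i) to coefficients.  An element of P_tau is written
  f = sum_T f_T (x) T and represented by the map T to f_T.\<close>

type_synonym mpoly = "(nat \<Rightarrow>\<^sub>0 nat) \<Rightarrow>\<^sub>0 K"
type_synonym ptau = "tab \<Rightarrow> mpoly"

definition const :: "K \<Rightarrow> mpoly" where "const c = Poly_Mapping.single 0 c"

definition Xv :: "nat \<Rightarrow> mpoly" where
  "Xv i = Poly_Mapping.single (Poly_Mapping.single i 1) 1"

definition expo :: "nat list \<Rightarrow> nat \<Rightarrow>\<^sub>0 nat" where
  "expo alpha = (\<Sum>i<length alpha. Poly_Mapping.single (Suc i) (alpha ! i))"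

definition rename_exp :: "(nat \<Rightarrow> nat) \<Rightarrow> (nat \<Rightarrow>\<^sub>0 nat) \<Rightarrow> nat \<Rightarrow>\<^sub>0 nat" where
  "rename_exp w a = (\<Sum>k\<in>Poly_Mapping.keys a. Poly_Mapping.single (w k) (Poly_Mapping.lookup a k))"

text \<open>p to p(xw), where (xw)_i = x_(w i)\<close>
definition perm_poly :: "(nat \<Rightarrow> nat) \<Rightarrow> mpoly \<Rightarrow> mpoly" where
  "perm_poly w p = (\<Sum>a\<in>Poly_Mapping.keys p.
      Poly_Mapping.single (rename_exp w a) (Poly_Mapping.lookup p a))"

definition pderiv_var :: "nat \<Rightarrow> mpoly \<Rightarrow> mpoly" where
  "pderiv_var i p = (\<Sum>a\<in>Poly_Mapping.keys p.
      Poly_Mapping.single (a - Poly_Mapping.single i 1)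
        (of_nat (Poly_Mapping.lookup a i) * Poly_Mapping.lookup p a))"

definition divdiff :: "nat \<Rightarrow> nat \<Rightarrow> mpoly \<Rightarrow> mpoly" where
  "divdiff i j p = (THE q. (Xv i - Xv j) * q = p - perm_poly (Transposition.transpose i j) p)"

definition Ptau :: "nat list \<Rightarrow> ptau set" where
  "Ptau tau = {f. (\<forall>T. T \<notin> RSYT tau \<longrightarrow> f T = 0)
     \<and> (\<forall>T a. a \<in> Poly_Mapping.keys (f T) \<longrightarrow> Poly_Mapping.keys a \<subseteq> {1..sum_list tau})}"

definition padd :: "ptau \<Rightarrow> ptau \<Rightarrow> ptau" where "padd f g = (\<lambda>T. f T + g T)"
definition psmul :: "K \<Rightarrow> ptau \<Rightarrow> ptau" where "psmul c f = (\<lambda>T. const c * f T)"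

definition basisP :: "tab \<Rightarrow> ptau" where
  "basisP T = (\<lambda>S. if S = T then 1 else 0)"

text \<open>apply a linear map L of V_tau to the V_tau-factor: sum_T f_T (x) T goes to sum_T f_T (x) L T\<close>
definition liftV :: "nat list \<Rightarrow> (vec \<Rightarrow> vec) \<Rightarrow> ptau \<Rightarrow> ptau" where
  "liftV tau L f = (\<lambda>T'. if T' \<in> RSYT tau
      then (\<Sum>T\<in>RSYT tau. const (L (basisv T) T') * f T) else 0)"

definition act :: "nat list \<Rightarrow> (nat \<Rightarrow> nat) \<Rightarrow> ptau \<Rightarrow> ptau" where
  "act tau w f = liftV tau (tau_perm tau w) (\<lambda>T. perm_poly w (f T))"

definition Dunkl :: "nat list \<Rightarrow> nat \<Rightarrow> ptau \<Rightarrow> ptau" where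
  "Dunkl tau i f = (\<lambda>T'. pderiv_var i (f T') + const kappa *
      (\<Sum>j\<in>{1..sum_list tau} - {i}.
         liftV tau (tau_perm tau (Transposition.transpose i j))
               (\<lambda>T. divdiff i j (f T)) T'))"

definition Uop :: "nat list \<Rightarrow> nat \<Rightarrow> ptau \<Rightarrow> ptau" where
  "Uop tau i f = (\<lambda>T'. Dunkl tau i (\<lambda>T. Xv i * f T) T'
      - const kappa * (\<Sum>j\<in>{1..<i}. act tau (Transposition.transpose i j) f T'))"

text \<open>alpha \<in> N_0^N is a list of length N; alpha_i = alpha ! (i - 1).\<close>

definition ell :: "nat list \<Rightarrow> nat" where
  "ell alpha = (if \<exists>i\<in>{1..length alpha}. alpha ! (i - 1) > 0
     then Max {i \<in> {1..length alpha}. alpha ! (i - 1) > 0} else 0)"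

definition rank :: "nat list \<Rightarrow> nat \<Rightarrow> nat" where
  "rank alpha i = (if i \<in> {1..length alpha} then
      card {j \<in> {1..length alpha}. alpha ! (j - 1) > alpha ! (i - 1)}
    + card {j \<in> {1..i}. alpha ! (j - 1) = alpha ! (i - 1)} else i)"

definition plus_part :: "nat list \<Rightarrow> nat list" where
  "plus_part alpha = rev (sort alpha)"

definition dom_prec :: "nat list \<Rightarrow> nat list \<Rightarrow> bool" where
  "dom_prec alpha beta \<longleftrightarrow> alpha \<noteq> beta \<and>
     (\<forall>i\<le>length alpha. sum_list (take i alpha) \<le> sum_list (take i beta))"

definition dom_lhd :: "nat list \<Rightarrow> nat list \<Rightarrow> bool" where
  "dom_lhd alpha beta \<longleftrightarrow> sum_list alpha = sum_list beta \<and>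
     (dom_prec (plus_part alpha) (plus_part beta)
      \<or> (plus_part alpha = plus_part beta \<and> dom_prec alpha beta))"

definition zeta :: "nat list \<Rightarrow> nat list \<Rightarrow> tab \<Rightarrow> ptau" where
  "zeta tau alpha T = (THE f. f \<in> Ptau tau
     \<and> (\<forall>T'. Poly_Mapping.lookup (f T') (expo alpha)
              = tau_perm tau (inv (rank alpha)) (basisv T) T')
     \<and> (\<forall>T' b. b \<in> Poly_Mapping.keys (f T') \<longrightarrow>
           b = expo alpha \<or> (\<exists>beta. length beta = length alpha \<and> b = expo beta \<and> dom_lhd beta alpha))
     \<and> (\<forall>i\<in>{1..length alpha}.
          Uop tau i f = psmul (of_nat (alpha ! (i - 1) + 1) + kappa * of_int (content (rank alpha i) T)) f))"

definition form_kappa :: "nat list \<Rightarrow> ptau \<Rightarrow> ptau \<Rightarrow> K" where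
  "form_kappa tau = (THE B.
       (\<forall>f g. f \<notin> Ptau tau \<or> g \<notin> Ptau tau \<longrightarrow> B f g = 0)
     \<and> (\<forall>f\<in>Ptau tau. \<forall>g\<in>Ptau tau. B f g = B g f)
     \<and> (\<forall>f1\<in>Ptau tau. \<forall>f2\<in>Ptau tau. \<forall>g\<in>Ptau tau. B (padd f1 f2) g = B f1 g + B f2 g)
     \<and> (\<forall>c. \<forall>f\<in>Ptau tau. \<forall>g\<in>Ptau tau. B (psmul c f) g = c * B f g)
     \<and> (\<forall>w. w permutes {1..sum_list tau} \<longrightarrow>
           (\<forall>f\<in>Ptau tau. \<forall>g\<in>Ptau tau. B (act tau w f) (act tau w g) = B f g))
     \<and> (\<forall>T\<in>RSYT tau. \<forall>T'\<in>RSYT tau. B (basisP T) (basisP T') = form0 tau T T')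
     \<and> (\<forall>i\<in>{1..sum_list tau}. \<forall>f\<in>Ptau tau. \<forall>g\<in>Ptau tau.
           B (Dunkl tau i f) g = B f (\<lambda>T. Xv i * g T)))"

definition normsq :: "nat list \<Rightarrow> ptau \<Rightarrow> K" where
  "normsq tau f = form_kappa tau f f"

definition theta :: "nat \<Rightarrow> nat \<Rightarrow> nat" where
  "theta m = word_perm [1..<m]"

definition alpha_hat :: "nat list \<Rightarrow> nat \<Rightarrow> nat list" where
  "alpha_hat alpha m = (alpha ! (m - 1) - 1) # take (m - 1) alpha @ replicate (length alpha - m) 0"

end

theory Submission
  imports Defs "HOL-Library.Function_Algebras"
begin

text \<open>The operators \<open>U\<^sub>i\<close> commute, are triangular on monomials and, \<open>\<kappa>\<close> being an indeterminate, have
  a simple joint spectrum, so that a joint eigenvector in \<open>P\<^sub>\<tau>\<close> is determined up to a scalar by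
  its eigenvalues. If \<open>\<ell>(\<alpha>) = m\<close>, then \<open>D\<^sub>j \<zeta>\<^sub>\<alpha> = 0\<close> for \<open>j > m\<close>, and the commutation relations show that
  \<open>\<theta>\<^sub>m D\<^sub>m \<zeta>\<^sub>\<alpha>\<close> has the eigenvalues belonging to \<open>\<alpha>^\<close>; hence it is a multiple \<open>c \<zeta>\<close> of the Jack
  polynomial \<open>\<zeta>\<close> of \<open>\<alpha>^\<close>. Pairing with \<open>\<theta>\<^sub>m\<^sup>-\<^sup>1 \<zeta>\<close> gives \<open>c \<parallel>\<zeta>\<parallel>\<^sup>2 = \<langle>\<zeta>\<^sub>\<alpha>, x\<^sub>m \<theta>\<^sub>m\<^sup>-\<^sup>1 \<zeta>\<rangle>\<close>. The right-hand side is
  \<open>\<parallel>\<zeta>\<^sub>\<alpha>\<parallel>\<^sup>2\<close>: up to \<open>s\<^sub>m \<dots> s\<^sub>N\<^sub>-\<^sub>1\<close> the polynomial \<open>x\<^sub>m \<theta>\<^sub>m\<^sup>-\<^sup>1 \<zeta>\<close> is the affine step \<open>x\<^sub>N \<theta>\<^sub>N\<^sup>-\<^sup>1 \<zeta>\<close>, itself a Jack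
  polynomial, and applying these reflections produces \<open>\<zeta>\<^sub>\<alpha>\<close> with coefficient 1 plus Jack
  polynomials orthogonal to it.\<close>

section \<open>Reverse standard Young tableaux\<close>

text \<open>The objects of the statement rest on choices: \<open>tau_perm\<close> picks a word,
  \<open>zeta\<close> and \<open>form_kappa\<close> are definite descriptions. Much of the work is
  to show them well defined: the seminormal matrices satisfy the Coxeter relations, these relations
  identify any two words for the same permutation, joint eigenvectors with prescribed leading term
  exist, and there is exactly one contravariant form. The spectrum separates tableaux as well as
  exponents because the contents of the entries determine a standard tableau. The division in the
  statement is a further obstacle, a quotient by zero being 0. The norms are never evaluated in
  closed form: a Jack polynomial of norm zero would be orthogonal to everything, and one of least
  degree would be killed by all Dunkl operators. This makes quantities that involve 1/\<kappa>
  integral, which forces the exponent to be 0, where the nondegenerate form on tableaux gives the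
  contradiction.\<close>

abbreviation tp :: "nat \<Rightarrow> nat \<Rightarrow> nat \<Rightarrow> nat" where "tp \<equiv> Transposition.transpose"

locale partition_shape =
  fixes tau :: "nat list"
  assumes partition: "is_partition tau"
begin

abbreviation N :: nat where "N \<equiv> sum_list tau"
abbreviation R :: "tab set" where "R \<equiv> RSYT tau"

lemma ferrers_downward:
  assumes "(r, c) \<in> ferrers tau" "r' \<le> r" "c' \<le> c"
  shows "(r', c') \<in> ferrers tau"
proof -
  have "tau ! r \<le> tau ! r'"
  proof (cases "r' = r")
    case False
    then show ?thesis using partition assms unfolding is_partition_def ferrers_def
      by (auto simp: sorted_wrt_iff_nth_less)
  qed simp
  then show ?thesis using assms unfolding ferrers_def by auto
qed

lemma finite_ferrers: "finite (ferrers tau)"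
proof (rule finite_subset)
  show "ferrers tau \<subseteq> {..<length tau} \<times> {..<N}"
    unfolding ferrers_def by (auto intro: less_le_trans elem_le_sum_list)
qed simp

lemma finite_R [simp, intro]: "finite R"
proof (rule finite_subset)
  show "R \<subseteq> {T. \<forall>x. (x \<in> ferrers tau \<longrightarrow> T x \<in> {1..N}) \<and> (x \<notin> ferrers tau \<longrightarrow> T x = 0)}"
    unfolding RSYT_def by (auto dest: bij_betwE)
qed (rule finite_set_of_finite_funs[OF finite_ferrers], simp)

lemma tab_row_le:
  assumes "T \<in> R" "(r, c + d) \<in> ferrers tau" shows "T (r, c + d) + d \<le> T (r, c)"
  using assms(2)
proof (induction d)
  case (Suc d)
  have "(r, c + d) \<in> ferrers tau" by (rule ferrers_downward[OF Suc.prems]) auto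
  moreover have "T (r, Suc (c + d)) < T (r, c + d)"
    using assms(1) Suc.prems unfolding RSYT_def by auto
  ultimately show ?case using Suc.IH by simp
qed simp

lemma tab_col_le:
  assumes "T \<in> R" "(r + d, c) \<in> ferrers tau" shows "T (r + d, c) + d \<le> T (r, c)"
  using assms(2)
proof (induction d)
  case (Suc d)
  have "(r + d, c) \<in> ferrers tau" by (rule ferrers_downward[OF Suc.prems]) auto
  moreover have "T (Suc (r + d), c) < T (r + d, c)"
    using assms(1) Suc.prems unfolding RSYT_def by auto
  ultimately show ?case using Suc.IH by simp
qed simp

text \<open>Entries increase by at least one with every unit step towards the corner, so the
  difference is at least the length of a lattice path.\<close>

lemma tab_le:
  assumes "T \<in> R" "(r2, c2) \<in> ferrers tau" "r1 \<le> r2" "c1 \<le> c2"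
  shows "T (r2, c2) + (r2 - r1) + (c2 - c1) \<le> T (r1, c1)"
proof -
  have "T (r2, c2) + (c2 - c1) \<le> T (r2, c1)"
    using tab_row_le[OF assms(1), of r2 c1 "c2 - c1"] assms by auto
  moreover have "T (r2, c1) + (r2 - r1) \<le> T (r1, c1)"
    using tab_col_le[OF assms(1), of r1 "r2 - r1" c1] ferrers_downward[OF assms(2), of r2 c1] assms by auto
  ultimately show ?thesis by simp
qed

lemma tab_range: "T \<in> R \<Longrightarrow> x \<in> ferrers tau \<Longrightarrow> T x \<in> {1..N}"
  unfolding RSYT_def by (blast dest: bij_betwE)

lemma tab_outside: "T \<in> R \<Longrightarrow> x \<notin> ferrers tau \<Longrightarrow> T x = 0"
  unfolding RSYT_def by blast

lemma tab_inj: "T \<in> R \<Longrightarrow> x \<in> ferrers tau \<Longrightarrow> T x = T y \<Longrightarrow> x = y"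
proof -
  assume a: "T \<in> R" "x \<in> ferrers tau" "T x = T y"
  then have "y \<in> ferrers tau" using tab_range[of T x] tab_outside[of T y] by (cases "y \<in> ferrers tau") auto
  then show "x = y" using a unfolding RSYT_def by (auto simp: bij_betw_def dest: inj_onD)
qed

lemma cell_unique: "T \<in> R \<Longrightarrow> x \<in> ferrers tau \<Longrightarrow> cell T (T x) = x"
  unfolding cell_def by (rule the_equality) (use tab_inj[of T x] in metis)+

lemma cell_props:
  assumes "T \<in> R" "i \<in> {1..N}"
  shows "cell T i \<in> ferrers tau" "T (cell T i) = i"
proof -
  have "i \<in> T ` ferrers tau" using assms unfolding RSYT_def by (auto simp: bij_betw_def)
  then obtain x where "x \<in> ferrers tau" "i = T x" by auto
  then show "cell T i \<in> ferrers tau" "T (cell T i) = i" using cell_unique[OF assms(1)] by auto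
qed

lemma cell_swapT: "cell (swapT i T) j = cell T (tp i (Suc i) j)"
proof -
  have "(tp i (Suc i) (T x) = j) = (T x = tp i (Suc i) j)" for x
    by (metis transpose_involutory)
  then show ?thesis unfolding cell_def swapT_def by simp
qed

lemma content_swapT [simp]: "content j (swapT i T) = content (tp i (Suc i) j) T"
  unfolding content_def rowT_def colT_def cell_swapT ..

lemma swapT_swapT [simp]: "swapT i (swapT i T) = T"
  unfolding swapT_def by (auto simp: fun_eq_iff)

lemma swapT_braid: "swapT i (swapT (Suc i) (swapT i T)) = swapT (Suc i) (swapT i (swapT (Suc i) T))"
  unfolding swapT_def by (auto simp: fun_eq_iff transpose_def)

lemma swapT_commute: "Suc i < j \<Longrightarrow> swapT i (swapT j T) = swapT j (swapT i T)"
  unfolding swapT_def by (auto simp: fun_eq_iff transpose_def)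

text \<open>Exchanging consecutive values reverses no comparison except that of \<open>i\<close>
  with \<open>Suc i\<close>, and these two share no row or column.\<close>

lemma swapT_in_R:
  assumes T: "T \<in> R" and i: "1 \<le> i" "Suc i \<le> N"
    and ne: "rowT i T \<noteq> rowT (Suc i) T" "colT i T \<noteq> colT (Suc i) T"
  shows "swapT i T \<in> R"
proof -
  have bij: "bij_betw (swapT i T) (ferrers tau) {1..N}"
  proof -
    have "tp i (Suc i) permutes {1..N}"
      using i by (intro permutes_swap_id) auto
    then show ?thesis unfolding swapT_def using T unfolding RSYT_def
      by (auto intro: bij_betw_trans permutes_imp_bij)
  qed
  have less: "swapT i T y < swapT i T x"
    if "x \<in> ferrers tau" "y \<in> ferrers tau" "T y < T x" "fst x = fst y \<or> snd x = snd y" for x y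
  proof -
    have "\<not> (T y = i \<and> T x = Suc i)"
      using ne that cell_unique[OF T, of x] cell_unique[OF T, of y] unfolding rowT_def colT_def by auto
    then show ?thesis using that(3) unfolding swapT_def by (auto simp: transpose_def)
  qed
  show ?thesis unfolding RSYT_def
  proof (intro CollectI conjI allI impI)
    fix x assume "x \<notin> ferrers tau" then have "T x = 0" by (rule tab_outside[OF T])
    then show "swapT i T x = 0" using i unfolding swapT_def by (auto simp: transpose_def)
  next
    fix r c assume a: "(r, Suc c) \<in> ferrers tau"
    have "(r, c) \<in> ferrers tau" by (rule ferrers_downward[OF a]) auto
    then show "swapT i T (r, Suc c) < swapT i T (r, c)"
      using T a unfolding RSYT_def by (intro less) auto
  next
    fix r c assume a: "(Suc r, c) \<in> ferrers tau"
    have "(r, c) \<in> ferrers tau" by (rule ferrers_downward[OF a]) auto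
    then show "swapT i T (Suc r, c) < swapT i T (r, c)"
      using T a unfolding RSYT_def by (intro less) auto
  qed (use bij in auto)
qed

text \<open>No value lies between \<open>i\<close> and \<open>Suc i\<close>, so if one cell is
  weakly below and to the right of the other, the two are adjacent. Otherwise one lies strictly
  above and to the right of the other, and both coordinates contribute to the content
  difference.\<close>

lemma content_diff_cases:
  assumes T: "T \<in> R" and i: "1 \<le> i" "Suc i \<le> N"
  defines "b \<equiv> content i T - content (Suc i) T"
  obtains (row) "rowT i T = rowT (Suc i) T" "b = 1"
  | (col) "rowT i T \<noteq> rowT (Suc i) T" "colT i T = colT (Suc i) T" "b = -1"
  | (other) "rowT i T \<noteq> rowT (Suc i) T" "colT i T \<noteq> colT (Suc i) T" "\<bar>b\<bar> \<ge> 2" "swapT i T \<in> R"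
proof -
  obtain r c where x: "cell T i = (r, c)" by fastforce
  obtain r' c' where y: "cell T (Suc i) = (r', c')" by fastforce
  have x': "(r, c) \<in> ferrers tau" "T (r, c) = i" using cell_props[OF T, of i] i x by auto
  have y': "(r', c') \<in> ferrers tau" "T (r', c') = Suc i" using cell_props[OF T, of "Suc i"] i y by auto
  have s: "rowT i T = r" "colT i T = c" "rowT (Suc i) T = r'" "colT (Suc i) T = c'"
    "b = (int c - int r) - (int c' - int r')"
    unfolding rowT_def colT_def b_def content_def using x y by auto
  have 1: "\<not> (r \<le> r' \<and> c \<le> c')" using tab_le[OF T y'(1), of r c] x' y' by auto
  have 2: "r - r' + (c - c') = 1" if "r' \<le> r" "c' \<le> c"
    using tab_le[OF T x'(1), of r' c'] x' y' that 1 by auto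
  consider "r = r'" | "r \<noteq> r'" "c = c'" | "r \<noteq> r'" "c \<noteq> c'" by blast
  then show thesis
  proof cases
    case 1 then show thesis using 2 \<open>\<not> (r \<le> r' \<and> c \<le> c')\<close> by (intro row) (auto simp: s)
  next
    case a: 2 then show thesis using 2 \<open>\<not> (r \<le> r' \<and> c \<le> c')\<close> by (intro col) (auto simp: s)
  next
    case 3
    have "\<not> (r' \<le> r \<and> c' \<le> c)" using 2 3 by auto
    then have "(r < r' \<and> c' < c) \<or> (r' < r \<and> c < c')" using 1 3 by auto
    then have "\<bar>b\<bar> \<ge> 2" unfolding s by auto
    then show thesis using 3 s swapT_in_R[OF T i] by (intro other) auto
  qed
qed

text \<open>Two further cells of a 2 by 2 block carry distinct values strictly between those of its
  diagonal corners; hence the 3.\<close>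

lemma tab_diag_less:
  assumes T: "T \<in> R" and f: "(r + d, c + d) \<in> ferrers tau" and d: "0 < d"
  shows "T (r + d, c + d) + 3 \<le> T (r, c)"
proof -
  have f1: "(r + 1, c + 1) \<in> ferrers tau" "(r + 1, c) \<in> ferrers tau" "(r, c + 1) \<in> ferrers tau" "(r, c) \<in> ferrers tau"
    using d by (auto intro!: ferrers_downward[OF f])
  have "T (r + d, c + d) \<le> T (r + 1, c + 1)" using tab_le[OF T f, of "r + 1" "c + 1"] d by auto
  moreover have "T (r + 1, c + 1) < T (r + 1, c)" "T (r + 1, c + 1) < T (r, c + 1)"
    "T (r + 1, c) < T (r, c)" "T (r, c + 1) < T (r, c)"
    using T f1 unfolding RSYT_def by auto
  moreover have "T (r + 1, c) \<noteq> T (r, c + 1)" using tab_inj[OF T f1(2), of "(r, c + 1)"] by auto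
  ultimately show ?thesis by linarith
qed

text \<open>Equal contents mean a common diagonal. The gap 3 separates the contents not only of
  neighbours but also of \<open>i\<close> and \<open>i + 2\<close>, which the braid relation
  requires.\<close>

lemma content_eq_dist:
  assumes T: "T \<in> R" and ij: "i \<in> {1..N}" "j \<in> {1..N}" "i < j" and eq: "content i T = content j T"
  shows "i + 3 \<le> j" "\<exists>d>0. cell T i = (rowT j T + d, colT j T + d)"
proof -
  obtain r c where x: "cell T i = (r, c)" by fastforce
  obtain r' c' where y: "cell T j = (r', c')" by fastforce
  have x': "(r, c) \<in> ferrers tau" "T (r, c) = i" using cell_props[OF T, of i] ij x by auto
  have y': "(r', c') \<in> ferrers tau" "T (r', c') = j" using cell_props[OF T, of j] ij y by auto
  have e: "int c - int r = int c' - int r'" using eq x y unfolding content_def rowT_def colT_def by auto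
  have "\<not> r \<le> r'" using tab_le[OF T y'(1), of r c] e x' y' ij by auto
  then obtain d where d: "r = r' + d" "d > 0" using less_imp_add_positive by (metis not_le)
  with e have "c = c' + d" by auto
  with d tab_diag_less[OF T, of r' d c'] x' y' show "i + 3 \<le> j" by auto
  show "\<exists>d>0. cell T i = (rowT j T + d, colT j T + d)"
    using d \<open>c = c' + d\<close> x y unfolding rowT_def colT_def by auto
qed

text \<open>The cells are recovered from \<open>N\<close> downwards. If \<open>S\<close> places
  \<open>i\<close> further down the diagonal than \<open>T\<close>, then the cell of
  \<open>i\<close> in \<open>T\<close> carries a larger value in \<open>S\<close>, and that value
  already has the same cell in both tableaux.\<close>

lemma content_inj:
  assumes T: "T \<in> R" and S: "S \<in> R" and eq: "\<And>i. i \<in> {1..N} \<Longrightarrow> content i T = content i S"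
  shows "T = S"
proof -
  have no: False if T: "T \<in> R" and S: "S \<in> R" and i: "i \<in> {1..N}"
      and IH: "\<And>j. j \<in> {1..N} \<Longrightarrow> i < j \<Longrightarrow> cell T j = cell S j"
      and d: "d > 0" and c: "cell S i = (rowT i T + d, colT i T + d)" for T S i d
  proof -
    let ?x = "cell T i"
    have x: "?x \<in> ferrers tau" "T ?x = i" using cell_props[OF T i] by auto
    have y: "cell S i \<in> ferrers tau" "S (cell S i) = i" using cell_props[OF S i] by auto
    have "i < S ?x" using tab_diag_less[OF S, of "rowT i T" d "colT i T"] y d c
      unfolding rowT_def colT_def by auto
    then have "cell T (S ?x) = cell S (S ?x)" using IH tab_range[OF S x(1)] by blast
    also have "\<dots> = ?x" by (rule cell_unique[OF S x(1)])
    finally have "S ?x = i" using cell_props(2)[OF T tab_range[OF S x(1)]] x by auto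
    with \<open>i < S ?x\<close> show False by simp
  qed
  have cells: "cell T i = cell S i" if "i \<in> {1..N}" for i
    using that
  proof (induction "N - i" arbitrary: i rule: less_induct)
    case less
    have IH: "cell T j = cell S j" if "j \<in> {1..N}" "i < j" for j
      using less.hyps[of j] that less.prems by auto
    have e: "int (colT i T) - int (rowT i T) = int (colT i S) - int (rowT i S)"
      using eq[OF less.prems] unfolding content_def .
    consider "rowT i T = rowT i S" | "rowT i T < rowT i S" | "rowT i S < rowT i T" by linarith
    then show ?case
    proof cases
      case 1 then show ?thesis using e unfolding rowT_def colT_def by (auto simp: prod_eq_iff)
    next
      case 2
      then have "cell S i = (rowT i T + (rowT i S - rowT i T), colT i T + (rowT i S - rowT i T))"
        using e unfolding rowT_def colT_def by (auto simp: prod_eq_iff)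
      then show ?thesis using no[OF T S less.prems IH _ , of "rowT i S - rowT i T"] 2 by auto
    next
      case 3
      then have "cell T i = (rowT i S + (rowT i T - rowT i S), colT i S + (rowT i T - rowT i S))"
        using e unfolding rowT_def colT_def by (auto simp: prod_eq_iff)
      then show ?thesis using no[OF S T less.prems IH[symmetric], of "rowT i T - rowT i S"] 3 by auto
    qed
  qed
  show "T = S"
  proof
    fix x show "T x = S x"
    proof (cases "x \<in> ferrers tau")
      case True
      then have "cell S (T x) = x" using cells[OF tab_range[OF T True]] cell_unique[OF T True] by simp
      then show ?thesis using cell_props(2)[OF S tab_range[OF T True]] by simp
    next
      case False then show ?thesis using tab_outside[OF T] tab_outside[OF S] by simp
    qed
  qed
qed

text \<open>The path from the cell of \<open>N\<close> to the corner would raise the entry above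
  \<open>N\<close> unless it is empty. This starts the descending inductions in
  \<open>JM_diagonal\<close> and \<open>Dunkl_Z_zero\<close>.\<close>

lemma content_N:
  assumes T: "T \<in> R" and N: "0 < N" shows "content N T = 0"
proof -
  obtain r c where x: "cell T N = (r, c)" by fastforce
  have x': "(r, c) \<in> ferrers tau" "T (r, c) = N" using cell_props[OF T, of N] N x by auto
  have "T (r, c) + r + c \<le> T (0, 0)" using tab_le[OF T x'(1), of 0 0] by simp
  moreover have "T (0, 0) \<le> N" using tab_range[OF T ferrers_downward[OF x'(1)], of 0 0] by auto
  ultimately show ?thesis using x x' unfolding content_def rowT_def colT_def by auto
qed

lemma content_distinct:
  assumes "T \<in> R" "1 \<le> i" "Suc i \<le> N" shows "content i T \<noteq> content (Suc i) T"
  using content_eq_dist(1)[OF assms(1), of i "Suc i"] assms by auto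

lemma content_distinct2:
  assumes "T \<in> R" "1 \<le> i" "Suc (Suc i) \<le> N" shows "content i T \<noteq> content (Suc (Suc i)) T"
  using content_eq_dist(1)[OF assms(1), of i "Suc (Suc i)"] assms by auto

end

section \<open>Words in Coxeter generators and the seminormal representation\<close>

lemma word_perm_Nil [simp]: "word_perm [] = id"
  by (simp add: word_perm_def)

lemma word_perm_Cons: "word_perm (i # ws) = tp i (Suc i) \<circ> word_perm ws"
  by (simp add: word_perm_def)

lemma word_perm_append: "word_perm (us @ ws) = word_perm us \<circ> word_perm ws"
  by (induction us) (auto simp: word_perm_Cons)

lemma word_perm_rev: "word_perm (rev ws) \<circ> word_perm ws = id" "word_perm ws \<circ> word_perm (rev ws) = id"
  by (induction ws) (auto simp: word_perm_Cons word_perm_append fun_eq_iff)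

lemma word_perm_permutes: "set ws \<subseteq> {1..<n} \<Longrightarrow> word_perm ws permutes {1..n}"
  by (induction ws) (auto simp: word_perm_Cons permutes_id intro!: permutes_compose permutes_swap_id)

lemma word_perm_descending: "k \<le> n \<Longrightarrow> word_perm (rev [k..<n]) k = n"
  by (induction n) (auto simp: word_perm_Cons le_Suc_eq)

text \<open>A descending word that carries the preimage of the last point to the last point reduces
  the degree by one.\<close>

lemma permutes_imp_word:
  "p permutes {1..n} \<Longrightarrow> \<exists>ws. set ws \<subseteq> {1..<n} \<and> word_perm ws = p"
proof (induction n arbitrary: p)
  case 0
  then show ?case by (intro exI[of _ "[]"]) auto
next
  case (Suc n)
  define k where "k = inv p (Suc n)"
  have k: "p k = Suc n" "k \<in> {1..Suc n}"
    unfolding k_def using Suc.prems permutes_inverses(1) permutes_in_image[OF permutes_inv[OF Suc.prems]] by auto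
  define d where "d = rev [k..<Suc n]"
  have d: "set d \<subseteq> {1..<Suc n}" using k unfolding d_def by auto
  define q where "q = p \<circ> word_perm (rev d)"
  have "word_perm d k = Suc n" unfolding d_def using k by (intro word_perm_descending) auto
  then have "word_perm (rev d) (Suc n) = k"
    using word_perm_rev(1)[of d] by (metis comp_apply id_apply)
  then have "q (Suc n) = Suc n" unfolding q_def using k by simp
  moreover have "q permutes {1..Suc n}"
    unfolding q_def using d Suc.prems by (intro permutes_compose word_perm_permutes) auto
  ultimately have "q permutes {1..n}" by (elim permutes_superset) (auto simp: le_Suc_eq)
  from Suc.IH[OF this] obtain ws where "set ws \<subseteq> {1..<n}" "word_perm ws = q" by auto
  moreover from this have "word_perm (ws @ d) = p"
    by (simp add: word_perm_append q_def comp_assoc word_perm_rev)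
  ultimately show ?case using d by (intro exI[of _ "ws @ d"]) auto
qed

text \<open>The relations are demanded on \<open>A\<close> only: involution and braid relation of
  \<open>sg\<close> are proved for vectors supported on standard tableaux.\<close>

locale coxeter_action =
  fixes F :: "nat \<Rightarrow> 'a \<Rightarrow> 'a" and A :: "'a set" and M :: nat
  assumes closed: "1 \<le> i \<Longrightarrow> i < M \<Longrightarrow> x \<in> A \<Longrightarrow> F i x \<in> A"
    and involution: "1 \<le> i \<Longrightarrow> i < M \<Longrightarrow> x \<in> A \<Longrightarrow> F i (F i x) = x"
    and commute: "1 \<le> i \<Longrightarrow> Suc i < j \<Longrightarrow> j < M \<Longrightarrow> x \<in> A \<Longrightarrow> F i (F j x) = F j (F i x)"
    and braid: "1 \<le> i \<Longrightarrow> Suc i < M \<Longrightarrow> x \<in> A \<Longrightarrow> F i (F (Suc i) (F i x)) = F (Suc i) (F i (F (Suc i) x))"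
begin

lemma foldr_closed: "set ws \<subseteq> {1..<M} \<Longrightarrow> x \<in> A \<Longrightarrow> foldr F ws x \<in> A"
  by (induction ws) (auto intro: closed)

lemma foldr_commute:
  assumes "1 \<le> i" "i < M" "x \<in> A" "set ws \<subseteq> {1..<M}" "\<And>j. j \<in> set ws \<Longrightarrow> Suc i < j \<or> Suc j < i"
  shows "foldr F ws (F i x) = F i (foldr F ws x)"
  using assms(4,5)
proof (induction ws)
  case (Cons j ws)
  have "foldr F ws x \<in> A" using Cons.prems assms by (intro foldr_closed) auto
  then have "F j (F i (foldr F ws x)) = F i (F j (foldr F ws x))"
    using Cons.prems(2)[of j] Cons.prems(1) commute[of i j "foldr F ws x"] commute[of j i "foldr F ws x"] assms
    by (auto simp del: One_nat_def)
  then show ?case using Cons by auto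
qed simp

text \<open>The descending words are coset representatives. A new letter on their right cancels the
  last letter, prolongs the word, commutes to the left, or, lying inside the word, passes to the
  left by one braid move with its index lowered by one.\<close>

lemma normal_form:
  assumes "set ws \<subseteq> {1..n}" "n < M"
  shows "\<exists>u k. set u \<subseteq> {1..<n} \<and> 1 \<le> k \<and> k \<le> Suc n \<and>
    (\<forall>x\<in>A. foldr F ws x = foldr F (u @ rev [k..<Suc n]) x)"
  using assms(1)
proof (induction ws rule: rev_induct)
  case Nil
  show ?case by (intro exI[of _ "[]"] exI[of _ "Suc n"]) auto
next
  case (snoc i ws)
  then have i: "1 \<le> i" "i \<le> n" by auto
  from snoc obtain u k where u: "set u \<subseteq> {1..<n}" "1 \<le> k" "k \<le> Suc n"
    "\<And>x. x \<in> A \<Longrightarrow> foldr F ws x = foldr F (u @ rev [k..<Suc n]) x" by auto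
  have step: "foldr F (ws @ [i]) x = foldr F u (foldr F (rev [k..<Suc n]) (F i x))" if "x \<in> A" for x
    using u(4)[of "F i x"] closed[of i x] i that assms by simp
  consider "i = k" | "Suc i = k" | "Suc i < k" | "k < i" by linarith
  then show ?case
  proof cases
    case 1
    then have "rev [k..<Suc n] = rev [Suc k..<Suc n] @ [k]"
      using i by (subst upt_conv_Cons) auto
    then show ?thesis using u i step 1 involution assms
      by (intro exI[of _ u] exI[of _ "Suc k"]) (auto simp del: upt_Suc)
  next
    case 2
    then have "rev [i..<Suc n] = rev [k..<Suc n] @ [i]"
      using i by (subst upt_conv_Cons) auto
    then show ?thesis using u i step 2
      by (intro exI[of _ u] exI[of _ i]) (auto simp del: upt_Suc)
  next
    case 3
    have "foldr F (rev [k..<Suc n]) (F i x) = F i (foldr F (rev [k..<Suc n]) x)" if "x \<in> A" for x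
      using 3 i that assms u by (intro foldr_commute) auto
    then show ?thesis using u i step 3
      by (intro exI[of _ "u @ [i]"] exI[of _ k]) (auto simp del: upt_Suc)
  next
    case 4
    then obtain l where l: "i = Suc l" "k \<le> l" by (cases i) auto
    have split: "rev [k..<Suc n] = rev [Suc i..<Suc n] @ [i, l] @ rev [k..<l]"
    proof -
      have "[k..<Suc n] = [k..<l] @ [l..<Suc n]" using upt_add_eq_append[of k l "Suc n - l"] l i by auto
      also have "[l..<Suc n] = l # i # [Suc i..<Suc n]" using l i
        by (subst upt_conv_Cons, simp, subst upt_conv_Cons) auto
      finally show ?thesis by simp
    qed
    have "foldr F (rev [k..<Suc n]) (F i x) = F l (foldr F (rev [k..<Suc n]) x)" if x: "x \<in> A" for x
    proof -
      let ?y = "foldr F (rev [k..<l]) x"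
      have y: "?y \<in> A" using x u i l assms by (intro foldr_closed) auto
      have "foldr F (rev [k..<l]) (F i x) = F i ?y"
        using x u i l assms by (intro foldr_commute) auto
      then have "foldr F (rev [k..<Suc n]) (F i x) = foldr F (rev [Suc i..<Suc n]) (F i (F l (F i ?y)))"
        unfolding split by simp
      also have "F i (F l (F i ?y)) = F l (F i (F l ?y))"
        using braid[of l ?y] l u i assms y by simp
      also have "foldr F (rev [Suc i..<Suc n]) (F l (F i (F l ?y))) = F l (foldr F (rev [Suc i..<Suc n]) (F i (F l ?y)))"
        using y u i l assms by (intro foldr_commute closed) auto
      finally show ?thesis unfolding split by simp
    qed
    then show ?thesis using u i step l
      by (intro exI[of _ "u @ [l]"] exI[of _ k]) (auto simp del: upt_Suc)
  qed
qed

lemma coxeter_action_product: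
  "coxeter_action (\<lambda>i (p, x). (tp i (Suc i) p, F i x)) (UNIV \<times> A) M"
proof
  fix i j and y :: "nat \<times> 'a" assume "1 \<le> i" "Suc i < j" "j < M" "y \<in> UNIV \<times> A"
  then show "(case case y of (p, x) \<Rightarrow> (tp j (Suc j) p, F j x) of (p, x) \<Rightarrow> (tp i (Suc i) p, F i x)) =
    (case case y of (p, x) \<Rightarrow> (tp i (Suc i) p, F i x) of (p, x) \<Rightarrow> (tp j (Suc j) p, F j x))"
    using commute by (auto simp: transpose_def)
next
  fix i and y :: "nat \<times> 'a" assume "1 \<le> i" "Suc i < M" "y \<in> UNIV \<times> A"
  then show "(case case case y of (p, x) \<Rightarrow> (tp i (Suc i) p, F i x) of (p, x) \<Rightarrow> (tp (Suc i) (Suc (Suc i)) p, F (Suc i) x) of (p, x) \<Rightarrow> (tp i (Suc i) p, F i x)) =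
    (case case case y of (p, x) \<Rightarrow> (tp (Suc i) (Suc (Suc i)) p, F (Suc i) x) of (p, x) \<Rightarrow> (tp i (Suc i) p, F i x) of (p, x) \<Rightarrow> (tp (Suc i) (Suc (Suc i)) p, F (Suc i) x))"
    using braid by (auto simp: transpose_def)
qed (auto intro: closed simp: involution)

text \<open>Applying the normal form to the product action reads off, from the permutation component, that
  the descending tail of the normal form of a trivial word is empty.\<close>

lemma foldr_trivial:
  assumes "set ws \<subseteq> {1..<n}" "n \<le> M" "word_perm ws = id" "x \<in> A"
  shows "foldr F ws x = x"
  using assms(1-3)
proof (induction n arbitrary: ws)
  case 0 then show ?case by (cases ws) auto
next
  case (Suc n)
  let ?F = "\<lambda>i (p, x). (tp i (Suc i) p, F i x)"
  have F: "foldr ?F us (p, y) = (word_perm us p, foldr F us y)" for us p y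
    by (induction us) (auto simp: word_perm_Cons)
  interpret prod: coxeter_action ?F "UNIV \<times> A" M by (rule coxeter_action_product)
  have "\<exists>u k. set u \<subseteq> {1..<n} \<and> 1 \<le> k \<and> k \<le> Suc n \<and>
    (\<forall>z\<in>UNIV \<times> A. foldr ?F ws z = foldr ?F (u @ rev [k..<Suc n]) z)"
    by (rule prod.normal_form) (use Suc.prems in auto)
  then obtain u k where u: "set u \<subseteq> {1..<n}" "1 \<le> k" "k \<le> Suc n"
    and eq: "\<And>z. z \<in> UNIV \<times> A \<Longrightarrow> foldr ?F ws z = foldr ?F (u @ rev [k..<Suc n]) z" by blast
  have e: "word_perm ws p = word_perm (u @ rev [k..<Suc n]) p" "foldr F ws x = foldr F (u @ rev [k..<Suc n]) x" for p
    using eq[of "(p, x)"] assms(4) unfolding F by auto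
  have "word_perm (u @ rev [k..<Suc n]) k = word_perm u (Suc n)"
    using word_perm_descending[of k "Suc n"] u by (simp add: word_perm_append del: upt_Suc)
  also have "\<dots> = Suc n"
    using word_perm_permutes[OF u(1)] by (rule permutes_not_in) auto
  finally have "k = Suc n" using e(1)[of k] Suc.prems by simp
  with e have "word_perm u = id" "foldr F ws x = foldr F u x" using Suc.prems by auto
  then show ?case using Suc.IH[of u] u Suc.prems by auto
qed

lemma foldr_rev:
  assumes "set ws \<subseteq> {1..<M}" "x \<in> A"
  shows "foldr F ws (foldr F (rev ws) x) = x"
  using assms
proof (induction ws arbitrary: x)
  case (Cons i ws)
  have "F i x \<in> A" using Cons.prems by (intro closed) auto
  then have "foldr F ws (foldr F (rev (i # ws)) x) = F i x" using Cons by simp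
  then show ?case using Cons.prems involution by auto
qed simp

lemma foldr_cong_perm:
  assumes "set ws \<subseteq> {1..<M}" "set ws' \<subseteq> {1..<M}" "word_perm ws = word_perm ws'" "x \<in> A"
  shows "foldr F ws x = foldr F ws' x"
proof -
  have "word_perm (rev ws' @ ws) = id" unfolding word_perm_append assms(3) by (rule word_perm_rev)
  then have "foldr F (rev ws' @ ws) x = x" using assms by (intro foldr_trivial[of _ M]) auto
  then have "foldr F ws' (foldr F (rev ws') (foldr F ws x)) = foldr F ws' x" by simp
  then show ?thesis using foldr_rev[OF assms(2) foldr_closed[OF assms(1,4)]] by simp
qed

end

text \<open>The off-diagonal coefficient of the seminormal form. It vanishes at \<open>\<plusminus>1\<close>, which are the content
  differences for which \<open>swapT i T\<close> is not a tableau; hence \<open>sg\<close>, the transposed matrix of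
  \<open>\<tau>(s\<^sub>i)\<close> acting on coefficient functions, needs no side condition.\<close>

definition gfac :: "int \<Rightarrow> K" where "gfac b = (if b \<ge> 2 then 1 else 1 - 1 / (of_int b)\<^sup>2)"

definition sg :: "nat \<Rightarrow> vec \<Rightarrow> vec" where
  "sg i v = (\<lambda>T. v T / of_int (content i T - content (Suc i) T)
     + gfac (content (Suc i) T - content i T) * v (swapT i T))"

lemma gfac_1 [simp]: "gfac 1 = 0" "gfac (-1) = 0"
  by (simp_all add: gfac_def)

lemma gfac_mult: "b \<noteq> 0 \<Longrightarrow> gfac b * gfac (- b) = 1 - 1 / (of_int b)\<^sup>2"
  by (cases "b = 1 \<or> b = -1") (auto simp: gfac_def)

lemma gfac_mult': "a \<noteq> b \<Longrightarrow> gfac (a - b) * gfac (b - a) = 1 - 1 / (of_int (a - b))\<^sup>2"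
  using gfac_mult[of "a - b"] by simp

context partition_shape
begin

definition V :: "vec set" where "V = {v. \<forall>T. T \<notin> R \<longrightarrow> v T = 0}"

lemma swapT_notin_R:
  assumes "T \<in> R" "1 \<le> i" "Suc i \<le> N" "swapT i T \<notin> R"
  shows "gfac (content i T - content (Suc i) T) = 0" "gfac (content (Suc i) T - content i T) = 0"
proof -
  have "content i T - content (Suc i) T = 1 \<or> content i T - content (Suc i) T = -1"
    by (cases rule: content_diff_cases[OF assms(1-3)]) (use assms(4) in auto)
  then have "(content i T - content (Suc i) T = 1 \<and> content (Suc i) T - content i T = -1) \<or>
    (content i T - content (Suc i) T = -1 \<and> content (Suc i) T - content i T = 1)" by auto
  then show "gfac (content i T - content (Suc i) T) = 0" "gfac (content (Suc i) T - content i T) = 0"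
    by (auto simp only: gfac_1)
qed

lemma sgen_coeff_eq:
  assumes "T \<in> R" "1 \<le> i" "Suc i \<le> N"
  shows "sgen_coeff i T T' = (if T' = T then 1 / of_int (content i T - content (Suc i) T) else 0)
    + (if T' = swapT i T then gfac (content i T - content (Suc i) T) else 0)"
  by (cases rule: content_diff_cases[OF assms])
    (auto simp: sgen_coeff_def gfac_def Let_def)

text \<open>The coefficient at a tableau receives contributions from itself and from its swap. The
  content difference of the swap is the negative one, whence the reversed argument of
  \<open>gfac\<close> in \<open>sg\<close>.\<close>

lemma tau_gen_eq:
  assumes v: "v \<in> V" and i: "1 \<le> i" "Suc i \<le> N"
  shows "tau_gen tau i v = sg i v"
proof
  fix T'
  let ?b = "\<lambda>T. content i T - content (Suc i) T"
  have "tau_gen tau i v T' = (\<Sum>T\<in>R. (if T = T' then v T / of_int (?b T) else 0)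
      + (if T = swapT i T' then v T * gfac (?b T) else 0))"
    unfolding tau_gen_def
  proof (rule sum.cong)
    fix T assume "T \<in> R"
    moreover have "T' = swapT i T \<longleftrightarrow> T = swapT i T'" by (metis swapT_swapT)
    ultimately show "v T * sgen_coeff i T T' = (if T = T' then v T / of_int (?b T) else 0)
      + (if T = swapT i T' then v T * gfac (?b T) else 0)"
      using i by (auto simp: sgen_coeff_eq algebra_simps)
  qed simp
  also have "\<dots> = (if T' \<in> R then v T' / of_int (?b T') else 0)
      + (if swapT i T' \<in> R then v (swapT i T') * gfac (?b (swapT i T')) else 0)"
    by (simp add: sum.distrib)
  also have "\<dots> = sg i v T'" using v unfolding V_def sg_def by auto
  finally show "tau_gen tau i v T' = sg i v T'" .
qed

lemma sg_closed:
  assumes v: "v \<in> V" and i: "1 \<le> i" "Suc i \<le> N" shows "sg i v \<in> V"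
  unfolding V_def
proof (intro CollectI allI impI)
  fix T assume T: "T \<notin> R"
  show "sg i v T = 0"
  proof (cases "swapT i T \<in> R")
    case True
    then show ?thesis using swapT_notin_R(1)[OF True i] T v unfolding sg_def V_def by simp
  next
    case False
    then show ?thesis using T v unfolding sg_def V_def by auto
  qed
qed

lemma V_eqI: "v \<in> V \<Longrightarrow> w \<in> V \<Longrightarrow> (\<And>T. T \<in> R \<Longrightarrow> v T = w T) \<Longrightarrow> v = w"
  unfolding V_def by fastforce

lemma sg_involution:
  assumes v: "v \<in> V" and i: "1 \<le> i" "Suc i \<le> N" shows "sg i (sg i v) = v"
proof (rule V_eqI)
  fix T assume T: "T \<in> R"
  define a b where "a = content i T" "b = content (Suc i) T"
  have ab: "a \<noteq> b" using content_distinct[OF T i] unfolding a_b_def .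
  define d :: K where "d = of_int (a - b)"
  have m: "of_int (b - a) = - d" unfolding d_def by simp
  have "sg i (sg i v) T = (v T / d + gfac (b - a) * v (swapT i T)) / d
      + gfac (b - a) * (v (swapT i T) / (- d) + gfac (a - b) * v T)"
    unfolding sg_def by (simp only: content_swapT transpose_apply_first transpose_apply_second swapT_swapT
      a_b_def[symmetric] d_def[symmetric] m)
  then have "sg i (sg i v) T = (1 / (of_int (a - b))\<^sup>2 + gfac (a - b) * gfac (b - a)) * v T"
    unfolding d_def[symmetric] by (simp add: algebra_simps add_divide_distrib power2_eq_square)
  then show "sg i (sg i v) T = v T" using gfac_mult'[OF ab] by simp
qed (use assms sg_closed in auto)

lemma sg_commute:
  assumes "Suc i < j" shows "sg i (sg j v) = sg j (sg i v)"
proof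
  fix T
  have "content k (swapT i T) = content k T" if "k \<noteq> i" "k \<noteq> Suc i" for k i and T :: tab
    using that by simp
  note c = this
  show "sg i (sg j v) T = sg j (sg i v) T"
    using assms unfolding sg_def
    by (simp add: swapT_commute[OF assms] c algebra_simps add_divide_distrib diff_divide_distrib del: content_swapT)
qed

text \<open>Both sides, evaluated at \<open>T\<close>, are combinations of the values of
  \<open>v\<close> at the six fillings that permute \<open>i\<close>, \<open>i + 1\<close>,
  \<open>i + 2\<close>; the coefficients depend on the three contents only and are compared one by
  one.\<close>

lemma sg_braid:
  assumes v: "v \<in> V" and i: "1 \<le> i" "Suc (Suc i) \<le> N"
  shows "sg i (sg (Suc i) (sg i v)) = sg (Suc i) (sg i (sg (Suc i) v))"
proof (rule V_eqI)
  fix T assume T: "T \<in> R"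
  define a b c where "a = content i T" "b = content (Suc i) T" "c = content (Suc (Suc i)) T"
  define x y z :: K where "x = of_int (a - b)" "y = of_int (b - c)" "z = of_int (a - c)"
  define gx gx' gy gy' gz where "gx = gfac (b - a)" "gx' = gfac (a - b)" "gy = gfac (c - b)" "gy' = gfac (b - c)" "gz = gfac (c - a)"
  have ne: "a \<noteq> b" "b \<noteq> c" "a \<noteq> c"
    using content_distinct[OF T, of i] content_distinct[OF T, of "Suc i"] content_distinct2[OF T, of i] i
    unfolding a_b_c_def by auto
  then have ne': "x \<noteq> 0" "y \<noteq> 0" "z \<noteq> 0" unfolding x_y_z_def by auto
  have z: "z = x + y" unfolding x_y_z_def by simp
  have gg: "gx' * gx = 1 - 1 / x\<^sup>2" "gy' * gy = 1 - 1 / y\<^sup>2"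
    unfolding gx_gx'_gy_gy'_gz_def x_y_z_def using gfac_mult'[OF ne(1)] gfac_mult'[OF ne(2)] by auto
  define v0 v1 v2 v12 v21 v121 where "v0 = v T" "v1 = v (swapT i T)" "v2 = v (swapT (Suc i) T)"
    "v12 = v (swapT i (swapT (Suc i) (swapT i T)))" "v21 = v (swapT (Suc i) (swapT i T))" "v121 = v (swapT i (swapT (Suc i) T))"
  have t: "tp i (Suc i) (Suc (Suc i)) = Suc (Suc i)"
    "tp (Suc i) (Suc (Suc i)) i = i"
    by (auto simp: transpose_def)
  have m: "of_int (b - a) = - x" "of_int (c - b) = - y" unfolding x_y_z_def by auto
  have 1: "sg i (sg (Suc i) (sg i v)) T =
      ((v0 / x + gx * v1) / y + gy * (v2 / z + gz * v121)) / x
      + gx * ((v1 / (- x) + gx' * v0) / z + gz * (v21 / y + gy * v12))"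
    unfolding sg_def
    by (simp only: content_swapT t transpose_apply_first transpose_apply_second swapT_swapT a_b_c_def[symmetric]
      x_y_z_def[symmetric] gx_gx'_gy_gy'_gz_def[symmetric] v0_v1_v2_v12_v21_v121_def[symmetric] m)
  have 2: "sg (Suc i) (sg i (sg (Suc i) v)) T =
      ((v0 / y + gy * v2) / x + gx * (v1 / z + gz * v21)) / y
      + gy * ((v2 / (- y) + gy' * v0) / z + gz * (v121 / x + gx * v12))"
    unfolding sg_def
    by (simp only: content_swapT t transpose_apply_first transpose_apply_second swapT_swapT a_b_c_def[symmetric]
      swapT_braid[symmetric]
      x_y_z_def[symmetric] gx_gx'_gy_gy'_gz_def[symmetric] v0_v1_v2_v12_v21_v121_def[symmetric] m)
  \<comment> \<open>Partial fractions, valid because the content differences satisfy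
    \<open>z = x + y\<close>.\<close>
  have e: "1 / (x * y) - 1 / (x * z) = 1 / (y * z)" "1 / (x * y) - 1 / (y * z) = 1 / (x * z)"
    "1 / (x\<^sup>2 * y) + (1 - 1 / x\<^sup>2) / z = 1 / (x * y\<^sup>2) + (1 - 1 / y\<^sup>2) / z"
  proof -
    have xy: "x + y \<noteq> 0" using ne' z by simp
    show "1 / (x * y) - 1 / (x * z) = 1 / (y * z)" "1 / (x * y) - 1 / (y * z) = 1 / (x * z)"
      "1 / (x\<^sup>2 * y) + (1 - 1 / x\<^sup>2) / z = 1 / (x * y\<^sup>2) + (1 - 1 / y\<^sup>2) / z"
      using ne' xy unfolding z by (simp_all add: divide_simps) algebra+
  qed
  have "sg i (sg (Suc i) (sg i v)) T = v0 * (1 / (x\<^sup>2 * y) + (gx' * gx) / z) + gx * v1 * (1 / (x * y) - 1 / (x * z))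
     + gy * v2 * (1 / (x * z)) + gy * gz * v121 / x + gx * gz * v21 / y + gx * gy * gz * v12"
    unfolding 1 by (simp add: algebra_simps add_divide_distrib diff_divide_distrib power2_eq_square)
  also have "\<dots> = v0 * (1 / (x * y\<^sup>2) + (gy' * gy) / z) + gx * v1 * (1 / (y * z))
     + gy * v2 * (1 / (x * y) - 1 / (y * z)) + gy * gz * v121 / x + gx * gz * v21 / y + gx * gy * gz * v12"
    unfolding gg e ..
  also have "\<dots> = sg (Suc i) (sg i (sg (Suc i) v)) T"
    unfolding 2 by (simp add: algebra_simps add_divide_distrib diff_divide_distrib power2_eq_square)
  finally show "sg i (sg (Suc i) (sg i v)) T = sg (Suc i) (sg i (sg (Suc i) v)) T" .
qed (use assms sg_closed in auto)

sublocale cox: coxeter_action sg V N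
  by standard (use sg_closed sg_involution sg_commute sg_braid in auto)

lemma tau_word_eq: "set ws \<subseteq> {1..<N} \<Longrightarrow> v \<in> V \<Longrightarrow> tau_word tau ws v = foldr sg ws v"
proof (induction ws)
  case (Cons i ws)
  then show ?case using tau_gen_eq[OF cox.foldr_closed[of ws v]] by (simp add: tau_word_def)
qed (simp add: tau_word_def)

text \<open>The word picked by \<open>SOME\<close> may be replaced by any word for the same
  permutation, since the Coxeter relations hold.\<close>

lemma tau_perm_word:
  assumes "set ws \<subseteq> {1..<N}" "v \<in> V" shows "tau_perm tau (word_perm ws) v = foldr sg ws v"
proof -
  define us where "us = (SOME us. set us \<subseteq> {1..<N} \<and> word_perm us = word_perm ws)"
  have "set us \<subseteq> {1..<N} \<and> word_perm us = word_perm ws"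
    unfolding us_def by (rule someI[of _ ws]) (use assms in auto)
  then show ?thesis unfolding tau_perm_def us_def[symmetric]
    using assms cox.foldr_cong_perm[of us ws v] by (simp add: tau_word_eq)
qed

lemma tau_perm_closed [simp, intro]:
  assumes "w permutes {1..N}" "v \<in> V" shows "tau_perm tau w v \<in> V"
proof -
  obtain ws where "set ws \<subseteq> {1..<N}" "word_perm ws = w" using permutes_imp_word[OF assms(1)] by auto
  then show ?thesis using tau_perm_word cox.foldr_closed assms by metis
qed

lemma tau_perm_comp:
  assumes "u permutes {1..N}" "w permutes {1..N}" "v \<in> V"
  shows "tau_perm tau u (tau_perm tau w v) = tau_perm tau (u \<circ> w) v"
proof -
  obtain ws where ws: "set ws \<subseteq> {1..<N}" "word_perm ws = w" using permutes_imp_word[OF assms(2)] by auto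
  obtain us where us: "set us \<subseteq> {1..<N}" "word_perm us = u" using permutes_imp_word[OF assms(1)] by auto
  have "tau_perm tau (word_perm (us @ ws)) v = foldr sg (us @ ws) v"
    using ws us assms by (intro tau_perm_word) auto
  then show ?thesis using ws us tau_perm_word[OF ws(1) assms(3)]
      tau_perm_word[OF us(1) cox.foldr_closed[OF ws(1) assms(3)]]
    by (simp add: word_perm_append)
qed

lemma tau_perm_id [simp]: "v \<in> V \<Longrightarrow> tau_perm tau id v = v"
  using tau_perm_word[of "[]"] by simp

lemma tau_perm_adjacent:
  assumes "v \<in> V" "1 \<le> i" "Suc i \<le> N"
  shows "tau_perm tau (tp i (Suc i)) v = sg i v"
  using tau_perm_word[of "[i]"] assms by (simp add: word_perm_Cons)

lemma tau_perm_sum: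
  "tau_perm tau w (\<lambda>T. \<Sum>x\<in>B. c x * f x T) = (\<lambda>T. \<Sum>x\<in>B. c x * tau_perm tau w (f x) T)"
proof -
  have gen: "tau_gen tau i (\<lambda>T. \<Sum>x\<in>B. c x * f x T) = (\<lambda>T. \<Sum>x\<in>B. c x * tau_gen tau i (f x) T)" for i f
    unfolding tau_gen_def
    by (rule ext) (simp add: sum_distrib_left sum_distrib_right sum.swap[of _ R] mult.assoc)
  have "tau_word tau ws (\<lambda>T. \<Sum>x\<in>B. c x * f x T) = (\<lambda>T. \<Sum>x\<in>B. c x * tau_word tau ws (f x) T)" for ws
    unfolding tau_word_def by (induction ws) (simp_all add: gen)
  then show ?thesis unfolding tau_perm_def by simp
qed

end

section \<open>Jucys-Murphy elements and the form on the tableau space\<close>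

text \<open>Otherwise \<open>{1..N}\<close> is rewritten to \<open>{Suc 0..N}\<close> and facts about it no longer match.\<close>

declare One_nat_def [simp del]

context partition_shape
begin

lemma tp_permutes [simp, intro]: "i \<in> {1..N} \<Longrightarrow> j \<in> {1..N} \<Longrightarrow> tp i j permutes {1..N}"
  by (rule permutes_swap_id)

lemma tp_comp_conj: "bij w \<Longrightarrow> w \<circ> tp i j = tp (w i) (w j) \<circ> w"
  by (auto simp: fun_eq_iff transpose_def bij_def inj_eq)

lemma sg_sum: "sg i (\<lambda>T. \<Sum>x\<in>B. f x T) = (\<lambda>T. \<Sum>x\<in>B. sg i (f x) T)"
  unfolding sg_def by (rule ext) (simp add: sum.distrib sum_divide_distrib sum_distrib_left)

lemma V_sum: "(\<And>x. x \<in> B \<Longrightarrow> f x \<in> V) \<Longrightarrow> (\<lambda>T. \<Sum>x\<in>B. f x T) \<in> V"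
  and V_scale: "v \<in> V \<Longrightarrow> (\<lambda>T. h T * v T) \<in> V"
  unfolding V_def by auto

lemma basisv_V [simp, intro]: "T \<in> R \<Longrightarrow> basisv T \<in> V"
  unfolding V_def basisv_def by auto

text \<open>The Jucys-Murphy element, summed over larger indices because in a reverse tableau it is
  \<open>N\<close> that sits in the corner.\<close>

definition JM :: "nat \<Rightarrow> vec \<Rightarrow> vec" where
  "JM i v = (\<lambda>T. \<Sum>j\<in>{Suc i..N}. tau_perm tau (tp i j) v T)"

lemma JM_closed: "v \<in> V \<Longrightarrow> i \<in> {1..N} \<Longrightarrow> JM i v \<in> V"
  unfolding JM_def by (intro V_sum) auto

lemma JM_step:
  assumes v: "v \<in> V" and i: "1 \<le> i" "Suc i \<le> N"
  shows "JM i v = (\<lambda>T. sg i (JM (Suc i) (sg i v)) T + sg i v T)"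
proof -
  let ?s = "tp i (Suc i)"
  have sv: "sg i v \<in> V" using sg_closed v i by auto
  have "sg i (JM (Suc i) (sg i v)) = (\<lambda>T. \<Sum>j\<in>{Suc (Suc i)..N}. sg i (tau_perm tau (tp (Suc i) j) (sg i v)) T)"
    unfolding JM_def by (rule sg_sum)
  also have "\<dots> = (\<lambda>T. \<Sum>j\<in>{Suc (Suc i)..N}. tau_perm tau (tp i j) v T)"
  proof (intro ext sum.cong)
    fix T j assume j: "j \<in> {Suc (Suc i)..N}"
    have p: "tp (Suc i) j permutes {1..N}" "?s permutes {1..N}" using i j by auto
    have "?s \<circ> (tp (Suc i) j \<circ> ?s) = tp i j" using j by (auto simp: fun_eq_iff transpose_def)
    moreover have "sg i (tau_perm tau (tp (Suc i) j) (sg i v)) =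
      tau_perm tau ?s (tau_perm tau (tp (Suc i) j) (tau_perm tau ?s v))"
      using v sv i p by (simp add: tau_perm_adjacent)
    ultimately show "sg i (tau_perm tau (tp (Suc i) j) (sg i v)) T = tau_perm tau (tp i j) v T"
      using p v by (simp add: tau_perm_comp permutes_compose)
  qed simp
  moreover have "{Suc i..N} = insert (Suc i) {Suc (Suc i)..N}" using i by auto
  ultimately show ?thesis using v i
    by (simp add: JM_def fun_eq_iff tau_perm_adjacent)
qed

text \<open>Descending induction along \<open>JM_step\<close>, started by an empty sum and the
  content 0 of \<open>N\<close>.\<close>

lemma JM_diagonal:
  assumes "v \<in> V" "i \<in> {1..N}"
  shows "JM i v = (\<lambda>T. of_int (content i T) * v T)"
  using assms(2,1)
proof (induction "N - i" arbitrary: i v)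
  case 0
  then have i: "i = N" "0 < N" by auto
  show ?case
  proof (rule V_eqI)
    fix T assume "T \<in> R"
    then show "JM i v T = of_int (content i T) * v T"
      using content_N i by (simp add: JM_def)
  qed (use 0 in \<open>auto intro: JM_closed V_scale\<close>)
next
  case (Suc n)
  then have i: "1 \<le> i" "Suc i \<le> N" by auto
  let ?w = "sg i v"
  have w: "?w \<in> V" using sg_closed Suc.prems i by auto
  have IH: "JM (Suc i) ?w = (\<lambda>T. of_int (content (Suc i) T) * ?w T)"
    by (rule Suc.hyps(1)) (use Suc.hyps(2) w i in auto)
  show ?case
  proof (rule V_eqI)
    fix T assume T: "T \<in> R"
    let ?a = "content i T" and ?b = "content (Suc i) T"
    define d g :: K where "d = of_int (?a - ?b)" and "g = gfac (?b - ?a)"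
    have d: "d \<noteq> 0" using content_distinct[OF T i] unfolding d_def by simp
    have e: "of_int ?b = of_int ?a - d" unfolding d_def by simp
    \<comment> \<open>Involutivity of \<open>sg i\<close> at \<open>T\<close>. In the next line the
      swapped tableau brings in the content of \<open>i\<close>, and the summand \<open>?w T\<close>
      makes up the difference in the diagonal term.\<close>
    have inv: "?w T / d + g * ?w (swapT i T) = v T"
      using sg_involution[OF Suc.prems(2) i] unfolding d_def g_def by (subst (asm) sg_def) (simp add: fun_eq_iff)
    have "JM i v T = of_int ?b * ?w T / d + g * (of_int ?a * ?w (swapT i T)) + ?w T"
      unfolding JM_step[OF Suc.prems(2) i] IH by (subst sg_def) (simp add: d_def g_def)
    also have "\<dots> = of_int ?a * (?w T / d + g * ?w (swapT i T))"
      unfolding e using d by (simp add: algebra_simps diff_divide_distrib)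
    finally show "JM i v T = of_int (content i T) * v T" unfolding inv .
  qed (use Suc.prems in \<open>auto intro: JM_closed V_scale\<close>)
qed

section \<open>The invariant form on the tableau space\<close>

definition nrm :: "tab \<Rightarrow> K" where "nrm T = form0 tau T T"

definition formV :: "vec \<Rightarrow> vec \<Rightarrow> K" where
  "formV v w = (\<Sum>T\<in>R. v T * w T * nrm T)"

text \<open>A factor of the norm product, extended by 1 so that the product runs over a set of pairs
  independent of the tableau.\<close>

definition hfac :: "int \<Rightarrow> K" where "hfac d = (if d \<le> -2 then 1 - 1 / (of_int d)\<^sup>2 else 1)"

definition pairs :: "(nat \<times> nat) set" where "pairs = {(i, j). i \<in> {1..N} \<and> j \<in> {1..N} \<and> i < j}"

lemma finite_pairs [simp]: "finite pairs"
  by (rule finite_subset[of _ "{1..N} \<times> {1..N}"]) (auto simp: pairs_def)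

lemma nrm_eq: "nrm T = (\<Prod>(i, j)\<in>pairs. hfac (content i T - content j T))"
proof -
  let ?P = "{(i, j). i \<in> {1..N} \<and> j \<in> {1..N} \<and> i < j \<and> content i T \<le> content j T - 2}"
  have "nrm T = (\<Prod>(i, j)\<in>?P. 1 - 1 / (of_int (content i T - content j T))\<^sup>2)"
    unfolding nrm_def form0_def by simp
  also have "\<dots> = (\<Prod>(i, j)\<in>?P. hfac (content i T - content j T))"
    by (rule prod.cong) (auto simp: hfac_def)
  also have "\<dots> = (\<Prod>(i, j)\<in>pairs. hfac (content i T - content j T))"
    by (rule prod.mono_neutral_left) (auto simp: hfac_def pairs_def intro: finite_subset[OF _ finite_pairs] split: if_splits)
  finally show ?thesis .
qed

lemma nrm_nonzero [simp]: "nrm T \<noteq> 0"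
proof -
  have "hfac d \<noteq> 0" for d
  proof -
    have "(of_int d :: K)\<^sup>2 \<noteq> 1" if "d \<le> -2"
    proof -
      have "d\<^sup>2 \<noteq> 1" using that by (auto simp: power2_eq_1_iff)
      then have "(of_int (d\<^sup>2) :: K) \<noteq> of_int 1" by (subst of_int_eq_iff)
      then show ?thesis by simp
    qed
    then show ?thesis by (auto simp: hfac_def divide_simps)
  qed
  then show ?thesis unfolding nrm_eq by (auto simp: prod_zero_iff)
qed

text \<open>The transposition permutes all pairs other than \<open>(i, Suc i)\<close> and keeps them
  ordered, so the two norms differ in a single factor.\<close>

lemma nrm_swap:
  assumes "T \<in> R" "1 \<le> i" "Suc i \<le> N"
  shows "gfac (content i T - content (Suc i) T) * nrm (swapT i T) = gfac (content (Suc i) T - content i T) * nrm T"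
proof -
  let ?s = "tp i (Suc i)"
  let ?Q = "pairs - {(i, Suc i)}"
  let ?b = "content i T - content (Suc i) T"
  have mem: "(i, Suc i) \<in> pairs" using assms by (auto simp: pairs_def)
  have nrm: "nrm S = hfac (content i S - content (Suc i) S) * (\<Prod>(j, k)\<in>?Q. hfac (content j S - content k S))" for S
    unfolding nrm_eq by (subst prod.remove[OF _ mem]) auto
  have "(\<Prod>(j, k)\<in>?Q. hfac (content (?s j) T - content (?s k) T)) = (\<Prod>(j, k)\<in>?Q. hfac (content j T - content k T))"
  proof (rule prod.reindex_bij_witness[where i = "map_prod ?s ?s" and j = "map_prod ?s ?s"])
    fix a assume "a \<in> ?Q"
    then show "map_prod ?s ?s a \<in> ?Q" using assms by (auto simp: pairs_def transpose_def split: if_splits)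
    then show "map_prod ?s ?s a \<in> ?Q" .
  qed (auto simp: map_prod_def split: prod.splits)
  then have 1: "nrm (swapT i T) = hfac (- ?b) * (\<Prod>(j, k)\<in>?Q. hfac (content j T - content k T))"
    unfolding nrm by simp
  have "gfac ?b * hfac (- ?b) = gfac (- ?b) * hfac ?b"
    by (cases rule: content_diff_cases[OF assms])
      (auto simp: gfac_def hfac_def abs_if split: if_splits)
  then show ?thesis unfolding 1 nrm[of T] by simp
qed

lemma sg_selfadjoint:
  assumes v: "v \<in> V" "w \<in> V" and i: "1 \<le> i" "Suc i \<le> N"
  shows "formV (sg i v) w = formV v (sg i w)"
proof -
  let ?g = "\<lambda>T. gfac (content (Suc i) T - content i T)" and ?g' = "\<lambda>T. gfac (content i T - content (Suc i) T)"
  let ?Q = "{T\<in>R. swapT i T \<in> R}"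
  \<comment> \<open>Tableaux whose swap is not standard drop out, which leaves a set on which
    \<open>swapT i\<close> is an involution; \<open>nrm_swap\<close> then balances the off-diagonal
    entries.\<close>
  have restrict: "(\<Sum>T\<in>R. ?g T * v (swapT i T) * w T * nrm T) = (\<Sum>T\<in>?Q. ?g T * v (swapT i T) * w T * nrm T)"
    if "v \<in> V" for v w
    using that by (intro sum.mono_neutral_right) (auto simp: V_def)
  have "(\<Sum>T\<in>?Q. ?g T * v (swapT i T) * w T * nrm T) = (\<Sum>T\<in>?Q. ?g' T * v T * w (swapT i T) * nrm (swapT i T))"
    by (rule sum.reindex_bij_witness[where i = "swapT i" and j = "swapT i"]) auto
  also have "\<dots> = (\<Sum>T\<in>?Q. ?g T * w (swapT i T) * v T * nrm T)"
    using nrm_swap i by (intro sum.cong) auto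
  finally have "(\<Sum>T\<in>R. ?g T * v (swapT i T) * w T * nrm T) = (\<Sum>T\<in>R. ?g T * w (swapT i T) * v T * nrm T)"
    using restrict v by simp
  then show ?thesis unfolding formV_def sg_def by (simp add: algebra_simps sum.distrib)
qed

lemma formV_invariant:
  assumes p: "p permutes {1..N}" and v: "v \<in> V" "w \<in> V"
  shows "formV (tau_perm tau p v) (tau_perm tau p w) = formV v w"
proof -
  obtain ws where ws: "set ws \<subseteq> {1..<N}" "word_perm ws = p" using permutes_imp_word[OF p] by auto
  have "formV (foldr sg ws v) (foldr sg ws w) = formV v w" using ws(1)
  proof (induction ws)
    case (Cons i ws)
    have c: "foldr sg ws v \<in> V" "foldr sg ws w \<in> V" using Cons.prems v cox.foldr_closed by auto
    then show ?case using Cons sg_selfadjoint[of "foldr sg ws v" "sg i (foldr sg ws w)" i]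
      by (simp add: sg_closed sg_involution)
  qed simp
  then show ?thesis using tau_perm_word[OF ws(1)] v ws(2) by simp
qed

lemma formV_sym: "formV v w = formV w v"
  unfolding formV_def by (simp add: mult.commute)

lemma formV_basisv: "T \<in> R \<Longrightarrow> T' \<in> R \<Longrightarrow> formV (basisv T) (basisv T') = form0 tau T T'"
proof -
  assume T: "T \<in> R" "T' \<in> R"
  have "formV (basisv T) (basisv T') = (\<Sum>S\<in>R. if S = T then basisv T' T * nrm T else 0)"
    unfolding formV_def by (rule sum.cong) (auto simp: basisv_def)
  also have "\<dots> = basisv T' T * nrm T" using T by simp
  also have "\<dots> = form0 tau T T'" by (auto simp: basisv_def nrm_def form0_def)
  finally show ?thesis .
qed

end

section \<open>Divided differences of polynomials\<close>

abbreviation "lk \<equiv> Poly_Mapping.lookup"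
abbreviation "ks \<equiv> Poly_Mapping.keys"
abbreviation "sgl \<equiv> Poly_Mapping.single"

lemma exponent_induct [consumes 1, case_names zero add]:
  fixes e :: "nat \<Rightarrow>\<^sub>0 nat"
  assumes "ks e \<subseteq> S" "Q 0" "\<And>i e. i \<in> S \<Longrightarrow> ks e \<subseteq> S \<Longrightarrow> Q e \<Longrightarrow> Q (sgl i 1 + e)"
  shows "Q e"
  using assms(1)
proof (induction e rule: update_induct)
  case const show ?case by (rule assms(2))
next
  case (update e a b)
  then have a: "a \<in> S" "ks e \<subseteq> S" by (auto simp: keys_update)
  have "Q (sgl a n + e) \<and> ks (sgl a n + e) \<subseteq> S" for n
  proof (induction n)
    case (Suc n)
    have "sgl a (Suc n) + e = sgl a 1 + (sgl a n + e)"
      by (simp add: single_add[symmetric] add.assoc[symmetric] One_nat_def)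
    moreover have "ks (sgl a 1 + (sgl a n + e)) \<subseteq> S"
      using keys_add[of "sgl a 1" "sgl a n + e"] Suc a by (auto split: if_splits)
    ultimately show ?case using assms(3)[OF a(1)] Suc by simp
  qed (use update a in simp)
  moreover have "Poly_Mapping.update a b e = sgl a b + e"
    using update by (intro poly_mapping_eqI) (auto simp: lookup_update lookup_add lookup_single when_def in_keys_iff)
  ultimately show ?case by simp
qed

lemma const_mult_single [simp]: "const c * sgl a d = sgl a (c * d)"
  by (simp add: const_def mult_single)

lemma const_add: "const (c + d) = const c + const d"
  and const_mult: "const (c * d) = const c * const d"
  and const_0 [simp]: "const 0 = 0"
  and const_1 [simp]: "const 1 = 1"
  by (simp_all add: const_def single_add mult_single)

lemma const_sum: "const (sum f A) = (\<Sum>x\<in>A. const (f x))"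
  by (induction A rule: infinite_finite_induct) (auto simp: const_add)

lemma lookup_const_mult [simp]: "lk (const c * p) a = c * lk p a"
proof -
  have "const c * p = Poly_Mapping.map ((*) c) p"
    by (simp add: mult_map_scale_conv_mult const_def)
  then show ?thesis by (simp add: map.rep_eq when_def)
qed

lemma Xv_mult_single: "Xv i * sgl a c = sgl (sgl i 1 + a) c"
  by (simp add: Xv_def mult_single)

lemma mpoly_single_induct [case_names single add]:
  assumes "\<And>a c. Q (sgl a c)" "\<And>p q. Q p \<Longrightarrow> Q q \<Longrightarrow> Q (p + q)"
  shows "Q (p :: mpoly)"
proof (induction p rule: update_induct)
  case const show ?case using assms(1)[of 0 0] by simp
next
  case (update e a b)
  have "Poly_Mapping.update a b e = sgl a b + e"
    using update by (intro poly_mapping_eqI) (auto simp: lookup_update lookup_add lookup_single when_def in_keys_iff)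
  then show ?case using assms update by simp
qed

definition PV :: "nat set \<Rightarrow> mpoly set" where "PV S = {p. \<forall>a\<in>ks p. ks a \<subseteq> S}"

lemma PV_induct [consumes 1, case_names const X add]:
  assumes "p \<in> PV S" "\<And>c. Q (const c)" "\<And>i p. i \<in> S \<Longrightarrow> p \<in> PV S \<Longrightarrow> Q p \<Longrightarrow> Q (Xv i * p)"
    "\<And>p q. Q p \<Longrightarrow> Q q \<Longrightarrow> Q (p + q)"
  shows "Q p"
  using assms(1)
proof (induction p rule: update_induct)
  case const show ?case using assms(2)[of 0] by simp
next
  case (update p a b)
  have eq: "Poly_Mapping.update a b p = sgl a b + p"
    using update by (intro poly_mapping_eqI) (auto simp: lookup_update lookup_add lookup_single when_def in_keys_iff)
  have "ks a \<subseteq> S" "p \<in> PV S" using update by (auto simp: PV_def keys_update)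
  moreover from this(1) have "Q (sgl a b)"
  proof (induction a rule: exponent_induct)
    case (add i e)
    then have "sgl e b \<in> PV S" by (auto simp: PV_def)
    then show ?case using assms(3) add by (simp add: Xv_mult_single[symmetric])
  qed (use assms(2)[of b] in \<open>simp add: const_def\<close>)
  ultimately show ?case using assms(4) update eq by auto
qed

lemma PV_UNIV [simp]: "p \<in> PV UNIV" by (simp add: PV_def)

lemmas mpoly_induct = PV_induct[OF PV_UNIV, case_names const X add]

lemma PV_zero [simp]: "0 \<in> PV S" by (simp add: PV_def)
lemma PV_const [simp]: "const c \<in> PV S" by (auto simp: PV_def const_def split: if_splits)
lemma PV_Xv: "i \<in> S \<Longrightarrow> Xv i \<in> PV S" by (auto simp: PV_def Xv_def)
lemma PV_add: "p \<in> PV S \<Longrightarrow> q \<in> PV S \<Longrightarrow> p + q \<in> PV S"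
  using keys_add[of p q] by (fastforce simp: PV_def)
lemma PV_uminus: "p \<in> PV S \<Longrightarrow> - p \<in> PV S"
  by (simp add: PV_def in_keys_iff)
lemma PV_diff: "p \<in> PV S \<Longrightarrow> q \<in> PV S \<Longrightarrow> p - q \<in> PV S"
  using PV_add[OF _ PV_uminus, of p S q] by simp
lemma PV_mult: "p \<in> PV S \<Longrightarrow> q \<in> PV S \<Longrightarrow> p * q \<in> PV S"
proof -
  assume a: "p \<in> PV S" "q \<in> PV S"
  have "ks x \<subseteq> S" if x: "x \<in> ks (p * q)" for x
  proof -
    obtain u w where "x = u + w" "u \<in> ks p" "w \<in> ks q" using subsetD[OF keys_mult x] by auto
    then show ?thesis using keys_add[of u w] a by (auto simp: PV_def)
  qed
  then show ?thesis by (simp add: PV_def)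
qed
lemma PV_sum: "(\<And>x. x \<in> A \<Longrightarrow> f x \<in> PV S) \<Longrightarrow> sum f A \<in> PV S"
  by (induction A rule: infinite_finite_induct) (auto intro: PV_add)

lemma rename_exp_add: "rename_exp w (a + b) = rename_exp w a + rename_exp w b"
  unfolding rename_exp_def by (rule setsum_keys_plus_distrib) (auto simp: single_add)

lemma rename_exp_single [simp]: "rename_exp w (sgl i n) = sgl (w i) n"
  unfolding rename_exp_def by simp

lemma rename_exp_0 [simp]: "rename_exp w 0 = 0"
  by (simp add: rename_exp_def)

lemma perm_poly_add: "perm_poly w (p + q) = perm_poly w p + perm_poly w q"
  unfolding perm_poly_def by (rule setsum_keys_plus_distrib) (auto simp: single_add)

lemma perm_poly_single: "perm_poly w (sgl a c) = sgl (rename_exp w a) c"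
  unfolding perm_poly_def by simp

lemma perm_poly_mult: "perm_poly w (p * q) = perm_poly w p * perm_poly w q"
proof (induction p rule: mpoly_single_induct)
  case (single a c)
  show ?case
    by (induction q rule: mpoly_single_induct)
      (auto simp: mult_single perm_poly_single rename_exp_add distrib_left perm_poly_add)
qed (simp add: distrib_right perm_poly_add)

lemma perm_poly_const [simp]: "perm_poly w (const c) = const c"
  by (simp add: const_def perm_poly_single)

lemma perm_poly_Xv [simp]: "perm_poly w (Xv i) = Xv (w i)"
  by (simp add: Xv_def perm_poly_single)

lemma perm_poly_0 [simp]: "perm_poly w 0 = 0"
  by (simp add: perm_poly_def)

lemma perm_poly_uminus: "perm_poly w (- p) = - perm_poly w p"
  using perm_poly_add[of w p "- p"] by (simp add: add_eq_0_iff)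

lemma perm_poly_diff: "perm_poly w (p - q) = perm_poly w p - perm_poly w q"
  using perm_poly_add[of w p "- q"] by (simp add: perm_poly_uminus)

lemma perm_poly_comp: "perm_poly u (perm_poly w p) = perm_poly (u \<circ> w) p"
  by (induction p rule: mpoly_induct) (simp_all add: perm_poly_add perm_poly_mult)

lemma perm_poly_id [simp]: "perm_poly id p = p"
  by (induction p rule: mpoly_induct) (simp_all add: perm_poly_add perm_poly_mult)

lemma pderiv_var_add: "pderiv_var i (p + q) = pderiv_var i p + pderiv_var i q"
  unfolding pderiv_var_def
  by (rule setsum_keys_plus_distrib) (auto simp: single_add[symmetric] algebra_simps)

lemma pderiv_var_single: "pderiv_var i (sgl a c) = sgl (a - sgl i 1) (of_nat (lk a i) * c)"
  unfolding pderiv_var_def by simp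

lemma pderiv_var_const [simp]: "pderiv_var i (const c) = 0"
  by (simp add: const_def pderiv_var_single)

lemma pderiv_var_Xv: "pderiv_var i (Xv j * p) = Xv j * pderiv_var i p + (if i = j then p else 0)"
proof (induction p rule: mpoly_single_induct)
  case (single a c)
  show ?case
  proof (cases "i = j")
    case True
    have "sgl i 1 + (a - sgl i 1) = a" if "lk a i \<noteq> 0"
      using that by (intro poly_mapping_eqI) (auto simp: lookup_add lookup_minus lookup_single when_def)
    then show ?thesis using True
      by (cases "lk a i = 0")
        (auto simp: pderiv_var_single Xv_mult_single lookup_add single_add[symmetric] algebra_simps)
  next
    case False
    have "sgl j 1 + a - sgl i 1 = sgl j 1 + (a - sgl i 1)" if "lk a i \<noteq> 0"
      using False by (intro poly_mapping_eqI) (auto simp: lookup_add lookup_minus lookup_single when_def)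
    then show ?thesis using False
      by (cases "lk a i = 0") (auto simp: pderiv_var_single Xv_mult_single lookup_add lookup_single)
  qed
qed (auto simp: pderiv_var_add distrib_left)

lemma pderiv_var_const_mult: "pderiv_var i (const c * p) = const c * pderiv_var i p"
  by (induction p rule: mpoly_single_induct)
    (auto simp: pderiv_var_add distrib_left pderiv_var_single algebra_simps)

lemma pderiv_var_perm: "inj w \<Longrightarrow> pderiv_var (w i) (perm_poly w p) = perm_poly w (pderiv_var i p)"
  by (induction p rule: mpoly_induct)
    (auto simp: pderiv_var_add perm_poly_add perm_poly_mult pderiv_var_Xv dest: injD)

lemma Xv_diff_nonzero: "i \<noteq> j \<Longrightarrow> Xv i - Xv j \<noteq> 0"
  unfolding Xv_def by (metis eq_iff_diff_eq_0 lookup_single_eq lookup_single_not_eq zero_neq_one)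

text \<open>The quotient is built by the twisted Leibniz rule, one variable at a time;
  \<open>r\<close> below is the divided difference of that variable.\<close>

lemma divdiff_ex: "\<exists>q. (Xv i - Xv j) * q = p - perm_poly (tp i j) p"
proof (induction p rule: mpoly_induct)
  case (const c)
  show ?case by (intro exI[of _ 0]) simp
next
  case (X k p)
  then obtain q where q: "(Xv i - Xv j) * q = p - perm_poly (tp i j) p" by blast
  define r :: mpoly where "r = (if k = i then 1 else if k = j then -1 else 0)"
  have "(Xv i - Xv j) * r = Xv k - Xv (tp i j k)" unfolding r_def by (auto simp: transpose_def)
  then have "(Xv i - Xv j) * (Xv k * q + r * perm_poly (tp i j) p)
    = Xv k * (p - perm_poly (tp i j) p) + (Xv k - Xv (tp i j k)) * perm_poly (tp i j) p"
    unfolding q[symmetric] by (simp add: distrib_left mult.assoc[symmetric])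
  then show ?case by (intro exI[of _ "Xv k * q + r * perm_poly (tp i j) p"]) (simp add: perm_poly_mult algebra_simps)
next
  case (add p q)
  then obtain a b where "(Xv i - Xv j) * a = p - perm_poly (tp i j) p" "(Xv i - Xv j) * b = q - perm_poly (tp i j) q"
    by blast
  then show ?case by (intro exI[of _ "a + b"]) (simp add: distrib_left perm_poly_add)
qed

lemma divdiff_unique:
  assumes "i \<noteq> j" "(Xv i - Xv j) * q = p - perm_poly (tp i j) p"
  shows "divdiff i j p = q"
  unfolding divdiff_def
proof (rule the_equality)
  fix r assume "(Xv i - Xv j) * r = p - perm_poly (tp i j) p"
  then have "(Xv i - Xv j) * r = (Xv i - Xv j) * q" using assms by simp
  then show "r = q" using Xv_diff_nonzero[OF assms(1)] by (simp only: mult_cancel_left simp_thms)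
qed fact

lemma divdiff_eq:
  assumes "i \<noteq> j" shows "(Xv i - Xv j) * divdiff i j p = p - perm_poly (tp i j) p"
proof -
  obtain q where "(Xv i - Xv j) * q = p - perm_poly (tp i j) p" using divdiff_ex by blast
  moreover from divdiff_unique[OF assms this] have "divdiff i j p = q" .
  ultimately show ?thesis by simp
qed

lemma divdiff_mult:
  assumes ij: "i \<noteq> j" and q: "(Xv i - Xv j) * r = q - perm_poly (tp i j) q"
  shows "divdiff i j (q * p) = q * divdiff i j p + r * perm_poly (tp i j) p"
proof (rule divdiff_unique[OF ij])
  have "(Xv i - Xv j) * (q * divdiff i j p + r * perm_poly (tp i j) p) =
     q * ((Xv i - Xv j) * divdiff i j p) + ((Xv i - Xv j) * r) * perm_poly (tp i j) p"
    by (simp only: distrib_left mult.assoc mult.left_commute)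
  then show "(Xv i - Xv j) * (q * divdiff i j p + r * perm_poly (tp i j) p) =
     q * p - perm_poly (tp i j) (q * p)"
    unfolding divdiff_eq[OF ij] q by (simp add: perm_poly_mult algebra_simps)
qed

lemma divdiff_Xv:
  assumes "i \<noteq> j"
  shows "divdiff i j (Xv k * p) = Xv k * divdiff i j p
    + (if k = i then perm_poly (tp i j) p else if k = j then - perm_poly (tp i j) p else 0)"
proof -
  define r :: mpoly where "r = (if k = i then 1 else if k = j then -1 else 0)"
  have "(Xv i - Xv j) * r = Xv k - perm_poly (tp i j) (Xv k)" unfolding r_def by (auto simp: transpose_def)
  from divdiff_mult[OF assms this, of p] show ?thesis unfolding r_def by auto
qed

lemma divdiff_symmetric_mult:
  assumes "i \<noteq> j" "perm_poly (tp i j) q = q" shows "divdiff i j (q * p) = q * divdiff i j p"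
  using divdiff_mult[OF assms(1), of 0 q p] assms(2) by simp

lemma divdiff_const_mult: "i \<noteq> j \<Longrightarrow> divdiff i j (const c * p) = const c * divdiff i j p"
  by (rule divdiff_symmetric_mult) auto

lemma divdiff_add: "i \<noteq> j \<Longrightarrow> divdiff i j (p + q) = divdiff i j p + divdiff i j q"
  by (rule divdiff_unique) (simp_all add: distrib_left divdiff_eq perm_poly_add)

lemma divdiff_const [simp]: "i \<noteq> j \<Longrightarrow> divdiff i j (const c) = 0"
  by (rule divdiff_unique) auto

lemma divdiff_perm:
  assumes "inj w" "i \<noteq> j"
  shows "divdiff (w i) (w j) (perm_poly w p) = perm_poly w (divdiff i j p)"
proof (rule divdiff_unique)
  have "w \<circ> tp i j = tp (w i) (w j) \<circ> w"
    using assms by (auto simp: fun_eq_iff transpose_def dest: injD)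
  then show "(Xv (w i) - Xv (w j)) * perm_poly w (divdiff i j p) =
    perm_poly w p - perm_poly (tp (w i) (w j)) (perm_poly w p)"
    using arg_cong[OF divdiff_eq[OF assms(2), of p], of "perm_poly w"]
    by (simp add: perm_poly_mult perm_poly_diff perm_poly_comp)
qed (use assms in \<open>auto dest: injD\<close>)

lemma PV_perm: "p \<in> PV S \<Longrightarrow> w permutes S \<Longrightarrow> perm_poly w p \<in> PV S"
  by (induction p rule: PV_induct)
    (auto simp: perm_poly_add perm_poly_mult permutes_in_image intro!: PV_add PV_mult PV_Xv)

lemma PV_pderiv: "p \<in> PV S \<Longrightarrow> pderiv_var i p \<in> PV S"
  by (induction p rule: PV_induct)
    (auto simp: pderiv_var_add pderiv_var_Xv intro: PV_add PV_mult PV_Xv)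

lemma PV_divdiff: "p \<in> PV S \<Longrightarrow> i \<noteq> j \<Longrightarrow> i \<in> S \<Longrightarrow> j \<in> S \<Longrightarrow> divdiff i j p \<in> PV S"
  by (induction p rule: PV_induct)
    (auto simp: divdiff_add divdiff_Xv intro!: PV_add PV_diff PV_mult PV_Xv PV_uminus PV_perm permutes_swap_id)

section \<open>Dunkl operators\<close>

notation psmul (infixr "\<odot>" 75)

lemma psmul_apply: "(c \<odot> f) T = const c * f T"
  by (simp add: psmul_def)

text \<open>These rules also rewrite eta-expanded functions, which hides sums of operators from the simplifier.\<close>

declare plus_fun_apply [simp del] zero_fun_apply [simp del] minus_apply [simp del] uminus_apply [simp del]
lemmas fun_apply = plus_fun_apply zero_fun_apply minus_apply uminus_apply psmul_apply
lemmas pointwise = fun_eq_iff fun_apply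

lemma padd_eq: "padd f g = f + g"
  by (simp add: padd_def pointwise)

interpretation pm: vector_space psmul
  by unfold_locales (simp_all add: pointwise distrib_left distrib_right const_add const_mult mult.assoc)

abbreviation "linop \<equiv> module_hom psmul psmul"

lemma linopI: "(\<And>f g. h (f + g) = h f + h g) \<Longrightarrow> (\<And>c f. h (c \<odot> f) = c \<odot> h f) \<Longrightarrow> linop h"
  by unfold_locales auto

lemmas linop_simps = module_hom.add module_hom.scale module_hom.zero module_hom.neg module_hom.diff module_hom.sum

definition Xop :: "nat \<Rightarrow> ptau \<Rightarrow> ptau" where "Xop i f = (\<lambda>T. Xv i * f T)"

lemma linop_Xop: "linop (Xop i)"
  by (rule linopI) (auto simp: Xop_def pointwise algebra_simps)

lemmas Xop_linear [simp] = linop_simps[OF linop_Xop]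

lemma Xop_commute: "Xop i (Xop j f) = Xop j (Xop i f)"
  by (simp add: Xop_def mult.left_commute)

lemma sum_fun_apply: "(sum f A) T = (\<Sum>x\<in>A. f x T)"
  by (induction A rule: infinite_finite_induct) (auto simp: fun_apply)

context partition_shape
begin

lemma liftV_add: "liftV tau L (\<lambda>T. f T + g T) = liftV tau L f + liftV tau L g"
  unfolding liftV_def by (auto simp: pointwise distrib_left sum.distrib)

lemma liftV_mult: "liftV tau L (\<lambda>T. p * f T) = (\<lambda>T. p * liftV tau L f T)"
  unfolding liftV_def by (auto simp: pointwise sum_distrib_left mult.left_commute)

text \<open>An operator on the polynomial factor commutes with one on the tableau factor.\<close>

lemma liftV_hom:
  assumes "\<And>p q. h (p + q) = h p + h q" "\<And>c p. h (const c * p) = const c * h p"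
  shows "liftV tau L (\<lambda>T. h (f T)) = (\<lambda>T. h (liftV tau L f T))"
proof -
  have h0: "h 0 = 0" using assms(2)[of 0 0] by simp
  have "h (sum g A) = (\<Sum>x\<in>A. h (g x))" for g and A :: "tab set"
    by (induction A rule: infinite_finite_induct) (auto simp: assms(1) h0)
  then show ?thesis unfolding liftV_def by (auto simp: pointwise assms(2) h0)
qed

lemma sum_basisv: "(\<And>T. T \<notin> R \<Longrightarrow> f T = 0) \<Longrightarrow> (\<Sum>S\<in>R. f S * (if T = S then 1 else 0)) = (f T :: 'b::semiring_1)"
  by (simp add: if_distrib cong: if_cong)

lemma basisv_expand: "v \<in> V \<Longrightarrow> v = (\<lambda>T. \<Sum>S\<in>R. v S * basisv S T)"
  by (rule ext) (simp add: basisv_def sum_basisv V_def)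

lemma tau_perm_expand: "v \<in> V \<Longrightarrow> tau_perm tau w v = (\<lambda>T. \<Sum>S\<in>R. v S * tau_perm tau w (basisv S) T)"
  using arg_cong[OF basisv_expand, of v "tau_perm tau w"] unfolding tau_perm_sum .

lemma liftV_comp:
  assumes "u permutes {1..N}" "w permutes {1..N}"
  shows "liftV tau (tau_perm tau u) (liftV tau (tau_perm tau w) f) = liftV tau (tau_perm tau (u \<circ> w)) f"
proof (rule ext)
  fix T
  show "liftV tau (tau_perm tau u) (liftV tau (tau_perm tau w) f) T = liftV tau (tau_perm tau (u \<circ> w)) f T"
  proof (cases "T \<in> R")
    case True
    have "(\<Sum>S\<in>R. const (tau_perm tau u (basisv S) T) * (\<Sum>Q\<in>R. const (tau_perm tau w (basisv Q) S) * f Q)) =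
      (\<Sum>Q\<in>R. const (\<Sum>S\<in>R. tau_perm tau w (basisv Q) S * tau_perm tau u (basisv S) T) * f Q)"
      unfolding sum_distrib_left sum_distrib_right const_sum const_mult
      by (subst sum.swap) (simp add: mult_ac)
    also have "\<dots> = (\<Sum>Q\<in>R. const (tau_perm tau (u \<circ> w) (basisv Q) T) * f Q)"
    proof (rule sum.cong)
      fix Q assume Q: "Q \<in> R"
      then have "tau_perm tau w (basisv Q) \<in> V" using assms by auto
      from tau_perm_expand[OF this, of u] show "const (\<Sum>S\<in>R. tau_perm tau w (basisv Q) S * tau_perm tau u (basisv S) T) * f Q =
         const (tau_perm tau (u \<circ> w) (basisv Q) T) * f Q"
        using tau_perm_comp[OF assms basisv_V[OF Q]] by simp
    qed simp
    finally show ?thesis using True by (simp add: liftV_def)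
  qed (simp add: liftV_def)
qed

lemma liftV_id: "(\<And>T. T \<notin> R \<Longrightarrow> f T = 0) \<Longrightarrow> liftV tau (tau_perm tau id) f = f"
proof (rule ext)
  fix T assume f: "\<And>T. T \<notin> R \<Longrightarrow> f T = 0"
  have "(\<Sum>S\<in>R. const (tau_perm tau id (basisv S) T) * f S) = (\<Sum>S\<in>R. f S * (if T = S then 1 else 0))"
    by (rule sum.cong) (simp_all, simp add: basisv_def)
  then show "liftV tau (tau_perm tau id) f T = f T" using f by (simp add: liftV_def sum_basisv)
qed

abbreviation A where "A \<equiv> act tau"
abbreviation D where "D \<equiv> Dunkl tau"
abbreviation sw where "sw i j \<equiv> act tau (tp i j)"
abbreviation P where "P \<equiv> Ptau tau"

lemma linop_act: "linop (A w)"
proof (rule linopI)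
  show "A w (f + g) = A w f + A w g" for f g
    unfolding act_def by (simp add: fun_apply perm_poly_add liftV_add)
  show "A w (c \<odot> f) = c \<odot> A w f" for c f
    unfolding act_def by (simp add: fun_apply perm_poly_mult liftV_mult) (simp add: pointwise)
qed

lemmas act_linear [simp] = linop_simps[OF linop_act]

lemma act_Xop: "A w (Xop i f) = Xop (w i) (A w f)"
  unfolding act_def Xop_def by (simp add: perm_poly_mult liftV_mult)

lemma act_comp:
  assumes "u permutes {1..N}" "w permutes {1..N}" shows "A u (A w f) = A (u \<circ> w) f"
  unfolding act_def
  by (simp add: liftV_hom[symmetric] perm_poly_add perm_poly_mult liftV_comp[OF assms] perm_poly_comp)

definition Yop :: "nat \<Rightarrow> nat \<Rightarrow> ptau \<Rightarrow> ptau" where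
  "Yop i j f = liftV tau (tau_perm tau (tp i j)) (\<lambda>T. divdiff i j (f T))"

definition dop :: "nat \<Rightarrow> ptau \<Rightarrow> ptau" where
  "dop i f = (\<lambda>T. pderiv_var i (f T))"

lemma Dunkl_eq: "D i f = dop i f + kappa \<odot> (\<Sum>j\<in>{1..N} - {i}. Yop i j f)"
  unfolding Dunkl_def dop_def Yop_def by (simp add: pointwise sum_fun_apply)

lemma linop_Yop: "i \<noteq> j \<Longrightarrow> linop (Yop i j)"
  unfolding Yop_def by (rule linopI)
    (simp_all add: divdiff_add divdiff_const_mult liftV_add liftV_mult pointwise)

lemma linop_dop: "linop (dop i)"
  unfolding dop_def by (rule linopI) (simp_all add: pderiv_var_add pderiv_var_const_mult pointwise)

lemma linop_Dunkl: "linop (D i)"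
proof (rule linopI)
  have Y: "Yop i j (f + g) = Yop i j f + Yop i j g" "Yop i j (c \<odot> f) = c \<odot> Yop i j f"
    if "j \<in> {1..N} - {i}" for j f g c
    using linop_simps(1,2)[OF linop_Yop[of i j]] that by auto
  show "D i (f + g) = D i f + D i g" for f g
  proof -
    have "(\<Sum>j\<in>{1..N} - {i}. Yop i j (f + g)) = (\<Sum>j\<in>{1..N} - {i}. Yop i j f + Yop i j g)"
      by (rule sum.cong) (simp_all only: Y)
    then show ?thesis unfolding Dunkl_eq
      by (simp add: linop_simps[OF linop_dop] sum.distrib pm.scale_right_distrib)
  qed
  show "D i (c \<odot> f) = c \<odot> D i f" for c f
  proof -
    have "(\<Sum>j\<in>{1..N} - {i}. Yop i j (c \<odot> f)) = (\<Sum>j\<in>{1..N} - {i}. c \<odot> Yop i j f)"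
      by (rule sum.cong) (simp_all only: Y)
    then show ?thesis unfolding Dunkl_eq
      by (simp add: linop_simps[OF linop_dop] pm.scale_sum_right[symmetric] pm.scale_right_distrib mult.commute)
  qed
qed

lemmas Dunkl_linear [simp] = linop_simps[OF linop_Dunkl]

lemma Yop_Xop:
  assumes "i \<noteq> j"
  shows "Yop i j (Xop k f) = Xop k (Yop i j f) + (if k = i then sw i j f else if k = j then - sw i j f else 0)"
proof -
  have "liftV tau L (\<lambda>T. - g T) = - liftV tau L g" for L g
    using liftV_mult[of L "- 1" g] by (auto simp: pointwise)
  then show ?thesis unfolding Yop_def Xop_def act_def
    by (simp add: divdiff_Xv[OF assms] liftV_add liftV_mult[symmetric])
      (auto simp: pointwise liftV_add liftV_def)
qed

lemma dop_Xop: "dop i (Xop k f) = Xop k (dop i f) + (if k = i then f else 0)"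
  unfolding dop_def Xop_def by (auto simp: pderiv_var_Xv pointwise)

text \<open>With \<open>Dunkl_Xop_diff\<close> and \<open>act_Dunkl\<close> these are relations of
  the rational Cherednik algebra; the later commutation rules are deduced from them instead of from
  divided differences.\<close>

lemma Dunkl_Xop_same:
  assumes "i \<in> {1..N}"
  shows "D i (Xop i f) = Xop i (D i f) + f + kappa \<odot> (\<Sum>k\<in>{1..N} - {i}. sw i k f)"
proof -
  have "(\<Sum>j\<in>{1..N} - {i}. Yop i j (Xop i f)) = Xop i (\<Sum>j\<in>{1..N} - {i}. Yop i j f) + (\<Sum>j\<in>{1..N} - {i}. sw i j f)"
    by (simp add: sum.distrib[symmetric]) (rule sum.cong; simp add: Yop_Xop)
  then show ?thesis unfolding Dunkl_eq by (simp add: dop_Xop pm.scale_right_distrib)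
qed

lemma Dunkl_Xop_diff:
  assumes "i \<in> {1..N}" "j \<in> {1..N}" "i \<noteq> j"
  shows "D i (Xop j f) = Xop j (D i f) - kappa \<odot> sw i j f"
proof -
  have "(\<Sum>k\<in>{1..N} - {i}. Yop i k (Xop j f)) = (\<Sum>k\<in>{1..N} - {i}. Xop j (Yop i k f) + (if k = j then - sw i j f else 0))"
    by (rule sum.cong) (use assms in \<open>auto simp: Yop_Xop\<close>)
  also have "\<dots> = Xop j (\<Sum>k\<in>{1..N} - {i}. Yop i k f) - sw i j f"
    using assms by (simp add: sum.distrib)
  finally show ?thesis using assms unfolding Dunkl_eq
    by (simp add: dop_Xop pm.scale_right_distrib pm.scale_right_diff_distrib)
qed

lemma act_dop: "inj w \<Longrightarrow> A w (dop i f) = dop (w i) (A w f)"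
  unfolding act_def dop_def
  by (simp add: pderiv_var_perm[symmetric] liftV_hom[of "pderiv_var (w i)" _ "\<lambda>T. perm_poly w (f T)"]
    pderiv_var_add pderiv_var_const_mult)

lemma act_Yop:
  assumes w: "w permutes {1..N}" and ij: "i \<in> {1..N}" "j \<in> {1..N}" "i \<noteq> j"
  shows "A w (Yop i j f) = Yop (w i) (w j) (A w f)"
proof -
  have inj: "inj w" using w by (rule permutes_inj)
  have ne: "w i \<noteq> w j" using ij inj by (auto dest: injD)
  have p: "tp i j permutes {1..N}" "tp (w i) (w j) permutes {1..N}"
    using ij permutes_in_image[OF w] by auto
  have "A w (Yop i j f) = liftV tau (tau_perm tau (w \<circ> tp i j)) (\<lambda>T. perm_poly w (divdiff i j (f T)))"
    unfolding act_def Yop_def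
    by (simp add: liftV_hom[symmetric] perm_poly_add perm_poly_mult liftV_comp[OF w p(1)])
  also have "w \<circ> tp i j = tp (w i) (w j) \<circ> w" by (rule tp_comp_conj[OF permutes_bij[OF w]])
  also have "liftV tau (tau_perm tau (tp (w i) (w j) \<circ> w)) (\<lambda>T. perm_poly w (divdiff i j (f T))) =
     liftV tau (tau_perm tau (tp (w i) (w j))) (liftV tau (tau_perm tau w) (\<lambda>T. divdiff (w i) (w j) (perm_poly w (f T))))"
    by (simp add: liftV_comp[OF p(2) w] divdiff_perm[OF inj ij(3)])
  also have "liftV tau (tau_perm tau w) (\<lambda>T. divdiff (w i) (w j) (perm_poly w (f T))) =
     (\<lambda>T. divdiff (w i) (w j) (A w f T))"
    unfolding act_def by (rule liftV_hom) (simp_all add: divdiff_add[OF ne] divdiff_const_mult[OF ne])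
  finally show ?thesis unfolding Yop_def .
qed

lemma act_Dunkl:
  assumes w: "w permutes {1..N}" and i: "i \<in> {1..N}"
  shows "A w (D i f) = D (w i) (A w f)"
proof -
  have "(\<Sum>j\<in>{1..N} - {i}. A w (Yop i j f)) = (\<Sum>j\<in>{1..N} - {i}. Yop (w i) (w j) (A w f))"
    using act_Yop[OF w i] by (intro sum.cong) auto
  also have "\<dots> = (\<Sum>j\<in>{1..N} - {w i}. Yop (w i) j (A w f))"
    using w i permutes_inverses[OF w] permutes_in_image[OF w] permutes_in_image[OF permutes_inv[OF w]]
    by (intro sum.reindex_bij_witness[where i = "inv w" and j = w]) (auto dest: permutes_inj[THEN injD])
  finally show ?thesis unfolding Dunkl_eq using act_dop[OF permutes_inj[OF w]] by simp
qed

section \<open>Simple tensors and the polynomial module\<close>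

definition ten :: "mpoly \<Rightarrow> vec \<Rightarrow> ptau" where "ten p v = (\<lambda>T. p * const (v T))"

abbreviation "cst \<equiv> ten 1"

lemma P_iff: "f \<in> P \<longleftrightarrow> (\<forall>T. T \<notin> R \<longrightarrow> f T = 0) \<and> (\<forall>T. f T \<in> PV {1..N})"
  by (auto simp: Ptau_def PV_def)

lemma ten_P [intro]: "p \<in> PV {1..N} \<Longrightarrow> v \<in> V \<Longrightarrow> ten p v \<in> P"
  by (auto simp: P_iff ten_def V_def intro: PV_mult)

lemma Xop_ten: "Xop i (ten p v) = ten (Xv i * p) v"
  by (simp add: Xop_def ten_def mult.assoc)

lemma ten_add: "ten (p + q) v = ten p v + ten q v"
  by (simp add: ten_def pointwise distrib_right)

lemma liftV_ten:
  assumes "v \<in> V" "w permutes {1..N}"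
  shows "liftV tau (tau_perm tau w) (\<lambda>T. p * const (v T)) = ten p (tau_perm tau w v)"
proof
  fix T
  have "tau_perm tau w v \<in> V" using assms by auto
  then have "T \<notin> R \<Longrightarrow> tau_perm tau w v T = 0" by (simp add: V_def)
  moreover have "const (tau_perm tau w v T) = (\<Sum>S\<in>R. const (v S) * const (tau_perm tau w (basisv S) T))"
    unfolding fun_cong[OF tau_perm_expand[OF assms(1)]] by (simp add: const_sum const_mult)
  ultimately show "liftV tau (tau_perm tau w) (\<lambda>T. p * const (v T)) T = ten p (tau_perm tau w v) T"
    by (cases "T \<in> R") (auto simp: liftV_def ten_def sum_distrib_left mult_ac)
qed

lemma act_ten: "v \<in> V \<Longrightarrow> w permutes {1..N} \<Longrightarrow> A w (ten p v) = ten (perm_poly w p) (tau_perm tau w v)"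
  unfolding act_def by (simp add: ten_def[of p] perm_poly_mult liftV_ten)

lemma Yop_ten:
  assumes "v \<in> V" "i \<in> {1..N}" "j \<in> {1..N}" "i \<noteq> j"
  shows "Yop i j (ten p v) = ten (divdiff i j p) (tau_perm tau (tp i j) v)"
proof -
  have "divdiff i j (p * const c) = divdiff i j p * const c" for c
    using divdiff_const_mult[OF assms(4), of c p] by (simp add: mult.commute)
  then show ?thesis unfolding Yop_def ten_def[of p] using assms by (simp add: liftV_ten)
qed

lemma dop_ten: "dop i (ten p v) = ten (pderiv_var i p) v"
proof -
  have "pderiv_var i (p * const c) = pderiv_var i p * const c" for c
    using pderiv_var_const_mult[of i c p] by (simp add: mult.commute)
  then show ?thesis by (simp add: dop_def ten_def)
qed

lemma Dunkl_cst: "v \<in> V \<Longrightarrow> i \<in> {1..N} \<Longrightarrow> D i (cst v) = 0"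
  unfolding Dunkl_eq using divdiff_const[of i _ 1] pderiv_var_const[of i 1]
  by (auto simp: Yop_ten dop_ten) (auto simp: ten_def pointwise sum_fun_apply)

lemma act_cst: "v \<in> V \<Longrightarrow> w permutes {1..N} \<Longrightarrow> A w (cst v) = cst (tau_perm tau w v)"
  using perm_poly_const[of w 1] by (simp add: act_ten)

lemma P_zero [simp, intro]: "0 \<in> P" and P_add [simp, intro]: "f \<in> P \<Longrightarrow> g \<in> P \<Longrightarrow> f + g \<in> P"
  and P_diff [simp, intro]: "f \<in> P \<Longrightarrow> g \<in> P \<Longrightarrow> f - g \<in> P"
  and P_uminus [simp, intro]: "f \<in> P \<Longrightarrow> - f \<in> P"
  and P_scale [simp, intro]: "f \<in> P \<Longrightarrow> c \<odot> f \<in> P"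
  by (auto simp: P_iff fun_apply intro: PV_add PV_diff PV_mult PV_uminus)

lemma P_sum [simp, intro]: "(\<And>x. x \<in> B \<Longrightarrow> h x \<in> P) \<Longrightarrow> sum h B \<in> P"
  by (induction B rule: infinite_finite_induct) auto

lemma P_Xop [simp, intro]: "f \<in> P \<Longrightarrow> i \<in> {1..N} \<Longrightarrow> Xop i f \<in> P"
  by (auto simp: P_iff Xop_def intro!: PV_mult PV_Xv)

lemma liftV_P: "(\<And>T. f T \<in> PV {1..N}) \<Longrightarrow> liftV tau L f \<in> P"
  by (auto simp: P_iff liftV_def intro!: PV_sum PV_mult)

lemma P_act [simp, intro]: "f \<in> P \<Longrightarrow> w permutes {1..N} \<Longrightarrow> A w f \<in> P"
  unfolding act_def by (rule liftV_P) (auto simp: P_iff intro: PV_perm)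

lemma P_Dunkl [simp, intro]: "f \<in> P \<Longrightarrow> i \<in> {1..N} \<Longrightarrow> D i f \<in> P"
  unfolding Dunkl_eq
proof (intro P_add P_scale P_sum)
  assume a: "f \<in> P" "i \<in> {1..N}"
  have "pderiv_var i (0::mpoly) = 0" by (simp add: pderiv_var_def)
  then show "dop i f \<in> P" using a by (auto simp: P_iff dop_def intro: PV_pderiv)
  fix j assume "j \<in> {1..N} - {i}"
  then show "Yop i j f \<in> P" unfolding Yop_def using a
    by (intro liftV_P PV_divdiff) (auto simp: P_iff)
qed

text \<open>The module is generated by constants under multiplication by variables. Together with
  the commutation relations this reduces operator identities to constants, which every
  \<open>D i\<close> annihilates.\<close>

lemma P_induct [consumes 1, case_names cst X add]:
  assumes "f \<in> P" "\<And>v. v \<in> V \<Longrightarrow> Q (cst v)" "\<And>i f. i \<in> {1..N} \<Longrightarrow> f \<in> P \<Longrightarrow> Q f \<Longrightarrow> Q (Xop i f)"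
    "\<And>f g. f \<in> P \<Longrightarrow> g \<in> P \<Longrightarrow> Q f \<Longrightarrow> Q g \<Longrightarrow> Q (f + g)"
  shows "Q f"
proof -
  have 1: "Q (ten p v)" if "p \<in> PV {1..N}" "v \<in> V" for p v
  proof -
    have "Q (ten p v) \<and> p \<in> PV {1..N}" using that(1)
    proof (induction p rule: PV_induct)
      case (const c)
      have "(\<lambda>T. c * v T) \<in> V" using that(2) by (rule V_scale)
      moreover have "ten (const c) v = cst (\<lambda>T. c * v T)" by (simp add: ten_def const_mult)
      ultimately show ?case using assms(2) by simp
    next
      case (X i p)
      then have "Q (Xop i (ten p v))" using that(2) by (intro assms(3)) auto
      then show ?case using X by (auto simp: Xop_ten intro!: PV_mult PV_Xv)
    next
      case (add p q)
      then have "Q (ten p v + ten q v)" using that(2) by (intro assms(4)) auto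
      then show ?case using add by (auto simp: ten_add intro: PV_add)
    qed
    then show ?thesis by simp
  qed
  have f: "f = (\<Sum>T\<in>R. ten (f T) (basisv T))"
  proof
    fix S
    have "(\<Sum>T\<in>R. f T * const (basisv T S)) = (\<Sum>T\<in>R. if T = S then f S else 0)"
      by (rule sum.cong) (auto simp: basisv_def)
    then show "f S = (\<Sum>T\<in>R. ten (f T) (basisv T)) S"
      using assms(1) by (auto simp: sum_fun_apply ten_def P_iff)
  qed
  have "Q (\<Sum>T\<in>B. ten (f T) (basisv T)) \<and> (\<Sum>T\<in>B. ten (f T) (basisv T)) \<in> P" if "B \<subseteq> R" for B
    using finite_subset[OF that finite_R] that
  proof (induction B rule: finite_induct)
    case empty
    have "cst (\<lambda>T. 0) = 0" by (simp add: ten_def pointwise)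
    then show ?case using assms(2)[of "\<lambda>T. 0"] by (simp add: V_def)
  next
    case (insert T B)
    have "ten (f T) (basisv T) \<in> P" using insert assms(1) by (intro ten_P) (auto simp: P_iff)
    then show ?case using insert assms 1[of "f T" "basisv T"] by (auto simp: P_iff[of f] intro!: assms(4))
  qed
  from this[of R] f show ?thesis by simp
qed

lemma act_id [simp]: "f \<in> P \<Longrightarrow> A id f = f"
  unfolding act_def by (simp add: liftV_id P_iff)

lemma act_inv: "f \<in> P \<Longrightarrow> w permutes {1..N} \<Longrightarrow> A w (A (inv w) f) = f" "f \<in> P \<Longrightarrow> w permutes {1..N} \<Longrightarrow> A (inv w) (A w f) = f"
  by (simp_all add: act_comp permutes_inv permutes_inv_o)

lemma sw_sw [simp]: "f \<in> P \<Longrightarrow> i \<in> {1..N} \<Longrightarrow> j \<in> {1..N} \<Longrightarrow> sw i j (sw i j f) = f"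
  by (simp add: act_comp)

lemma act_sw: "w permutes {1..N} \<Longrightarrow> i \<in> {1..N} \<Longrightarrow> j \<in> {1..N} \<Longrightarrow> A w (sw i j f) = sw (w i) (w j) (A w f)"
  using tp_comp_conj[OF permutes_bij, of w] permutes_in_image[of w "{1..N}"]
  by (simp add: act_comp)

end

section \<open>Cherednik-Dunkl operators\<close>

context partition_shape
begin

text \<open>By the commutation relations with multiplications, \<open>[D\<^sub>i, D\<^sub>j]\<close> commutes with every \<open>x\<^sub>k\<close>
  (the Jacobi identity), and it kills constants.\<close>

lemma Dunkl_commute:
  assumes "f \<in> P" and ij: "i \<in> {1..N}" "j \<in> {1..N}"
  shows "D i (D j f) = D j (D i f)"
proof (cases "i = j")
  case ne: False
  show ?thesis using assms(1)
  proof (induction f rule: P_induct)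
    case (cst v)
    then show ?case using ij by (simp add: Dunkl_cst)
  next
    case (X k f)
    have DD: "D i (D j f) = D j (D i f)" by (rule X.IH)
    have sD: "D a (sw b c f) = sw b c (D (tp b c a) f)" if "a \<in> {1..N}" "b \<in> {1..N}" "c \<in> {1..N}" for a b c
      using act_Dunkl[of "tp b c" "tp b c a"] that permutes_in_image[OF tp_permutes[of b c], of a] by simp
    consider "k = i" | "k = j" | "k \<noteq> i" "k \<noteq> j" by blast
    then show ?case
    proof cases
      case 1
      have "(\<Sum>l\<in>{1..N} - {i}. D j (sw i l f)) = (\<Sum>l\<in>{1..N} - {i}. sw i l (D j f) + (if l = j then sw i j (D i f) - sw i j (D j f) else 0))"
        by (rule sum.cong) (use ij ne in \<open>auto simp: sD transpose_def\<close>)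
      also have "\<dots> = (\<Sum>l\<in>{1..N} - {i}. sw i l (D j f)) + sw i j (D i f) - sw i j (D j f)"
        using ij ne by (simp add: sum.distrib)
      finally have "(\<Sum>l\<in>{1..N} - {i}. D j (sw i l f)) = (\<Sum>l\<in>{1..N} - {i}. sw i l (D j f)) + sw i j (D i f) - sw i j (D j f)" .
      moreover have "D i (sw i j f) = sw i j (D j f)" using ij by (simp add: sD)
      ultimately show ?thesis unfolding 1 using ij ne
        by (simp add: Dunkl_Xop_same Dunkl_Xop_diff transpose_commute[of j i] DD pm.scale_right_diff_distrib pm.scale_right_distrib)
    next
      case 2
      have "(\<Sum>l\<in>{1..N} - {j}. D i (sw j l f)) = (\<Sum>l\<in>{1..N} - {j}. sw j l (D i f) + (if l = i then sw i j (D j f) - sw i j (D i f) else 0))"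
        by (rule sum.cong) (use ij ne in \<open>auto simp: sD transpose_def transpose_commute[of j i]\<close>)
      also have "\<dots> = (\<Sum>l\<in>{1..N} - {j}. sw j l (D i f)) + sw i j (D j f) - sw i j (D i f)"
        using ij ne by (simp add: sum.distrib)
      finally have "(\<Sum>l\<in>{1..N} - {j}. D i (sw j l f)) = (\<Sum>l\<in>{1..N} - {j}. sw j l (D i f)) + sw i j (D j f) - sw i j (D i f)" .
      moreover have "D j (sw i j f) = sw i j (D i f)" using ij by (simp add: sD)
      ultimately show ?thesis unfolding 2 using ij ne
        by (simp add: Dunkl_Xop_same Dunkl_Xop_diff transpose_commute[of j i] DD pm.scale_right_diff_distrib pm.scale_right_distrib)
    next
      case 3
      then show ?thesis using ij ne X by (simp add: Dunkl_Xop_diff sD transpose_def DD)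
    qed
  qed simp
qed simp


text \<open>In contrast to \<open>JM\<close>, the transpositions act on both tensor factors.\<close>

definition JMP :: "nat \<Rightarrow> ptau \<Rightarrow> ptau" where "JMP i f = (\<Sum>j\<in>{Suc i..N}. sw i j f)"

definition lowJM :: "nat \<Rightarrow> ptau \<Rightarrow> ptau" where "lowJM i f = (\<Sum>j\<in>{1..<i}. sw i j f)"

abbreviation U where "U \<equiv> Uop tau"

lemma linop_JMP: "linop (JMP i)" and linop_lowJM: "linop (lowJM i)"
  unfolding JMP_def lowJM_def by (rule linopI; simp add: sum.distrib pm.scale_sum_right)+

lemmas JMP_linear [simp] = linop_simps[OF linop_JMP]
lemmas lowJM_linear [simp] = linop_simps[OF linop_lowJM]

lemma Uop_eq: "U i f = D i (Xop i f) - kappa \<odot> lowJM i f"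
  unfolding Uop_def lowJM_def Xop_def by (rule ext) (simp add: fun_apply sum_fun_apply)

lemma linop_Uop: "linop (U i)"
  unfolding Uop_eq
  by (rule linopI; simp add: pm.scale_right_distrib pm.scale_right_diff_distrib mult.commute)

lemmas Uop_linear [simp] = linop_simps[OF linop_Uop]

text \<open>The reflections with index below \<open>i\<close> cancel against the correction in
  \<open>Uop\<close>. In this form \<open>U i\<close> is visibly \<open>1 + kappa JMP i\<close>
  wherever \<open>D i\<close> vanishes.\<close>

lemma Uop_alt:
  assumes "i \<in> {1..N}" shows "U i f = Xop i (D i f) + f + kappa \<odot> JMP i f"
proof -
  have e: "{1..N} - {i} = {1..<i} \<union> {Suc i..N}" using assms by auto
  have "(\<Sum>k\<in>{1..N} - {i}. sw i k f) = lowJM i f + JMP i f"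
    unfolding e lowJM_def JMP_def by (rule sum.union_disjoint) auto
  then show ?thesis unfolding Uop_eq Dunkl_Xop_same[OF assms] by (simp add: pm.scale_right_distrib)
qed

lemma P_JMP [simp, intro]: "f \<in> P \<Longrightarrow> i \<in> {1..N} \<Longrightarrow> JMP i f \<in> P"
  unfolding JMP_def by (intro P_sum P_act) auto

lemma P_lowJM [simp, intro]: "f \<in> P \<Longrightarrow> i \<in> {1..N} \<Longrightarrow> lowJM i f \<in> P"
  unfolding lowJM_def by (intro P_sum P_act) auto

lemma P_Uop [simp, intro]: "f \<in> P \<Longrightarrow> i \<in> {1..N} \<Longrightarrow> U i f \<in> P"
  unfolding Uop_eq by auto

lemma act_DX: "w permutes {1..N} \<Longrightarrow> i \<in> {1..N} \<Longrightarrow> A w (D i (Xop i f)) = D (w i) (Xop (w i) (A w f))"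
  by (simp add: act_Dunkl act_Xop)

lemma act_lowJM:
  assumes w: "w permutes {1..N}" "w permutes {1..<k}" and k: "k \<in> {1..N}" "w k = k"
  shows "A w (lowJM k f) = lowJM k (A w f)"
proof -
  have "(\<Sum>j\<in>{1..<k}. A w (sw k j f)) = (\<Sum>j\<in>{1..<k}. sw k (w j) (A w f))"
    using k by (intro sum.cong) (auto simp: act_sw[OF w(1)])
  also have "\<dots> = (\<Sum>j\<in>{1..<k}. sw k j (A w f))"
    using sum.permute[OF w(2), of "\<lambda>j. sw k j (A w f)"] by (simp add: comp_def)
  finally show ?thesis unfolding lowJM_def by simp
qed

lemma act_Uop:
  assumes w: "w permutes {1..N}" "w permutes {1..<k}" and k: "k \<in> {1..N}" "w k = k"
  shows "A w (U k f) = U k (A w f)"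
  unfolding Uop_eq using assms by (simp add: act_DX act_lowJM)

lemma sw_Uop_other:
  assumes "1 \<le> i" "Suc i \<le> N" "k \<in> {1..N}" "k \<noteq> i" "k \<noteq> Suc i"
  shows "sw i (Suc i) (U k f) = U k (sw i (Suc i) f)"
proof (cases "k < i")
  case True
  have "tp i (Suc i) j = j" if "j < i" for j using that by auto
  have "A (tp i (Suc i)) (sw k j f) = sw k j (A (tp i (Suc i)) f)" if "j \<in> {1..<k}" for j
    using act_sw[of "tp i (Suc i)" k j f] assms that True by auto
  then have "sw i (Suc i) (lowJM k f) = lowJM k (sw i (Suc i) f)" unfolding lowJM_def by simp
  then show ?thesis unfolding Uop_eq using assms act_DX[of "tp i (Suc i)" k f] by auto
next
  case False
  then show ?thesis using assms by (intro act_Uop permutes_swap_id) auto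
qed

text \<open>The relation of the degenerate affine Hecke algebra: the extra term stems from the
  transposition \<open>(i, Suc i)\<close>, which occurs in \<open>lowJM (Suc i)\<close> but not in
  \<open>lowJM i\<close>.\<close>

lemma sw_Uop:
  assumes f: "f \<in> P" and i: "1 \<le> i" "Suc i \<le> N"
  shows "sw i (Suc i) (U i f) = U (Suc i) (sw i (Suc i) f) + kappa \<odot> f"
proof -
  let ?s = "tp i (Suc i)"
  have s: "?s permutes {1..N}" using i by auto
  have "sw i (Suc i) (lowJM i f) = (\<Sum>j\<in>{1..<i}. sw (Suc i) j (A ?s f))"
    unfolding lowJM_def act_linear using i by (intro sum.cong) (auto simp: act_sw[OF s])
  moreover have "{1..<Suc i} = insert i {1..<i}" using i by auto
  then have "lowJM (Suc i) (A ?s f) = sw (Suc i) i (A ?s f) + (\<Sum>j\<in>{1..<i}. sw (Suc i) j (A ?s f))"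
    unfolding lowJM_def by simp
  moreover have "sw (Suc i) i (A ?s f) = f"
    using sw_sw[OF f, of i "Suc i"] i by (simp add: transpose_commute)
  ultimately have "sw i (Suc i) (lowJM i f) = lowJM (Suc i) (A ?s f) - f" by simp
  then show ?thesis unfolding Uop_eq using act_DX[OF s, of i f] i
    by (simp add: pm.scale_right_diff_distrib)
qed

lemma sw_JMP:
  assumes f: "f \<in> P" and i: "1 \<le> i" "Suc i \<le> N"
  shows "sw i (Suc i) (JMP i f) = JMP (Suc i) (sw i (Suc i) f) + f"
proof -
  let ?s = "tp i (Suc i)"
  have s: "?s permutes {1..N}" using i by auto
  have "{Suc i..N} = insert (Suc i) {Suc (Suc i)..N}" using i by auto
  then have "JMP i f = sw i (Suc i) f + (\<Sum>j\<in>{Suc (Suc i)..N}. sw i j f)"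
    unfolding JMP_def by simp
  moreover have "(\<Sum>j\<in>{Suc (Suc i)..N}. A ?s (sw i j f)) = JMP (Suc i) (A ?s f)"
    unfolding JMP_def using i by (intro sum.cong) (auto simp: act_sw[OF s])
  ultimately show ?thesis using f i by simp
qed

lemma lowJM_commute:
  assumes "i < j" "i \<in> {1..N}" "j \<in> {1..N}"
  shows "lowJM i (lowJM j f) = lowJM j (lowJM i f)"
proof -
  have "lowJM i (lowJM j f) = (\<Sum>k\<in>{1..<i}. lowJM j (sw i k f))"
    unfolding lowJM_def[of i] using assms
    by (intro sum.cong act_lowJM permutes_swap_id) auto
  then show ?thesis by (simp add: lowJM_def[of i])
qed

text \<open>Both products contain the common part \<open>D i D j x_i x_j\<close>. The reflection
  terms left over from reordering are cancelled by the failure of \<open>D i x_i\<close> to commute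
  with the summand \<open>(i, j)\<close> of \<open>lowJM j\<close>.\<close>

lemma Uop_commute:
  assumes f: "f \<in> P" and ij: "i \<in> {1..N}" "j \<in> {1..N}"
  shows "U i (U j f) = U j (U i f)"
proof -
  have "U i (U j f) = U j (U i f)" if ij: "i \<in> {1..N}" "j \<in> {1..N}" "i < j" for i j
  proof -
    let ?s = "tp i j" and ?DX = "\<lambda>i f. D i (Xop i f)"
    have s: "?s permutes {1..N}" using ij by auto
    have X: "Xop i (D j g) = D j (Xop i g) + kappa \<odot> A ?s g" "Xop j (D i g) = D i (Xop j g) + kappa \<odot> A ?s g" for g
      using ij by (auto simp: Dunkl_Xop_diff transpose_commute[of j i])
    have 1: "?DX i (?DX j f) = D i (D j (Xop i (Xop j f))) + kappa \<odot> ?DX i (A ?s f)"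
      "?DX j (?DX i f) = D i (D j (Xop i (Xop j f))) + kappa \<odot> ?DX j (A ?s f)"
      using ij f by (simp_all add: X act_Xop Dunkl_commute[of _ j i] Xop_commute[of j i])
    have "?DX i (sw j k f) = sw j k (?DX i f) + (if k = i then ?DX i (A ?s f) - ?DX j (A ?s f) else 0)"
      if "k \<in> {1..<j}" for k
      using that ij act_DX[of "tp j k" i f] by (auto simp: transpose_commute[of j i])
    then have "?DX i (lowJM j f) = (\<Sum>k\<in>{1..<j}. sw j k (?DX i f) + (if k = i then ?DX i (A ?s f) - ?DX j (A ?s f) else 0))"
      unfolding lowJM_def by simp
    then have 2: "?DX i (lowJM j f) = lowJM j (?DX i f) + ?DX i (A ?s f) - ?DX j (A ?s f)"
      using ij unfolding lowJM_def by (simp add: sum.distrib)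
    have 3: "lowJM i (?DX j f) = ?DX j (lowJM i f)"
      unfolding lowJM_def using ij by (simp add: act_DX)
    show ?thesis unfolding Uop_eq using ij
      by (simp add: 1 2 3 lowJM_commute[of i j] pm.scale_right_distrib pm.scale_right_diff_distrib)
  qed
  then show ?thesis using ij by (cases i j rule: linorder_cases) metis+
qed

end

section \<open>The dominance order on exponents\<close>

lemma sum_list_map_mset_cong:
  fixes f :: "nat \<Rightarrow> nat"
  shows "mset xs = mset ys \<Longrightarrow> sum_list (map f xs) = sum_list (map f ys)"
  by (metis mset_map sum_mset_sum_list)

lemma sum_list_take_le:
  fixes xs :: "nat list"
  shows "sum_list (take k xs) \<le> k * t + (\<Sum>x\<leftarrow>xs. x - t)"
proof (induction xs arbitrary: k)
  case (Cons x xs)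
  show ?case
  proof (cases k)
    case (Suc l)
    have "x \<le> t + (x - t)" by simp
    then have "x + sum_list (take l xs) \<le> t + (x - t) + (l * t + (\<Sum>x\<leftarrow>xs. x - t))"
      using Cons.IH[of l] by (intro add_mono) auto
    then show ?thesis using Suc by simp
  qed simp
qed simp

lemma sum_list_take_eq:
  fixes xs :: "nat list"
  assumes "sorted_wrt (\<ge>) xs" "k < length xs"
  shows "sum_list (take (Suc k) xs) = Suc k * (xs ! k) + (\<Sum>x\<leftarrow>xs. x - xs ! k)"
  using assms
proof (induction xs arbitrary: k)
  case (Cons x xs)
  show ?case
  proof (cases k)
    case 0
    have "(\<Sum>y\<leftarrow>xs. y - x) = 0" using Cons.prems by simp
    then show ?thesis using 0 by simp
  next
    case (Suc l)
    then have "xs ! l \<le> x" using Cons.prems by auto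
    then obtain z where z: "x = xs ! l + z" by (metis le_add_diff_inverse)
    have "sum_list (take (Suc l) xs) = Suc l * (xs ! l) + (\<Sum>x\<leftarrow>xs. x - xs ! l)"
      using Cons.IH[of l] Cons.prems Suc by auto
    then show ?thesis unfolding Suc z by simp
  qed
qed simp

lemma mset_plus_part [simp]: "mset (plus_part xs) = mset xs"
  and length_plus_part [simp]: "length (plus_part xs) = length xs"
  and sorted_plus_part: "sorted_wrt (\<ge>) (plus_part xs)"
  unfolding plus_part_def by (auto simp: sorted_wrt_rev)

text \<open>The sum of the \<open>k\<close> largest entries is the minimum over \<open>t\<close> of \<open>k t + \<Sum>(x - t)\<close> with truncated
  subtraction, so comparing these sums for all \<open>t\<close> suffices.\<close>

lemma plus_part_take_le:
  assumes "length xs = length ys" "\<And>t. (\<Sum>x\<leftarrow>xs. x - t) \<le> (\<Sum>x\<leftarrow>ys. x - t)" "k \<le> length xs"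
  shows "sum_list (take k (plus_part xs)) \<le> sum_list (take k (plus_part ys))"
proof (cases k)
  case (Suc l)
  \<comment> \<open>The \<open>k\<close>-th largest entry of \<open>ys\<close> attains the
    minimum.\<close>
  define t where "t = plus_part ys ! l"
  have "sum_list (take k (plus_part xs)) \<le> k * t + (\<Sum>x\<leftarrow>plus_part xs. x - t)"
    by (rule sum_list_take_le)
  also have "(\<Sum>x\<leftarrow>plus_part xs. x - t) = (\<Sum>x\<leftarrow>xs. x - t)" by (rule sum_list_map_mset_cong) simp
  also have "\<dots> \<le> (\<Sum>x\<leftarrow>ys. x - t)" by (rule assms)
  also have "\<dots> = (\<Sum>x\<leftarrow>plus_part ys. x - t)" by (rule sum_list_map_mset_cong) simp
  also have "k * t + (\<Sum>x\<leftarrow>plus_part ys. x - t) = sum_list (take k (plus_part ys))"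
    using sum_list_take_eq[OF sorted_plus_part, of l ys] assms Suc by (simp add: t_def)
  finally show ?thesis by simp
qed simp

lemma dom_prec_antisym_aux:
  fixes xs ys :: "nat list"
  assumes "length xs = length ys" "\<And>i. i \<le> length xs \<Longrightarrow> sum_list (take i xs) = sum_list (take i ys)"
  shows "xs = ys"
proof (rule nth_equalityI)
  fix i assume "i < length xs"
  then show "xs ! i = ys ! i"
    using assms(2)[of i] assms(2)[of "Suc i"] assms(1) by (simp add: take_Suc_conv_app_nth)
qed (rule assms(1))

lemma dom_prec_trans:
  assumes "dom_prec xs ys" "dom_prec ys zs" "length xs = length ys" "length ys = length zs"
  shows "dom_prec xs zs"
proof -
  have le: "sum_list (take i xs) \<le> sum_list (take i ys)" "sum_list (take i ys) \<le> sum_list (take i zs)"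
    if "i \<le> length xs" for i
    using assms that unfolding dom_prec_def by auto
  have "xs \<noteq> zs"
  proof
    assume "xs = zs"
    then have "sum_list (take i xs) = sum_list (take i ys)" if "i \<le> length xs" for i
      using le[OF that] by simp
    then have "xs = ys" by (rule dom_prec_antisym_aux[OF assms(3)])
    then show False using assms(1) unfolding dom_prec_def by simp
  qed
  then show ?thesis using le order_trans unfolding dom_prec_def by blast
qed

lemma dom_lhd_trans:
  assumes "dom_lhd xs ys" "dom_lhd ys zs" "length xs = length ys" "length ys = length zs"
  shows "dom_lhd xs zs"
  using assms dom_prec_trans[of xs ys zs] dom_prec_trans[of "plus_part xs" "plus_part ys" "plus_part zs"]
  unfolding dom_lhd_def by auto

lemma dom_lhd_irrefl: "\<not> dom_lhd xs xs"
  unfolding dom_lhd_def dom_prec_def by auto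

context partition_shape
begin

section \<open>Exponent vectors and their order\<close>

definition L :: "(nat \<Rightarrow>\<^sub>0 nat) \<Rightarrow> nat list" where "L a = map (lk a) [1..<Suc N]"

definition EXP :: "(nat \<Rightarrow>\<^sub>0 nat) set" where "EXP = {a. ks a \<subseteq> {1..N}}"

definition lt :: "(nat \<Rightarrow>\<^sub>0 nat) \<Rightarrow> (nat \<Rightarrow>\<^sub>0 nat) \<Rightarrow> bool" where "lt a b = dom_lhd (L a) (L b)"

definition deg :: "(nat \<Rightarrow>\<^sub>0 nat) \<Rightarrow> nat" where "deg a = (\<Sum>i\<in>{1..N}. lk a i)"

lemma length_L [simp]: "length (L a) = N" by (simp add: L_def del: upt_Suc)

lemma nth_L: "i \<in> {1..N} \<Longrightarrow> L a ! (i - 1) = lk a i"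
  by (auto simp: L_def nth_append simp del: upt_Suc)

lemma EXP_eqI: "a \<in> EXP \<Longrightarrow> b \<in> EXP \<Longrightarrow> (\<And>i. i \<in> {1..N} \<Longrightarrow> lk a i = lk b i) \<Longrightarrow> a = b"
  unfolding EXP_def by (rule poly_mapping_eqI) (metis in_keys_iff mem_Collect_eq subsetD)

lemma L_inj: "a \<in> EXP \<Longrightarrow> b \<in> EXP \<Longrightarrow> L a = L b \<Longrightarrow> a = b"
  by (rule EXP_eqI) (auto simp: nth_L[symmetric])

lemma lookup_expo: "lk (expo xs) j = (if j \<in> {1..length xs} then xs ! (j - 1) else 0)"
proof -
  have "lk (expo xs) j = (\<Sum>i<length xs. if i = j - 1 \<and> 1 \<le> j then xs ! i else 0)"
    unfolding expo_def lookup_sum by (rule sum.cong) (auto simp: lookup_single when_def)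
  then show ?thesis by auto
qed

lemma expo_EXP: "length xs = N \<Longrightarrow> expo xs \<in> EXP"
  unfolding EXP_def by (auto simp: in_keys_iff lookup_expo split: if_splits)

lemma L_expo: "length xs = N \<Longrightarrow> L (expo xs) = xs"
  by (rule nth_equalityI) (auto simp: L_def lookup_expo simp del: upt_Suc)

lemma expo_L: "a \<in> EXP \<Longrightarrow> expo (L a) = a"
  by (rule L_inj) (auto simp: expo_EXP L_expo)

lemma lt_trans: "lt a b \<Longrightarrow> lt b c \<Longrightarrow> lt a c"
  unfolding lt_def by (erule dom_lhd_trans) auto

lemma lt_irrefl [simp]: "\<not> lt a a"
  unfolding lt_def by (rule dom_lhd_irrefl)

lemma sum_list_map_L: "sum_list (map f (L a)) = (\<Sum>i\<in>{1..N}. f (lk a i))"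
proof -
  have "sum_list (map f (L a)) = sum_list (map (\<lambda>i. f (lk a i)) [1..<Suc N])"
    by (simp add: L_def comp_def del: upt_Suc)
  also have "\<dots> = sum (\<lambda>i. f (lk a i)) (set [1..<Suc N])" by (rule sum_set_upt_conv_sum_list_nat[symmetric])
  also have "set [1..<Suc N] = {1..N}" by auto
  finally show ?thesis .
qed

lemma sum_list_L: "sum_list (L a) = deg a"
  using sum_list_map_L[of id] by (simp add: deg_def)

lemma sum_list_take_L: "k \<le> N \<Longrightarrow> sum_list (take k (L a)) = (\<Sum>i\<in>{1..k}. lk a i)"
proof -
  assume "k \<le> N"
  then have "take k (L a) = map (lk a) [1..<Suc k]" by (simp add: L_def take_map plus_1_eq_Suc del: upt_Suc)
  moreover have "set [1..<Suc k] = {1..k}" by auto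
  ultimately show ?thesis using sum_set_upt_conv_sum_list_nat[of "lk a" 1 "Suc k"] by simp
qed

lemma lt_deg: "lt a b \<Longrightarrow> deg a = deg b"
  unfolding lt_def dom_lhd_def by (simp add: sum_list_L)

lemma finite_deg: "finite {a \<in> EXP. deg a = n}"
proof (rule finite_imageD)
  show "finite (L ` {a \<in> EXP. deg a = n})"
  proof (rule finite_subset)
    show "L ` {a \<in> EXP. deg a = n} \<subseteq> {xs. set xs \<subseteq> {..n} \<and> length xs = N}"
    proof clarsimp
      fix a x assume "x \<in> set (L a)"
      then show "x \<le> deg a" using member_le_sum_list[of x "L a"] by (simp add: sum_list_L)
    qed
  qed (rule finite_lists_length_eq, simp)
qed (auto intro!: inj_onI L_inj)

lemma finite_lt: "finite {b \<in> EXP. lt b a}"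
  by (rule finite_subset[OF _ finite_deg[of "deg a"]]) (auto dest: lt_deg)

lemma lookup_rename:
  assumes "bij w" shows "lk (rename_exp w a) (w k) = lk a k"
proof -
  have "lk (rename_exp w a) (w k) = (\<Sum>j\<in>ks a. if j = k then lk a j else 0)"
    unfolding rename_exp_def lookup_sum using assms
    by (intro sum.cong) (auto simp: lookup_single when_def bij_def dest: injD)
  then show ?thesis by (auto simp: in_keys_iff)
qed

lemma lookup_rename_tp [simp]: "lk (rename_exp (tp i j) a) k = lk a (tp i j k)"
  using lookup_rename[of "tp i j" a "tp i j k"] by simp

lemma EXP_rename:
  assumes w: "w permutes {1..N}" and a: "a \<in> EXP" shows "rename_exp w a \<in> EXP"
  unfolding EXP_def
proof (intro CollectI subsetI)
  fix k assume "k \<in> ks (rename_exp w a)"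
  then have "lk (rename_exp w a) (w (inv w k)) \<noteq> 0" using permutes_inverses(1)[OF w] by (simp add: in_keys_iff)
  then have "inv w k \<in> ks a" using lookup_rename[OF permutes_bij[OF w]] by (simp add: in_keys_iff)
  then have "inv w k \<in> {1..N}" using a unfolding EXP_def by auto
  then show "k \<in> {1..N}" using permutes_in_image[OF w, of "inv w k"] permutes_inverses(1)[OF w] by simp
qed

lemma plus_part_swap:
  assumes "i \<in> {1..N}" "j \<in> {1..N}"
  shows "plus_part (L (rename_exp (tp i j) a)) = plus_part (L a)"
proof -
  have s: "tp i j permutes {1..N}" using assms by auto
  have "mset (L c) = image_mset (lk c) (mset_set {1..N})" for c
    unfolding L_def mset_map by (simp add: mset_upt atLeastLessThanSuc_atLeastAtMost del: upt_Suc)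
  moreover have "image_mset (lk (rename_exp (tp i j) a)) (mset_set {1..N}) = image_mset (lk a) (image_mset (tp i j) (mset_set {1..N}))"
  proof -
    have "lk (rename_exp (tp i j) a) = (\<lambda>k. lk a (tp i j k))" by (rule ext) simp
    then show ?thesis by (simp add: multiset.map_comp comp_def)
  qed
  moreover have "image_mset (tp i j) (mset_set {1..N}) = mset_set {1..N}"
    using image_mset_mset_set[OF permutes_inj_on[OF s], of "{1..N}"] permutes_image[OF s] by simp
  ultimately have "mset (L (rename_exp (tp i j) a)) = mset (L a)" by simp
  then show ?thesis unfolding plus_part_def by (simp add: properties_for_sort)
qed

lemma deg_swap: "i \<in> {1..N} \<Longrightarrow> j \<in> {1..N} \<Longrightarrow> deg (rename_exp (tp i j) a) = deg a"
  unfolding deg_def using sum.permute[OF tp_permutes, of i j "lk a"] by (simp add: comp_def)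

text \<open>The swap transfers \<open>?d\<close> from \<open>j\<close> to the earlier position
  \<open>i\<close>, so no partial sum decreases, while the nonincreasing rearrangement stays the
  same.\<close>

lemma lt_swap:
  assumes i: "i \<in> {1..N}" and j: "j \<in> {1..N}" and ij: "i < j" and less: "lk a i < lk a j"
  shows "lt a (rename_exp (tp i j) a)"
proof -
  let ?b = "rename_exp (tp i j) a"
  let ?d = "lk a j - lk a i"
  have pt: "lk ?b k + (if k = j then ?d else 0) = lk a k + (if k = i then ?d else 0)" for k
    using ij less by (auto simp: transpose_def)
  have "(\<Sum>l\<in>{1..k}. lk a l) \<le> (\<Sum>l\<in>{1..k}. lk ?b l)" for k
  proof -
    have "(\<Sum>l\<in>{1..k}. lk ?b l + (if l = j then ?d else 0)) = (\<Sum>l\<in>{1..k}. lk a l + (if l = i then ?d else 0))"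
      unfolding pt ..
    then have "(\<Sum>l\<in>{1..k}. lk ?b l) + (if j \<in> {1..k} then ?d else 0) = (\<Sum>l\<in>{1..k}. lk a l) + (if i \<in> {1..k} then ?d else 0)"
      by (simp add: sum.distrib del: lookup_rename_tp)
    then show ?thesis using ij i by (auto split: if_splits)
  qed
  moreover have "L a \<noteq> L ?b" using nth_L[OF i, of a] nth_L[OF i, of ?b] less by auto
  ultimately have "dom_prec (L a) (L ?b)" unfolding dom_prec_def by (auto simp: sum_list_take_L simp del: lookup_rename_tp)
  then show ?thesis unfolding lt_def dom_lhd_def
    using plus_part_swap[OF i j] deg_swap[OF i j] by (simp add: sum_list_L)
qed

section \<open>Leading terms of divided differences of monomials\<close>

definition shift :: "nat \<Rightarrow> nat \<Rightarrow> (nat \<Rightarrow>\<^sub>0 nat) \<Rightarrow> nat \<Rightarrow> nat \<Rightarrow>\<^sub>0 nat" where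
  "shift i j b k = b + sgl j k - sgl i k"

lemma lookup_shift: "i \<noteq> j \<Longrightarrow> lk (shift i j b k) l = (if l = i then lk b i - k else if l = j then lk b j + k else lk b l)"
  unfolding shift_def by (auto simp: lookup_add lookup_minus lookup_single when_def)

lemma EXP_shift:
  assumes "b \<in> EXP" "i \<noteq> j" "j \<in> {1..N}" shows "shift i j b k \<in> EXP"
proof -
  have "lk (shift i j b k) l = 0" if l: "l \<notin> {1..N}" for l
  proof -
    have "lk b l = 0" using assms(1) l unfolding EXP_def by (metis in_keys_iff mem_Collect_eq subsetD)
    moreover have "l \<noteq> j" using l assms by metis
    ultimately show ?thesis using assms by (auto simp: lookup_shift)
  qed
  then show ?thesis unfolding EXP_def by (metis in_keys_iff mem_Collect_eq subsetI)
qed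

lemma sum_split_two:
  fixes g :: "nat \<Rightarrow> nat"
  assumes "i \<in> {1..N}" "j \<in> {1..N}" "i \<noteq> j"
  shows "(\<Sum>l\<in>{1..N}. g l) = g i + g j + (\<Sum>l\<in>{1..N} - {i, j}. g l)"
proof -
  have e: "{1..N} - {i} - {j} = {1..N} - {i, j}" by auto
  have "(\<Sum>l\<in>{1..N}. g l) = g i + (\<Sum>l\<in>{1..N} - {i}. g l)"
    using assms by (intro sum.remove) auto
  also have "(\<Sum>l\<in>{1..N} - {i}. g l) = g j + (\<Sum>l\<in>{1..N} - {i} - {j}. g l)"
    using assms by (intro sum.remove) auto
  finally show ?thesis unfolding e by (simp only: add.assoc)
qed

text \<open>Moving \<open>k\<close> units from the larger entry to the smaller one, without reaching
  the exchanged pair, balances the two entries, and truncated subtraction of a threshold is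
  convex.\<close>

lemma plus_part_shift:
  assumes i: "i \<in> {1..N}" and j: "j \<in> {1..N}" and ij: "i \<noteq> j"
    and k: "0 < k" "lk b j + k < lk b i"
  shows "dom_prec (plus_part (L (shift i j b k))) (plus_part (L b))" "deg (shift i j b k) = deg b"
proof -
  let ?c = "shift i j b k"
  have rest: "(\<Sum>l\<in>{1..N} - {i, j}. g (lk ?c l)) = (\<Sum>l\<in>{1..N} - {i, j}. g (lk b l))" for g :: "nat \<Rightarrow> nat"
    by (rule sum.cong) (auto simp: lookup_shift[OF ij])
  have sum: "sum_list (map g (L a)) = g (lk a i) + g (lk a j) + (\<Sum>l\<in>{1..N} - {i, j}. g (lk a l))" for g :: "nat \<Rightarrow> nat" and a
    unfolding sum_list_map_L by (rule sum_split_two[OF i j ij])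
  have "(\<Sum>x\<leftarrow>L ?c. x - t) \<le> (\<Sum>x\<leftarrow>L b. x - t)" for t
    unfolding sum rest using k ij by (auto simp: lookup_shift[OF ij])
  then have "sum_list (take n (plus_part (L ?c))) \<le> sum_list (take n (plus_part (L b)))" if "n \<le> N" for n
    using that by (intro plus_part_take_le) auto
  \<comment> \<open>This threshold detects strictness: both new entries are at most
    \<open>lk b i - 1\<close>, while the old entry at \<open>i\<close> exceeds it by one.\<close>
  moreover have "(\<Sum>x\<leftarrow>L ?c. x - (lk b i - 1)) \<noteq> (\<Sum>x\<leftarrow>L b. x - (lk b i - 1))"
    unfolding sum rest using k ij by (auto simp: lookup_shift[OF ij])
  then have "plus_part (L ?c) \<noteq> plus_part (L b)"
    using sum_list_map_mset_cong[of "L ?c" "L b"] mset_plus_part by metis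
  ultimately show "dom_prec (plus_part (L ?c)) (plus_part (L b))" unfolding dom_prec_def by auto
  show "deg ?c = deg b" using sum[of "\<lambda>x. x" ?c] sum[of "\<lambda>x. x" b] rest[of "\<lambda>x. x"] k ij
    by (simp add: sum_list_L lookup_shift[OF ij])
qed

abbreviation xpow :: "(nat \<Rightarrow>\<^sub>0 nat) \<Rightarrow> mpoly" where "xpow a \<equiv> sgl a 1"

text \<open>A finite geometric series, verified by telescoping; \<open>shift i j b k\<close> moves
  \<open>k\<close> units of the exponent from \<open>i\<close> to \<open>j\<close>.\<close>

lemma divdiff_xpow_gt:
  assumes ij: "i \<noteq> j" and gt: "lk b j < lk b i"
  shows "Xv i * divdiff i j (xpow b) = (\<Sum>k<lk b i - lk b j. xpow (shift i j b k))"
proof -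
  let ?d = "lk b i - lk b j"
  let ?q = "\<Sum>k<?d. xpow (shift i j b k - sgl i 1)"
  have 1: "Xv i * xpow (shift i j b k - sgl i 1) = xpow (shift i j b k)" if "k < ?d" for k
    unfolding Xv_mult_single using that
    by (intro arg_cong2[where f = sgl] poly_mapping_eqI)
      (auto simp: lookup_add lookup_minus lookup_shift[OF ij] lookup_single when_def)
  have 2: "Xv j * xpow (shift i j b k - sgl i 1) = xpow (shift i j b (Suc k))" if "k < ?d" for k
    unfolding Xv_mult_single using that ij
    by (intro arg_cong2[where f = sgl] poly_mapping_eqI)
      (auto simp: lookup_add lookup_minus lookup_shift[OF ij] lookup_single when_def)
  have "(Xv i - Xv j) * ?q = (\<Sum>k<?d. xpow (shift i j b k) - xpow (shift i j b (Suc k)))"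
    unfolding sum_distrib_left by (rule sum.cong) (auto simp: left_diff_distrib 1 2)
  also have "\<dots> = xpow (shift i j b 0) - xpow (shift i j b ?d)" by (rule sum_lessThan_telescope')
  also have "shift i j b 0 = b" by (simp add: shift_def)
  also have "shift i j b ?d = rename_exp (tp i j) b"
    using gt ij by (intro poly_mapping_eqI) (auto simp: lookup_shift[OF ij] transpose_def)
  finally have "divdiff i j (xpow b) = ?q" using ij by (intro divdiff_unique) (auto simp: perm_poly_single)
  then show ?thesis by (simp add: sum_distrib_left 1)
qed

text \<open>Exchanging the two variables in the argument changes the sign of the divided difference,
  which reduces this to the previous case.\<close>

lemma divdiff_xpow_lt:
  assumes ij: "i \<noteq> j" and less: "lk b i < lk b j"
  shows "Xv i * divdiff i j (xpow b) = - (\<Sum>k<lk b j - lk b i. xpow (shift i j (rename_exp (tp i j) b) k))"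
proof -
  have "divdiff i j (xpow b) = - divdiff i j (xpow (rename_exp (tp i j) b))"
  proof (rule divdiff_unique[OF ij])
    have "rename_exp (tp i j) (rename_exp (tp i j) b) = b" by (intro poly_mapping_eqI) simp
    then show "(Xv i - Xv j) * - divdiff i j (xpow (rename_exp (tp i j) b)) = xpow b - perm_poly (tp i j) (xpow b)"
      using divdiff_eq[OF ij, of "xpow (rename_exp (tp i j) b)"]
      by (simp add: perm_poly_single minus_mult_right[symmetric] del: minus_mult_right)
  qed
  then show ?thesis using divdiff_xpow_gt[OF ij, of "rename_exp (tp i j) b"] less by simp
qed

text \<open>The strict linear order on positions whose ranking function is \<open>r\<^sub>\<alpha>\<close>.\<close>

definition bef :: "(nat \<Rightarrow>\<^sub>0 nat) \<Rightarrow> nat \<Rightarrow> nat \<Rightarrow> bool" where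
  "bef b i j \<longleftrightarrow> lk b i > lk b j \<or> lk b i = lk b j \<and> i < j"

definition lowp :: "(nat \<Rightarrow>\<^sub>0 nat) \<Rightarrow> mpoly set" where
  "lowp b = {p. \<forall>a\<in>ks p. a \<in> EXP \<and> lt a b}"

lemma lowp_0 [simp]: "0 \<in> lowp b" by (simp add: lowp_def)
lemma lowp_add: "p \<in> lowp b \<Longrightarrow> q \<in> lowp b \<Longrightarrow> p + q \<in> lowp b"
  using keys_add[of p q] by (fastforce simp: lowp_def)
lemma lowp_uminus: "p \<in> lowp b \<Longrightarrow> - p \<in> lowp b"
  by (simp add: lowp_def in_keys_iff)
lemma lowp_sum: "(\<And>x. x \<in> B \<Longrightarrow> f x \<in> lowp b) \<Longrightarrow> sum f B \<in> lowp b"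
  by (induction B rule: infinite_finite_induct) (auto intro: lowp_add)
lemma lowp_xpow: "a \<in> EXP \<Longrightarrow> lt a b \<Longrightarrow> xpow a \<in> lowp b"
  by (simp add: lowp_def)

text \<open>The contribution of \<open>j\<close> to \<open>U i\<close> in the form of
  \<open>Uop_alt\<close>. For \<open>i < j\<close> and \<open>lk b i < lk b j\<close> the divided
  difference produces the reflected monomial, which is larger than \<open>b\<close>; the reflection
  from \<open>JMP\<close> cancels exactly this term.\<close>

lemma divdiff_triangular:
  assumes b: "b \<in> EXP" and i: "i \<in> {1..N}" and j: "j \<in> {1..N}" and ij: "i \<noteq> j"
  shows "Xv i * divdiff i j (xpow b) + (if i < j then xpow (rename_exp (tp i j) b) else 0)
    - (if bef b i j then xpow b else 0) \<in> lowp b"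
proof -
  let ?b = "rename_exp (tp i j) b"
  have b': "?b \<in> EXP" using EXP_rename[OF tp_permutes[OF i j] b] .
  have bb: "rename_exp (tp i j) ?b = b" by (intro poly_mapping_eqI) simp
  consider "lk b i = lk b j" | "lk b j < lk b i" | "lk b i < lk b j" by linarith
  then show ?thesis
  proof cases
    case 1
    then have e: "?b = b" by (intro poly_mapping_eqI) (auto simp: transpose_def)
    then have "divdiff i j (xpow b) = 0" using ij by (intro divdiff_unique) (auto simp: perm_poly_single)
    then show ?thesis using 1 e by (auto simp: bef_def)
  next
    case 2
    then obtain d where d: "lk b i - lk b j = Suc d" by (metis Suc_diff_Suc)
    have "xpow (shift i j b (Suc k)) \<in> lowp b" if "k < d" for k
      using plus_part_shift[OF i j ij, of "Suc k" b] that d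
      by (intro lowp_xpow EXP_shift b ij j) (auto simp: lt_def dom_lhd_def sum_list_L)
    then have "(\<Sum>k<d. xpow (shift i j b (Suc k))) \<in> lowp b" by (intro lowp_sum) auto
    moreover have "xpow ?b \<in> lowp b" if "i < j"
      using lt_swap[OF i j that, of ?b] 2 b' bb by (intro lowp_xpow) auto
    moreover have "Xv i * divdiff i j (xpow b) = xpow b + (\<Sum>k<d. xpow (shift i j b (Suc k)))"
      unfolding divdiff_xpow_gt[OF ij 2] d sum.lessThan_Suc_shift by (simp add: shift_def)
    ultimately show ?thesis using 2 by (auto simp: bef_def intro: lowp_add)
  next
    case 3
    then obtain d where d: "lk b j - lk b i = Suc d" by (metis Suc_diff_Suc)
    have "xpow (shift i j ?b (Suc k)) \<in> lowp b" if "k < d" for k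
      using plus_part_shift[OF i j ij, of "Suc k" ?b] that d plus_part_swap[OF i j, of b] deg_swap[OF i j, of b]
      by (intro lowp_xpow EXP_shift b' ij j) (auto simp: lt_def dom_lhd_def sum_list_L)
    then have "- (\<Sum>k<d. xpow (shift i j ?b (Suc k))) \<in> lowp b" by (intro lowp_sum lowp_uminus) auto
    moreover have "- xpow ?b \<in> lowp b" if "j < i"
      using lt_swap[OF j i that, of ?b] 3 b' bb by (intro lowp_xpow lowp_uminus) (auto simp: transpose_commute[of j i])
    moreover have "Xv i * divdiff i j (xpow b) = - xpow ?b - (\<Sum>k<d. xpow (shift i j ?b (Suc k)))"
      unfolding divdiff_xpow_lt[OF ij 3] d sum.lessThan_Suc_shift by (simp add: shift_def)
    ultimately show ?thesis using 3 ij lowp_add[of "- xpow ?b" b "- (\<Sum>k<d. xpow (shift i j ?b (Suc k)))"]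
      by (auto simp: bef_def)
  qed
qed

end

section \<open>Triangularity\<close>

lemma of_int_Fract: "(of_int k :: K) = Fract (of_int k) 1"
proof (cases k)
  case (nonneg n) then show ?thesis by (simp add: of_nat_fract)
next
  case (neg n)
  have "(of_int k :: K) = - of_nat (Suc n)" using neg by simp
  also have "\<dots> = Fract (- of_nat (Suc n)) 1" by (simp only: of_nat_fract minus_fract)
  finally show ?thesis using neg by simp
qed

text \<open>Comparison of the coefficients of the indeterminate. All genericity of \<kappa> enters
  the proof through this lemma.\<close>

lemma kappa_of_int: "kappa * of_int d = of_int e \<Longrightarrow> d = 0 \<and> e = 0"
proof -
  assume a: "kappa * of_int d = of_int e"
  have "Fract ([:0, 1:] * of_int d) 1 = Fract (of_int e :: real poly) 1"
    using a unfolding kappa_def of_int_Fract by simp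
  then have e: "[:0, 1:] * of_int d = (of_int e :: real poly)" by (simp add: eq_fract)
  have "coeff ([:0, 1:] * of_int d :: real poly) 1 = of_int d" "coeff (of_int e :: real poly) 1 = 0"
    by (simp_all add: of_int_poly One_nat_def)
  with e have "d = 0" by simp
  moreover from this e have "e = 0" by simp
  ultimately show ?thesis by simp
qed

lemma kappa_nonzero [simp]: "kappa \<noteq> 0"
  using kappa_of_int[of 1 0] by auto

lemma spectral_inj:
  assumes "of_nat m + kappa * of_int c = of_nat n + kappa * of_int d"
  shows "m = n \<and> c = d"
proof -
  have "kappa * of_int (c - d) = of_int (int n - int m)"
    using assms by (simp add: algebra_simps)
  from kappa_of_int[OF this] show ?thesis by simp
qed

context partition_shape
begin

definition rk :: "(nat \<Rightarrow>\<^sub>0 nat) \<Rightarrow> nat \<Rightarrow> nat" where "rk b = rank (L b)"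

lemma rk_outside: "i \<notin> {1..N} \<Longrightarrow> rk b i = i"
  unfolding rk_def rank_def by auto

lemma bef_irrefl [simp]: "\<not> bef b i i" by (simp add: bef_def)
lemma bef_trans: "bef b i j \<Longrightarrow> bef b j k \<Longrightarrow> bef b i k" by (auto simp: bef_def)
lemma bef_total: "i \<noteq> j \<Longrightarrow> bef b i j \<or> bef b j i" by (auto simp: bef_def)

lemma rk_eq_card:
  assumes i: "i \<in> {1..N}" shows "rk b i = card {j \<in> {1..N}. bef b j i \<or> j = i}"
proof -
  have "{j \<in> {1..N}. L b ! (j - 1) > L b ! (i - 1)} = {j \<in> {1..N}. lk b j > lk b i}"
    using i by (auto simp: nth_L)
  moreover have "{j \<in> {1..i}. L b ! (j - 1) = L b ! (i - 1)} = {j \<in> {1..i}. lk b j = lk b i}"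
    using i nth_L[of _ b] by auto
  ultimately have "rk b i = card {j \<in> {1..N}. lk b j > lk b i} + card {j \<in> {1..i}. lk b j = lk b i}"
    using i unfolding rk_def rank_def by simp
  also have "\<dots> = card ({j \<in> {1..N}. lk b j > lk b i} \<union> {j \<in> {1..i}. lk b j = lk b i})"
    by (rule card_Un_disjoint[symmetric]) auto
  also have "{j \<in> {1..N}. lk b j > lk b i} \<union> {j \<in> {1..i}. lk b j = lk b i} = {j \<in> {1..N}. bef b j i \<or> j = i}"
    using i by (auto simp: bef_def)
  finally show ?thesis .
qed

lemma rk_less:
  assumes "i \<in> {1..N}" "j \<in> {1..N}" "bef b i j" shows "rk b i < rk b j"
  unfolding rk_eq_card[OF assms(1)] rk_eq_card[OF assms(2)]
proof (rule psubset_card_mono)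
  have "j \<notin> {k \<in> {1..N}. bef b k i \<or> k = i}" using assms bef_trans[of b i j i] bef_trans[of b j i j] by auto
  then show "{k \<in> {1..N}. bef b k i \<or> k = i} \<subset> {k \<in> {1..N}. bef b k j \<or> k = j}"
    using assms bef_trans by blast
qed simp

lemma rk_less_iff:
  assumes "i \<in> {1..N}" "j \<in> {1..N}" shows "rk b i < rk b j \<longleftrightarrow> bef b i j"
  using rk_less[OF assms] rk_less[OF assms(2,1)] bef_total[of i j b] by (cases "i = j") force+

lemma rk_in: "i \<in> {1..N} \<Longrightarrow> rk b i \<in> {1..N}"
proof -
  assume i: "i \<in> {1..N}"
  have "card {j \<in> {1..N}. bef b j i \<or> j = i} \<le> card {1..N}" by (rule card_mono) auto
  moreover have "card {j \<in> {1..N}. bef b j i \<or> j = i} > 0" using i by (subst card_gt_0_iff) auto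
  ultimately show ?thesis unfolding rk_eq_card[OF i] by simp
qed

lemma rk_permutes [simp, intro]: "rk b permutes {1..N}"
proof (rule bij_imp_permutes)
  have "inj_on (rk b) {1..N}"
    by (rule inj_onI) (metis rk_less bef_total less_irrefl)
  then show "bij_betw (rk b) {1..N} {1..N}"
    unfolding bij_betw_def using rk_in[of _ b] endo_inj_surj[of "{1..N}" "rk b"] by blast
qed (rule rk_outside)

lemma inv_rk_permutes [simp, intro]: "inv (rk b) permutes {1..N}"
  by (rule permutes_inv) simp

text \<open>Ranks are determined by the order \<open>bef\<close>, so a relation between rank
  permutations is obtained by comparing two positions at a time.\<close>

lemma rk_comp:
  assumes w: "w permutes {1..N}"
    and bef: "\<And>j k. j \<in> {1..N} \<Longrightarrow> k \<in> {1..N} \<Longrightarrow> bef b j k \<longleftrightarrow> bef a (w j) (w k)"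
  shows "rk b = rk a \<circ> w"
proof
  fix i show "rk b i = (rk a \<circ> w) i"
  proof (cases "i \<in> {1..N}")
    case True
    have wi: "w j \<in> {1..N} \<longleftrightarrow> j \<in> {1..N}" for j using permutes_in_image[OF w] .
    have "w ` {j \<in> {1..N}. bef b j i \<or> j = i} = {j \<in> {1..N}. bef a j (w i) \<or> j = w i}"
    proof (intro equalityI subsetI)
      fix x assume "x \<in> w ` {j \<in> {1..N}. bef b j i \<or> j = i}"
      then show "x \<in> {j \<in> {1..N}. bef a j (w i) \<or> j = w i}" using bef True wi by blast
    next
      fix x assume x: "x \<in> {j \<in> {1..N}. bef a j (w i) \<or> j = w i}"
      define y where "y = inv w x"
      have y: "x = w y" unfolding y_def by (simp add: permutes_inverses(1)[OF w])
      have yN: "y \<in> {1..N}" using x wi[of y] unfolding y by simp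
      have "bef b y i \<or> y = i"
      proof (cases "w y = w i")
        case True
        then show ?thesis using permutes_inj[OF w] by (auto dest: injD)
      next
        case False
        then show ?thesis using x bef[OF yN True] unfolding y by simp
      qed
      with yN have "y \<in> {j \<in> {1..N}. bef b j i \<or> j = i}" by simp
      then show "x \<in> w ` {j \<in> {1..N}. bef b j i \<or> j = i}" using y by blast
    qed
    then have "card {j \<in> {1..N}. bef b j i \<or> j = i} = card {j \<in> {1..N}. bef a j (w i) \<or> j = w i}"
      by (metis (no_types, lifting) card_image inj_on_subset permutes_inj subset_UNIV w)
    then show ?thesis using True wi by (simp add: rk_eq_card del: atLeastAtMost_iff)
  next
    case False
    then have "w i = i" using w by (simp add: permutes_not_in)
    then show ?thesis using False by (simp add: rk_outside del: atLeastAtMost_iff)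
  qed
qed

section \<open>Leading coefficients\<close>

definition cf :: "ptau \<Rightarrow> (nat \<Rightarrow>\<^sub>0 nat) \<Rightarrow> vec" where "cf f a = (\<lambda>T. lk (f T) a)"

definition supp :: "ptau \<Rightarrow> (nat \<Rightarrow>\<^sub>0 nat) set" where "supp f = (\<Union>T. ks (f T))"

lemma cf_simps [simp]:
  "cf (f + g) a = (\<lambda>T. cf f a T + cf g a T)" "cf (f - g) a = (\<lambda>T. cf f a T - cf g a T)"
  "cf (c \<odot> f) a = (\<lambda>T. c * cf f a T)" "cf 0 a = (\<lambda>T. 0)"
  by (auto simp: cf_def fun_apply lookup_add lookup_minus)

lemma cf_sum: "cf (\<Sum>x\<in>B. h x) a = (\<lambda>T. \<Sum>x\<in>B. cf (h x) a T)"
  by (simp add: cf_def sum_fun_apply lookup_sum)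

lemma cf_ten: "cf (ten p v) a = (\<lambda>T. lk p a * v T)"
  unfolding cf_def ten_def by (rule ext) (metis lookup_const_mult mult.commute)

lemma supp_iff: "a \<in> supp f \<longleftrightarrow> cf f a \<noteq> (\<lambda>T. 0)"
  by (auto simp: supp_def cf_def in_keys_iff fun_eq_iff)

lemma cf_V [simp, intro]: "f \<in> P \<Longrightarrow> cf f a \<in> V"
  by (auto simp: P_iff cf_def V_def)

lemma supp_EXP: "f \<in> P \<Longrightarrow> supp f \<subseteq> EXP"
  unfolding Ptau_def EXP_def supp_def by auto

lemma finite_supp: "f \<in> P \<Longrightarrow> finite (supp f)"
proof -
  assume f: "f \<in> P"
  have "supp f = (\<Union>T\<in>R. ks (f T))" using f unfolding supp_def P_iff by fastforce
  then show ?thesis by simp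
qed

lemma ptau_eqI: "(\<And>a. cf f a = cf g a) \<Longrightarrow> f = g"
  by (auto simp: cf_def fun_eq_iff intro!: poly_mapping_eqI)

lemma supp_empty: "supp f = {} \<Longrightarrow> f = 0"
  by (rule ptau_eqI) (use supp_iff in auto)

lemma lookup_xpow: "lk (xpow b) a = (if a = b then 1 else 0)"
  by (auto simp: lookup_single when_def)

lemma xpow_P [simp, intro]: "b \<in> EXP \<Longrightarrow> v \<in> V \<Longrightarrow> ten (xpow b) v \<in> P"
  by (rule ten_P) (auto simp: PV_def EXP_def)

lemma monomial_expansion:
  assumes "f \<in> P" shows "f = (\<Sum>b\<in>supp f. ten (xpow b) (cf f b))"
proof (rule ptau_eqI)
  fix a
  have "(\<Sum>b\<in>supp f. lk (xpow b) a * cf f b T) = (\<Sum>b\<in>supp f. if b = a then cf f a T else 0)" for T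
    by (rule sum.cong) (auto simp: lookup_xpow)
  then show "cf f a = cf (\<Sum>b\<in>supp f. ten (xpow b) (cf f b)) a"
    using finite_supp[OF assms] supp_iff[of a f] by (auto simp: cf_sum cf_ten fun_eq_iff)
qed

lemma tau_perm_add: "tau_perm tau w (\<lambda>T. u T + v T) = (\<lambda>T. tau_perm tau w u T + tau_perm tau w v T)"
  using tau_perm_sum[where w = w and B = "UNIV :: bool set" and c = "\<lambda>_. 1" and f = "\<lambda>x. if x then u else v"]
  by (simp add: UNIV_bool add.commute)

lemma tau_perm_scale: "tau_perm tau w (\<lambda>T. c * v T) = (\<lambda>T. c * tau_perm tau w v T)"
  using tau_perm_sum[where w = w and B = "{()}" and c = "\<lambda>_. c" and f = "\<lambda>_. v"] by simp

lemma tau_perm_0 [simp]: "tau_perm tau w (\<lambda>T. 0) = (\<lambda>T. 0)"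
  using tau_perm_scale[of w 0] by simp

lemma tau_perm_inv [simp]:
  assumes "w permutes {1..N}" "v \<in> V"
  shows "tau_perm tau w (tau_perm tau (inv w) v) = v" "tau_perm tau (inv w) (tau_perm tau w v) = v"
  using assms by (simp_all add: tau_perm_comp permutes_inv permutes_inv_o)

text \<open>By \<open>divdiff_triangular\<close> all monomials other than \<open>b\<close> are
  strictly lower, and at \<open>b\<close> exactly the transpositions with positions \<open>j\<close>
  after \<open>i\<close> in the order \<open>bef\<close> survive.\<close>

lemma cf_U_xpow:
  assumes b: "b \<in> EXP" and v: "v \<in> V" and i: "i \<in> {1..N}" and a: "\<not> lt a b"
  shows "cf (U i (ten (xpow b) v)) a = (\<lambda>T. if a = b then of_nat (lk b i + 1) * v T
    + kappa * (\<Sum>j\<in>{1..N} - {i}. if bef b i j then tau_perm tau (tp i j) v T else 0) else 0)"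
proof
  fix T
  let ?q = "\<lambda>j. Xv i * divdiff i j (xpow b) + (if i < j then xpow (rename_exp (tp i j) b) else 0)"
  have q: "lk (?q j) a = (if a = b \<and> bef b i j then 1 else 0)" if "j \<in> {1..N} - {i}" for j
  proof -
    have "lk (?q j - (if bef b i j then xpow b else 0)) a = 0"
      using divdiff_triangular[OF b i, of j] that a unfolding lowp_def by (force simp: in_keys_iff)
    then show ?thesis by (auto simp: lookup_minus lookup_xpow split: if_splits)
  qed
  have "sgl i 1 + (b - sgl i 1) = b" if "lk b i \<noteq> 0"
    using that by (intro poly_mapping_eqI) (auto simp: lookup_add lookup_minus lookup_single when_def)
  then have d: "Xv i * pderiv_var i (xpow b) = const (of_nat (lk b i)) * xpow b"
    by (cases "lk b i = 0") (auto simp: pderiv_var_single Xv_mult_single)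
  have D: "D i (ten (xpow b) v) = ten (pderiv_var i (xpow b)) v
      + kappa \<odot> (\<Sum>j\<in>{1..N} - {i}. ten (divdiff i j (xpow b)) (tau_perm tau (tp i j) v))"
    unfolding Dunkl_eq dop_ten using Yop_ten[OF v i] by auto
  have "JMP i (ten (xpow b) v) = (\<Sum>j\<in>{Suc i..N}. ten (xpow (rename_exp (tp i j) b)) (tau_perm tau (tp i j) v))"
    unfolding JMP_def using v i by (intro sum.cong) (auto simp: act_ten perm_poly_single)
  also have "\<dots> = (\<Sum>j\<in>{1..N} - {i}. ten (if i < j then xpow (rename_exp (tp i j) b) else 0) (tau_perm tau (tp i j) v))"
    using i by (intro sum.mono_neutral_cong_left) (auto simp: ten_def zero_fun_def)
  finally have J: "JMP i (ten (xpow b) v) = \<dots>" .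
  have "cf (U i (ten (xpow b) v)) a T = (of_nat (lk b i) + 1) * lk (xpow b) a * v T
      + kappa * (\<Sum>j\<in>{1..N} - {i}. lk (?q j) a * tau_perm tau (tp i j) v T)"
    unfolding Uop_alt[OF i] D J
    by (simp add: Xop_ten d cf_sum cf_ten lookup_add sum.distrib ring_distribs del: const_mult_single)
  also have "(\<Sum>j\<in>{1..N} - {i}. lk (?q j) a * tau_perm tau (tp i j) v T) =
     (\<Sum>j\<in>{1..N} - {i}. if a = b \<and> bef b i j then tau_perm tau (tp i j) v T else 0)"
    by (rule sum.cong[OF refl]) (simp only: q, simp)
  finally show "cf (U i (ten (xpow b) v)) a T = (if a = b then of_nat (lk b i + 1) * v T
    + kappa * (\<Sum>j\<in>{1..N} - {i}. if bef b i j then tau_perm tau (tp i j) v T else 0) else 0)"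
    by (simp add: lookup_xpow)
qed

text \<open>Undoing the rank permutation turns the leading part of \<open>U\<^sub>i\<close> into a Jucys-Murphy element, so
  that in these coordinates its action on leading coefficients is diagonal.\<close>

definition tv :: "ptau \<Rightarrow> (nat \<Rightarrow>\<^sub>0 nat) \<Rightarrow> vec" where "tv f b = tau_perm tau (rk b) (cf f b)"

definition ev :: "(nat \<Rightarrow>\<^sub>0 nat) \<Rightarrow> tab \<Rightarrow> nat \<Rightarrow> K" where
  "ev b S i = of_nat (lk b i + 1) + kappa * of_int (content (rk b i) S)"

lemma tv_V [simp, intro]: "f \<in> P \<Longrightarrow> tv f b \<in> V"
  unfolding tv_def by auto

lemma tv_simps [simp]:
  "tv (f + g) a = (\<lambda>T. tv f a T + tv g a T)" "tv (c \<odot> f) a = (\<lambda>T. c * tv f a T)" "tv 0 a = (\<lambda>T. 0)"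
  by (simp_all add: tv_def tau_perm_add tau_perm_scale)

lemma tv_diff [simp]: "tv (f - g) a = (\<lambda>T. tv f a T - tv g a T)"
proof -
  have "f - g = f + (-1) \<odot> g" by simp
  then show ?thesis by (simp only: tv_simps) simp
qed

lemma tv_sum: "tv (\<Sum>x\<in>B. h x) a = (\<lambda>T. \<Sum>x\<in>B. tv (h x) a T)"
  by (induction B rule: infinite_finite_induct) auto

lemma cf_tv: "f \<in> P \<Longrightarrow> cf f b = tau_perm tau (inv (rk b)) (tv f b)"
  unfolding tv_def by simp

lemma tv_eq_0_iff: "f \<in> P \<Longrightarrow> tv f b = (\<lambda>T. 0) \<longleftrightarrow> b \<notin> supp f"
  unfolding supp_iff using cf_tv[of f b] tau_perm_0 unfolding tv_def by metis

lemma tv_xpow: "v \<in> V \<Longrightarrow> tv (ten (xpow b) v) a = (if a = b then tau_perm tau (rk b) v else (\<lambda>T. 0))"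
  unfolding tv_def cf_ten lookup_xpow by simp

text \<open>No monomial above \<open>b\<close> occurs, so only the one at \<open>b\<close> feeds the
  coefficient at \<open>b\<close>. Conjugation by the rank permutation turns the positions after
  \<open>i\<close> into the indices above \<open>rk b i\<close>, whence \<open>JM (rk b i)\<close>
  and its diagonal action.\<close>

lemma U_top:
  assumes f: "f \<in> P" and b: "b \<in> EXP" and i: "i \<in> {1..N}" and top: "\<And>a. a \<in> supp f \<Longrightarrow> \<not> lt b a"
  shows "tv (U i f) b = (\<lambda>S. ev b S i * tv f b S)"
proof -
  let ?v = "cf f b" and ?r = "rk b"
  have v: "?v \<in> V" using f by auto
  have "U i f = (\<Sum>a\<in>supp f. U i (ten (xpow a) (cf f a)))"
    by (subst monomial_expansion[OF f]) simp
  then have "cf (U i f) b = (\<lambda>T. \<Sum>a\<in>supp f. cf (U i (ten (xpow a) (cf f a))) b T)"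
    by (simp add: cf_sum)
  also have "\<dots> = (\<lambda>T. \<Sum>a\<in>supp f. if a = b then of_nat (lk b i + 1) * ?v T
    + kappa * (\<Sum>j\<in>{1..N} - {i}. if bef b i j then tau_perm tau (tp i j) ?v T else 0) else 0)"
    using top supp_EXP[OF f] f i by (intro ext sum.cong) (auto simp: cf_U_xpow subset_iff)
  also have "\<dots> = (\<lambda>T. of_nat (lk b i + 1) * ?v T
    + kappa * (\<Sum>j\<in>{1..N} - {i}. if bef b i j then tau_perm tau (tp i j) ?v T else 0))"
  proof (cases "b \<in> supp f")
    case False
    then have v0: "?v = (\<lambda>T. 0)" by (simp add: supp_iff)
    show ?thesis unfolding v0 by (simp cong: if_cong)
  qed (use finite_supp[OF f] in simp)
  also have "\<dots> = (\<lambda>T. of_nat (lk b i + 1) * ?v T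
    + kappa * (\<Sum>j\<in>{1..N} - {i}. (if bef b i j then 1 else 0) * tau_perm tau (tp i j) ?v T))"
    by (simp add: if_distrib[of "\<lambda>x. x * _"] cong: if_cong)
  finally have "tv (U i f) b = (\<lambda>S. of_nat (lk b i + 1) * tv f b S
     + kappa * (\<Sum>j\<in>{1..N} - {i}. (if bef b i j then 1 else 0) * tau_perm tau ?r (tau_perm tau (tp i j) ?v) S))"
    unfolding tv_def by (simp only: tau_perm_add tau_perm_scale tau_perm_sum)
  moreover have "(\<Sum>j\<in>{1..N} - {i}. (if bef b i j then 1 else 0) * tau_perm tau ?r (tau_perm tau (tp i j) ?v) S)
     = JM (?r i) (tv f b) S" for S
  proof -
    have conj: "tau_perm tau ?r (tau_perm tau (tp i j) ?v) = tau_perm tau (tp (?r i) (?r j)) (tv f b)" if "j \<in> {1..N}" for j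
      unfolding tv_def using i that rk_in v tp_comp_conj[OF permutes_bij[OF rk_permutes]]
      by (simp add: tau_perm_comp del: atLeastAtMost_iff)
    have "(\<Sum>j\<in>{1..N} - {i}. (if bef b i j then 1 else 0) * tau_perm tau ?r (tau_perm tau (tp i j) ?v) S) =
      (\<Sum>j\<in>{j\<in>{1..N}. bef b i j}. tau_perm tau (tp (?r i) (?r j)) (tv f b) S)"
      by (rule sum.mono_neutral_cong_right) (auto simp: conj)
    also have "\<dots> = (\<Sum>l\<in>{Suc (?r i)..N}. tau_perm tau (tp (?r i) l) (tv f b) S)"
    proof (rule sum.reindex_bij_witness[where i = "inv ?r" and j = ?r])
      fix l assume l: "l \<in> {Suc (?r i)..N}"
      have "l \<in> {1..N}" using l rk_in[OF i] by auto
      then have "inv ?r l \<in> {1..N}" using permutes_in_image[OF inv_rk_permutes] by blast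
      moreover have "?r i < ?r (inv ?r l)" using l by (simp add: permutes_inverses(1)[OF rk_permutes])
      ultimately show "inv ?r l \<in> {j \<in> {1..N}. bef b i j}" using rk_less_iff[OF i] by auto
    qed (use rk_less[OF i] rk_in in \<open>auto simp: permutes_inverses[OF rk_permutes] Suc_le_eq\<close>)
    finally show ?thesis unfolding JM_def .
  qed
  ultimately show ?thesis
    using JM_diagonal[OF tv_V[OF f, of b] rk_in[OF i, of b]] by (auto simp: ev_def algebra_simps)
qed

lemma ex_maximal:
  assumes "finite S" "S \<noteq> {}" shows "\<exists>b\<in>S. \<forall>a\<in>S. \<not> lt b a"
  using assms
proof (induction S rule: finite_ne_induct)
  case (insert x F)
  then obtain b where "b \<in> F" "\<forall>a\<in>F. \<not> lt b a" by auto
  then show ?case using lt_trans lt_irrefl by (cases "lt b x") blast+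
qed simp

section \<open>Joint eigenvectors\<close>

definition eigen :: "(nat \<Rightarrow> K) \<Rightarrow> ptau \<Rightarrow> bool" where
  "eigen e f \<longleftrightarrow> f \<in> P \<and> (\<forall>i\<in>{1..N}. U i f = e i \<odot> f)"

lemma eigen_P: "eigen e f \<Longrightarrow> f \<in> P" by (simp add: eigen_def)

lemma eigen_diff: "eigen e f \<Longrightarrow> eigen e g \<Longrightarrow> eigen e (f - g)"
  by (auto simp: eigen_def pm.scale_right_diff_distrib)

lemma eigen_scale: "eigen e f \<Longrightarrow> eigen e (c \<odot> f)"
  by (auto simp: eigen_def mult.commute)

text \<open>At a maximal exponent \<open>U_top\<close> exhibits the eigenvalues, and their parts
  free of \<kappa> give back the exponent. The integers \<open>c i\<close> are arbitrary because in
  \<open>sw_Z_equal\<close> they need not be contents of a standard tableau.\<close>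

lemma eigen_maximal:
  assumes f: "eigen (\<lambda>i. of_nat (lk a i + 1) + kappa * of_int (c i)) f" and a: "a \<in> EXP"
    and b: "b \<in> supp f" "\<And>d. d \<in> supp f \<Longrightarrow> \<not> lt b d"
  shows "b = a"
proof -
  have fP: "f \<in> P" using f by (rule eigen_P)
  have bE: "b \<in> EXP" using supp_EXP[OF fP] b by auto
  obtain S where S: "tv f b S \<noteq> 0" using b(1) tv_eq_0_iff[OF fP, of b] by auto
  show "b = a"
  proof (rule EXP_eqI[OF bE a])
    fix i assume i: "i \<in> {1..N}"
    have "(of_nat (lk a i + 1) + kappa * of_int (c i)) * tv f b S = ev b S i * tv f b S"
    proof -
      have e: "U i f = (of_nat (lk a i + 1) + kappa * of_int (c i)) \<odot> f" using f i unfolding eigen_def by blast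
      show ?thesis using fun_cong[OF U_top[OF fP bE i b(2)], of S] unfolding e by simp
    qed
    then show "lk b i = lk a i" using S spectral_inj unfolding ev_def by force
  qed
qed

lemma eigen_supp:
  assumes f: "eigen (\<lambda>i. of_nat (lk a i + 1) + kappa * of_int (c i)) f" and a: "a \<in> EXP" and b: "b \<in> supp f"
  shows "b = a \<or> lt b a"
proof -
  let ?S = "{d \<in> supp f. d = b \<or> lt b d}"
  have "finite ?S" "?S \<noteq> {}" using finite_supp[OF eigen_P[OF f]] b by auto
  from ex_maximal[OF this] obtain d where d: "d \<in> ?S" "\<forall>x\<in>?S. \<not> lt d x" by auto
  then have "\<not> lt d x" if "x \<in> supp f" for x using that lt_trans by blast
  then have "d = a" using eigen_maximal[OF f a] d by auto
  then show ?thesis using d by auto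
qed

lemma eigen_zero:
  assumes f: "eigen (\<lambda>i. of_nat (lk a i + 1) + kappa * of_int (c i)) f" and a: "a \<in> EXP" and "tv f a = (\<lambda>T. 0)"
  shows "f = 0"
proof (rule ccontr)
  assume "f \<noteq> 0"
  then have "supp f \<noteq> {}" using supp_empty by auto
  from ex_maximal[OF finite_supp[OF eigen_P[OF f]] this]
  obtain b where "b \<in> supp f" "\<forall>d\<in>supp f. \<not> lt b d" by auto
  then have "a \<in> supp f" using eigen_maximal[OF f a] by auto
  then show False using assms(3) tv_eq_0_iff[OF eigen_P[OF f]] by auto
qed

end

section \<open>Nonsymmetric Jack polynomials\<close>

context partition_shape
begin

lemma ev_fun: "ev a T = (\<lambda>i. of_nat (lk a i + 1) + kappa * of_int (content (rk a i) T))"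
  by (rule ext) (simp add: ev_def)

lemma supp_add: "supp (f + g) \<subseteq> supp f \<union> supp g"
  and supp_diff: "supp (f - g) \<subseteq> supp f \<union> supp g"
  and supp_scale: "supp (c \<odot> f) \<subseteq> supp f"
  and supp_ten: "supp (ten (xpow b) v) \<subseteq> {b}"
  by (auto simp: supp_iff cf_ten lookup_xpow fun_eq_iff split: if_splits)

lemma supp_U_ten:
  assumes "b \<in> EXP" "v \<in> V" "i \<in> {1..N}"
  shows "supp (U i (ten (xpow b) v)) \<subseteq> {c \<in> EXP. c = b \<or> lt c b}"
proof
  fix c assume c: "c \<in> supp (U i (ten (xpow b) v))"
  have "U i (ten (xpow b) v) \<in> P" using assms by auto
  then have "c \<in> EXP" using supp_EXP c by blast
  moreover have "c = b \<or> lt c b"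
  proof (rule ccontr)
    assume "\<not> (c = b \<or> lt c b)"
    then have "cf (U i (ten (xpow b) v)) c = (\<lambda>T. 0)" using cf_U_xpow[OF assms, of c] by auto
    then show False using c by (simp add: supp_iff)
  qed
  ultimately show "c \<in> {c \<in> EXP. c = b \<or> lt c b}" by simp
qed

text \<open>The conditions of \<open>zeta\<close>, except that the leading coefficient is undone by
  the rank permutation and thus becomes the basis vector of \<open>T\<close>.\<close>

definition zsp :: "(nat \<Rightarrow>\<^sub>0 nat) \<Rightarrow> tab \<Rightarrow> ptau \<Rightarrow> bool" where
  "zsp a T f \<longleftrightarrow> eigen (ev a T) f \<and> tv f a = basisv T \<and> supp f \<subseteq> {b. b = a \<or> lt b a}"

text \<open>Existence: the defects \<open>(U\<^sub>i - e\<^sub>i) f\<close> are supported on \<open>B\<close>. At a maximal exponent \<open>b\<close> of \<open>B\<close> each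
  of them could be cancelled by a multiple of \<open>x\<^sup>b\<close>; commutativity of the \<open>U\<^sub>i\<close> makes the required
  multiple independent of \<open>i\<close>.\<close>

lemma zsp_correct:
  assumes a: "a \<in> EXP" and T: "T \<in> R"
  shows "finite B \<Longrightarrow> B \<subseteq> {b \<in> EXP. lt b a} \<Longrightarrow> (\<And>b c. b \<in> B \<Longrightarrow> c \<in> EXP \<Longrightarrow> lt c b \<Longrightarrow> c \<in> B) \<Longrightarrow>
    f \<in> P \<Longrightarrow> tv f a = basisv T \<Longrightarrow> supp f \<subseteq> {b. b = a \<or> lt b a} \<Longrightarrow>
    (\<And>i. i \<in> {1..N} \<Longrightarrow> supp (U i f - ev a T i \<odot> f) \<subseteq> B) \<Longrightarrow> \<exists>g. zsp a T g"
proof (induction B arbitrary: f rule: finite_psubset_induct)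
  case (psubset B)
  note f = psubset.prems(3) and down = psubset.prems(2)
  show ?case
  proof (cases "B = {}")
    case True
    then have "U i f = ev a T i \<odot> f" if "i \<in> {1..N}" for i
      using supp_empty[of "U i f - ev a T i \<odot> f"] psubset.prems(6)[OF that] by simp
    then have "zsp a T f" using psubset.prems unfolding zsp_def eigen_def by auto
    then show ?thesis by (rule exI[of _ f])
  next
    case False
    from ex_maximal[OF psubset.hyps this] obtain b where b: "b \<in> B" "\<And>x. x \<in> B \<Longrightarrow> \<not> lt b x" by auto
    have bE: "b \<in> EXP" and ba: "lt b a" using b psubset.prems(1) by auto
    define g where "g i = U i f - ev a T i \<odot> f" for i
    have gP: "g i \<in> P" if "i \<in> {1..N}" for i using f that unfolding g_def by auto
    have gtop: "tv (U j (g i)) b = (\<lambda>S. ev b S j * tv (g i) b S)" if "i \<in> {1..N}" "j \<in> {1..N}" for i j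
      using U_top[OF gP[OF that(1)] bE that(2)] psubset.prems(6)[OF that(1)] b(2) unfolding g_def by blast
    have compat: "(ev b S j - ev a T j) * tv (g i) b S = (ev b S i - ev a T i) * tv (g j) b S"
      if ij: "i \<in> {1..N}" "j \<in> {1..N}" for i j S
    proof -
      have "U j (g i) - ev a T j \<odot> g i = U i (g j) - ev a T i \<odot> g j"
        unfolding g_def using Uop_commute[OF f ij]
        by (simp add: pm.scale_right_diff_distrib mult.commute)
      then have "tv (U j (g i) - ev a T j \<odot> g i) b S = tv (U i (g j) - ev a T i \<odot> g j) b S" by simp
      then show ?thesis unfolding tv_diff tv_simps gtop[OF ij] gtop[OF ij(2,1)]
        by (simp add: algebra_simps)
    qed
    \<comment> \<open>The exponents already differ, so some index separates the eigenvalues; it may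
      depend on \<open>S\<close>, hence the choice function \<open>idx\<close>.\<close>
    have "\<exists>i\<in>{1..N}. ev b S i \<noteq> ev a T i" for S
    proof (rule ccontr)
      assume "\<not> ?thesis"
      then have "lk b i = lk a i" if "i \<in> {1..N}" for i using that spectral_inj unfolding ev_def by force
      then have "b = a" by (rule EXP_eqI[OF bE a])
      then show False using ba by simp
    qed
    then obtain idx where idx: "\<And>S. idx S \<in> {1..N}" "\<And>S. ev b S (idx S) \<noteq> ev a T (idx S)" by metis
    define h where "h S = tv (g (idx S)) b S / (ev b S (idx S) - ev a T (idx S))" for S
    have hV: "h \<in> V" unfolding V_def
    proof (intro CollectI allI impI)
      fix S assume "S \<notin> R"
      then show "h S = 0" using tv_V[OF gP[OF idx(1)[of S]], of b] unfolding h_def V_def by simp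
    qed
    define k where "k = ten (xpow b) (tau_perm tau (inv (rk b)) h)"
    have hV': "tau_perm tau (inv (rk b)) h \<in> V" using hV by auto
    have kP: "k \<in> P" unfolding k_def using bE hV' by auto
    have ksupp: "supp k \<subseteq> {b}" unfolding k_def by (rule supp_ten)
    have tvk: "tv k b = h" "c \<noteq> b \<Longrightarrow> tv k c = (\<lambda>T. 0)" for c
      unfolding k_def using tv_xpow[OF hV'] hV by auto
    show ?thesis
    proof (rule psubset.IH[of "B - {b}" "f - k"])
      show "f - k \<in> P" using f kP by auto
      have "a \<noteq> b" using ba by auto
      then show "tv (f - k) a = basisv T" by (simp add: psubset.prems(4) tvk(2))
      show "supp (f - k) \<subseteq> {b. b = a \<or> lt b a}"
        using supp_diff[of f k] ksupp psubset.prems(5) ba by blast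
      show "B - {b} \<subset> B" using b by auto
      show "B - {b} \<subseteq> {b \<in> EXP. lt b a}" using psubset.prems(1) by auto
      show "c \<in> B - {b}" if "x \<in> B - {b}" "c \<in> EXP" "lt c x" for x c
        using that down[of x c] b(2)[of x] by auto
      fix i assume i: "i \<in> {1..N}"
      have e: "U i (f - k) - ev a T i \<odot> (f - k) = g i - (U i k - ev a T i \<odot> k)"
        unfolding g_def by (simp add: pm.scale_right_diff_distrib)
      have "supp (U i k) \<subseteq> B" using supp_U_ten[OF bE hV' i] b down unfolding k_def by blast
      moreover have "supp (g i) \<subseteq> B" using psubset.prems(6)[OF i] unfolding g_def .
      moreover have "supp k \<subseteq> B" using ksupp b by blast
      ultimately have "supp (U i (f - k) - ev a T i \<odot> (f - k)) \<subseteq> B"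
        unfolding e using supp_diff[of "g i" "U i k - ev a T i \<odot> k"] supp_diff[of "U i k" "ev a T i \<odot> k"]
          supp_scale[of "ev a T i" k] by blast
      moreover have "b \<notin> supp (U i (f - k) - ev a T i \<odot> (f - k))"
      proof -
        have "tv (U i k) b = (\<lambda>S. ev b S i * h S)"
          using U_top[OF kP bE i] ksupp tvk(1) by fastforce
        moreover have "tv (g i) b S = (ev b S i - ev a T i) * h S" for S
          using compat[OF i idx(1), of S] idx(2)[of S] unfolding h_def by (simp add: field_simps)
        ultimately have "tv (g i - (U i k - ev a T i \<odot> k)) b = (\<lambda>T. 0)"
          by (simp add: tvk fun_eq_iff algebra_simps)
        moreover have "g i - (U i k - ev a T i \<odot> k) \<in> P" using gP[OF i] kP i by auto
        ultimately show ?thesis unfolding e using tv_eq_0_iff by blast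
      qed
      ultimately show "supp (U i (f - k) - ev a T i \<odot> (f - k)) \<subseteq> B - {b}" by blast
    qed
  qed
qed

text \<open>The leading monomial alone has defects supported strictly below \<open>a\<close>, a
  finite set closed downwards, as \<open>zsp_correct\<close> requires.\<close>

lemma zsp_exists:
  assumes a: "a \<in> EXP" and T: "T \<in> R" shows "\<exists>f. zsp a T f"
proof (rule zsp_correct[OF assms finite_lt subset_refl])
  define v where "v = tau_perm tau (inv (rk a)) (basisv T)"
  have v: "v \<in> V" using T unfolding v_def by auto
  let ?f = "ten (xpow a) v"
  show f: "?f \<in> P" using a v by auto
  show tvf: "tv ?f a = basisv T" using tv_xpow[OF v, of a a] T by (simp add: v_def)
  show "supp ?f \<subseteq> {b. b = a \<or> lt b a}" using supp_ten[of a v] by auto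
  show "c \<in> {b \<in> EXP. lt b a}" if "b \<in> {b \<in> EXP. lt b a}" "c \<in> EXP" "lt c b" for b c
    using that lt_trans by blast
  fix i assume i: "i \<in> {1..N}"
  have "tv (U i ?f) a = (\<lambda>S. ev a S i * tv ?f a S)"
    using supp_ten[of a v] by (intro U_top[OF f a i]) auto
  then have "tv (U i ?f - ev a T i \<odot> ?f) a = (\<lambda>S. 0)"
    unfolding tv_diff tv_simps tvf by (intro ext) (simp add: basisv_def)
  then have "a \<notin> supp (U i ?f - ev a T i \<odot> ?f)"
    using tv_eq_0_iff[of "U i ?f - ev a T i \<odot> ?f" a] f i by auto
  then show "supp (U i ?f - ev a T i \<odot> ?f) \<subseteq> {b \<in> EXP. lt b a}"
    using supp_U_ten[OF a v i] supp_diff[of "U i ?f" "ev a T i \<odot> ?f"] supp_scale[of "ev a T i" ?f] supp_ten[of a v]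
    by blast
qed

lemma eigen_eqI:
  assumes "eigen (\<lambda>i. of_nat (lk a i + 1) + kappa * of_int (c i)) f" "eigen (\<lambda>i. of_nat (lk a i + 1) + kappa * of_int (c i)) g"
    "a \<in> EXP" "tv f a = tv g a"
  shows "f = g"
  using eigen_zero[OF eigen_diff[OF assms(1,2)] assms(3)] assms(4) by simp

definition Z :: "(nat \<Rightarrow>\<^sub>0 nat) \<Rightarrow> tab \<Rightarrow> ptau" where "Z a T = (THE f. zsp a T f)"

lemma zsp_unique: "a \<in> EXP \<Longrightarrow> zsp a T f \<Longrightarrow> zsp a T g \<Longrightarrow> f = g"
  unfolding zsp_def ev_fun by (rule eigen_eqI[where a = a and c = "\<lambda>i. content (rk a i) T"]) simp_all

lemma zsp_Z: "a \<in> EXP \<Longrightarrow> T \<in> R \<Longrightarrow> zsp a T (Z a T)"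
proof -
  assume a: "a \<in> EXP" "T \<in> R"
  from zsp_exists[OF this] obtain f where "zsp a T f" by (rule exE)
  then have "\<exists>!f. zsp a T f" by (rule ex1I[of _ f]) (use \<open>zsp a T f\<close> zsp_unique[OF a(1)] in blast)
  then show ?thesis unfolding Z_def by (rule theI')
qed



lemma eigen_Z: "a \<in> EXP \<Longrightarrow> T \<in> R \<Longrightarrow> eigen (ev a T) (Z a T)"
  and tv_Z: "a \<in> EXP \<Longrightarrow> T \<in> R \<Longrightarrow> tv (Z a T) a = basisv T"
  and supp_Z: "a \<in> EXP \<Longrightarrow> T \<in> R \<Longrightarrow> b \<in> supp (Z a T) \<Longrightarrow> b = a \<or> lt b a"
  using zsp_Z unfolding zsp_def by auto

lemma Z_P [simp, intro]: "a \<in> EXP \<Longrightarrow> T \<in> R \<Longrightarrow> Z a T \<in> P"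
  using eigen_Z eigen_P by blast

lemma U_Z: "a \<in> EXP \<Longrightarrow> T \<in> R \<Longrightarrow> i \<in> {1..N} \<Longrightarrow> U i (Z a T) = ev a T i \<odot> Z a T"
  using eigen_Z unfolding eigen_def by blast

lemma zeta_eq_Z:
  assumes al: "length al = N" and T: "T \<in> R" shows "zeta tau al T = Z (expo al) T"
proof -
  let ?a = "expo al"
  have a: "?a \<in> EXP" and La: "L ?a = al" using al by (simp_all add: expo_EXP L_expo)
  have rk: "rk ?a = rank al" by (simp add: rk_def La)
  have lka: "lk ?a i = al ! (i - 1)" if "i \<in> {1..N}" for i using that al by (simp add: lookup_expo)
  have low: "(\<forall>T' b. b \<in> ks (f T') \<longrightarrow> b = ?a \<or> (\<exists>beta. length beta = length al \<and> b = expo beta \<and> dom_lhd beta al))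
     \<longleftrightarrow> supp f \<subseteq> {b. b = ?a \<or> lt b ?a}" if "f \<in> P" for f
  proof -
    have "(\<exists>beta. length beta = length al \<and> b = expo beta \<and> dom_lhd beta al) \<longleftrightarrow> lt b ?a" if "b \<in> EXP" for b
      using that al expo_L[OF that] L_expo unfolding lt_def La by (metis length_L)
    moreover have "b \<in> EXP" if "b \<in> ks (f T')" for b T' using supp_EXP[OF \<open>f \<in> P\<close>] that unfolding supp_def by auto
    ultimately show ?thesis unfolding supp_def by blast
  qed
  have cfv: "(\<forall>T'. lk (f T') ?a = tau_perm tau (inv (rank al)) (basisv T) T') \<longleftrightarrow> tv f ?a = basisv T" if "f \<in> P" for f
  proof -
    have "(\<forall>T'. lk (f T') ?a = tau_perm tau (inv (rk ?a)) (basisv T) T') \<longleftrightarrow> cf f ?a = tau_perm tau (inv (rk ?a)) (basisv T)"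
      unfolding cf_def by (simp add: fun_eq_iff)
    also have "\<dots> \<longleftrightarrow> tv f ?a = basisv T"
      using cf_tv[OF that, of ?a] T unfolding tv_def by auto
    finally show ?thesis unfolding rk .
  qed
  have eig: "(\<forall>i\<in>{1..length al}. U i f = (of_nat (al ! (i - 1) + 1) + kappa * of_int (content (rank al i) T)) \<odot> f)
     \<longleftrightarrow> (\<forall>i\<in>{1..N}. U i f = ev ?a T i \<odot> f)" for f
    unfolding ev_def rk using lka al by (auto simp del: of_nat_add)
  have "(\<lambda>f. f \<in> Ptau tau
     \<and> (\<forall>T'. lk (f T') (expo al) = tau_perm tau (inv (rank al)) (basisv T) T')
     \<and> (\<forall>T' b. b \<in> ks (f T') \<longrightarrow> b = expo al \<or> (\<exists>beta. length beta = length al \<and> b = expo beta \<and> dom_lhd beta al))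
     \<and> (\<forall>i\<in>{1..length al}. Uop tau i f = psmul (of_nat (al ! (i - 1) + 1) + kappa * of_int (content (rank al i) T)) f))
    = zsp ?a T"
    unfolding zsp_def eigen_def eig using low cfv by (intro ext) blast
  then show ?thesis unfolding zeta_def Z_def by simp
qed

text \<open>Given the exponent, the contents still separate tableaux. So the leading coefficient of
  \<open>f\<close> is concentrated at \<open>T\<close>, and it determines \<open>f\<close>.\<close>

lemma eigen_unique:
  assumes f: "eigen (ev a T) f" and a: "a \<in> EXP" and T: "T \<in> R"
  shows "f = tv f a T \<odot> Z a T"
proof -
  have fP: "f \<in> P" using f by (rule eigen_P)
  have off: "tv f a S = 0" if "S \<noteq> T" for S
  proof (cases "S \<in> R")
    case True
    obtain j where j: "j \<in> {1..N}" "content j S \<noteq> content j T"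
      using content_inj[OF True T] \<open>S \<noteq> T\<close> by blast
    define i where "i = inv (rk a) j"
    have i: "i \<in> {1..N}" "rk a i = j" unfolding i_def
      using permutes_in_image[OF inv_rk_permutes] j permutes_inverses(1)[OF rk_permutes] by auto
    have "\<And>b. b \<in> supp f \<Longrightarrow> \<not> lt a b"
      using eigen_supp[OF f[unfolded ev_fun] a] lt_trans lt_irrefl by blast
    from U_top[OF fP a i(1) this] have "tv (U i f) a S = ev a S i * tv f a S" by simp
    moreover have "U i f = ev a T i \<odot> f" using f i unfolding eigen_def by blast
    ultimately have "ev a T i * tv f a S = ev a S i * tv f a S" by simp
    moreover have "ev a T i \<noteq> ev a S i" using spectral_inj[of "lk a i + 1" "content j T" "lk a i + 1" "content j S"] j i
      unfolding ev_def by auto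
    ultimately show ?thesis by auto
  next
    case False then show ?thesis using tv_V[OF fP, of a] unfolding V_def by auto
  qed
  then have "tv f a = tv (tv f a T \<odot> Z a T) a"
    using tv_Z[OF a T] by (auto simp: basisv_def)
  then show ?thesis
    using f eigen_scale[OF eigen_Z[OF a T], of "tv f a T"] unfolding ev_fun
    by (intro eigen_eqI[where a = a and c = "\<lambda>i. content (rk a i) T"] a)
qed

text \<open>At a maximal exponent of \<open>B\<close> the coefficient is cancelled by Jack
  polynomials, which bring in only smaller exponents; closure of \<open>B\<close> downwards keeps
  the induction going.\<close>

lemma Z_span:
  "finite B \<Longrightarrow> B \<subseteq> EXP \<Longrightarrow> (\<And>b c. b \<in> B \<Longrightarrow> c \<in> EXP \<Longrightarrow> lt c b \<Longrightarrow> c \<in> B) \<Longrightarrow> f \<in> P \<Longrightarrow> supp f \<subseteq> B \<Longrightarrow>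
    f \<in> pm.span ((\<lambda>(b, S). Z b S) ` (B \<times> R))"
proof (induction B arbitrary: f rule: finite_psubset_induct)
  case (psubset B)
  note down = psubset.prems(2)
  show ?case
  proof (cases "B = {}")
    case True
    then have "f = 0" using psubset.prems supp_empty by auto
    then show ?thesis by (simp add: pm.span_zero)
  next
    case False
    from ex_maximal[OF psubset.hyps this] obtain b where b: "b \<in> B" "\<And>x. x \<in> B \<Longrightarrow> \<not> lt b x" by auto
    have bE: "b \<in> EXP" using b psubset.prems by auto
    define g where "g = (\<Sum>S\<in>R. tv f b S \<odot> Z b S)"
    have gP: "g \<in> P" unfolding g_def using bE by auto
    have gs: "g \<in> pm.span ((\<lambda>(b, S). Z b S) ` (B \<times> R))"
      unfolding g_def by (intro pm.span_sum pm.span_scale pm.span_base) (use b in auto)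
    have "c \<in> B" if c: "c \<in> supp g" for c
    proof (rule ccontr)
      assume "c \<notin> B"
      then have "c \<notin> supp (Z b S)" if "S \<in> R" for S
        using supp_Z[OF bE that] b down[OF b(1), of c] supp_EXP[OF gP] c by blast
      then have "cf (Z b S) c = (\<lambda>T. 0)" if "S \<in> R" for S using that by (simp add: supp_iff)
      then have "cf g c = (\<lambda>T. 0)" unfolding g_def cf_sum cf_simps by (intro ext sum.neutral) auto
      then show False using c by (simp add: supp_iff)
    qed
    then have "supp (f - g) \<subseteq> B" using supp_diff[of f g] psubset.prems(4) by blast
    moreover have "tv g b = tv f b"
    proof -
      have "tv g b = (\<lambda>T. \<Sum>S\<in>R. tv f b S * basisv S T)"
        unfolding g_def tv_sum tv_simps by (intro ext sum.cong) (auto simp: tv_Z bE)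
      then show ?thesis using basisv_expand[OF tv_V[OF psubset.prems(3)], of b] by simp
    qed
    then have "b \<notin> supp (f - g)" using tv_eq_0_iff[of "f - g" b] gP psubset.prems(3) by simp
    ultimately have "supp (f - g) \<subseteq> B - {b}" by blast
    then have "f - g \<in> pm.span ((\<lambda>(b, S). Z b S) ` ((B - {b}) \<times> R))"
      using psubset.prems gP b by (intro psubset.IH) auto
    moreover have "pm.span ((\<lambda>(b, S). Z b S) ` ((B - {b}) \<times> R)) \<subseteq> pm.span ((\<lambda>(b, S). Z b S) ` (B \<times> R))"
      by (intro pm.span_mono image_mono) auto
    ultimately have "f - g + g \<in> pm.span ((\<lambda>(b, S). Z b S) ` (B \<times> R))"
      using gs by (intro pm.span_add) auto
    then show ?thesis by simp
  qed
qed

lemma span_image: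
  assumes "linop h" "\<And>x. x \<in> B \<Longrightarrow> h x \<in> pm.span C" "f \<in> pm.span B" shows "h f \<in> pm.span C"
proof -
  have "pm.subspace {x. h x \<in> pm.span C}"
    by (rule pm.subspaceI) (auto simp: linop_simps[OF assms(1)] pm.span_zero intro: pm.span_add pm.span_scale)
  then show ?thesis using pm.span_induct[OF assms(3), of "\<lambda>x. h x \<in> pm.span C"] assms(2) by simp
qed

lemma cf_act:
  assumes w: "w permutes {1..N}" and f: "f \<in> P"
  shows "cf (A w f) (rename_exp w a) = tau_perm tau w (cf f a)"
proof
  fix T
  have inj: "rename_exp w a = rename_exp w b \<longleftrightarrow> b = a" for b
    using lookup_rename[OF permutes_bij[OF w]] by (metis poly_mapping_eqI)
  have "A w f = (\<Sum>b\<in>supp f. A w (ten (xpow b) (cf f b)))"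
    by (subst monomial_expansion[OF f]) simp
  also have "\<dots> = (\<Sum>b\<in>supp f. ten (xpow (rename_exp w b)) (tau_perm tau w (cf f b)))"
    using f w by (intro sum.cong) (auto simp: act_ten perm_poly_single)
  finally have "cf (A w f) (rename_exp w a) T = (\<Sum>b\<in>supp f. if b = a then tau_perm tau w (cf f a) T else 0)"
    by (simp only: cf_sum cf_ten lookup_xpow inj) (rule sum.cong, auto)
  also have "\<dots> = tau_perm tau w (cf f a) T"
  proof (cases "a \<in> supp f")
    case False
    then have "cf f a = (\<lambda>T. 0)" by (simp add: supp_iff)
    then show ?thesis using False finite_supp[OF f] by simp
  qed (use finite_supp[OF f] in simp)
  finally show "cf (A w f) (rename_exp w a) T = tau_perm tau w (cf f a) T" .
qed

end

section \<open>Intertwiners and the affine step\<close>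

lemma theta_Suc: "1 \<le> m \<Longrightarrow> theta (Suc m) = theta m \<circ> tp m (Suc m)"
  unfolding theta_def by (simp add: word_perm_append word_perm_Cons)

lemma theta_apply:
  "1 \<le> m \<Longrightarrow> theta m k = (if 1 \<le> k \<and> k < m then Suc k else if k = m then 1 else k)"
proof (induction m arbitrary: k rule: dec_induct)
  case base
  show ?case by (simp add: theta_def)
next
  case (step m)
  then show ?case by (auto simp: theta_Suc transpose_def)
qed

lemma theta_simps [simp]:
  "1 \<le> k \<Longrightarrow> k < m \<Longrightarrow> theta m k = Suc k" "1 \<le> m \<Longrightarrow> theta m m = 1" "1 \<le> m \<Longrightarrow> m < k \<Longrightarrow> theta m k = k"
  by (simp_all add: theta_apply)

lemma theta_permutes: "theta m permutes {1..m}"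
  unfolding theta_def by (rule word_perm_permutes) simp

context partition_shape
begin

lemma theta_permutes_N [simp, intro]: "m \<le> N \<Longrightarrow> theta m permutes {1..N}"
  by (rule permutes_subset[OF theta_permutes]) auto

lemma inv_theta_permutes_N [simp, intro]: "m \<le> N \<Longrightarrow> inv (theta m) permutes {1..N}"
  by (rule permutes_inv) auto

text \<open>By \<open>sw_Uop\<close> the reflection exchanges two eigenvalues up to a multiple
  \<kappa> of \<open>f\<close>, and the stated multiple of \<open>f\<close> absorbs this error. The
  result may be zero, which \<open>eigen\<close> admits.\<close>

lemma sw_eigen:
  assumes f: "eigen e f" and i: "1 \<le> i" "Suc i \<le> N" and ne: "e i \<noteq> e (Suc i)"
  shows "eigen (e \<circ> tp i (Suc i)) (sw i (Suc i) f - (kappa / (e i - e (Suc i))) \<odot> f)"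
  unfolding eigen_def
proof (intro conjI ballI)
  let ?s = "sw i (Suc i)" and ?c = "kappa / (e i - e (Suc i))"
  have fP: "f \<in> P" and U: "\<And>k. k \<in> {1..N} \<Longrightarrow> U k f = e k \<odot> f" using f by (auto simp: eigen_def)
  have sP: "?s f \<in> P" using fP i by auto
  then show "?s f - ?c \<odot> f \<in> P" using fP by auto
  have ss: "?s (?s f) = f" using fP i by simp
  have c: "?c * (e i - e (Suc i)) = kappa" using ne by simp
  have U2: "U (Suc i) (?s f) = e i \<odot> ?s f - kappa \<odot> f"
    using sw_Uop[OF fP i] U[of i] i by simp
  have "?s (U i (?s f)) = e (Suc i) \<odot> f + kappa \<odot> ?s f"
    using sw_Uop[OF sP i] U[of "Suc i"] i by (simp add: ss)
  then have "?s (?s (U i (?s f))) = e (Suc i) \<odot> ?s f + kappa \<odot> f" by (simp add: ss)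
  then have U1: "U i (?s f) = e (Suc i) \<odot> ?s f + kappa \<odot> f" using sP i by simp
  fix k assume k: "k \<in> {1..N}"
  consider "k = i" | "k = Suc i" | "k \<noteq> i" "k \<noteq> Suc i" by blast
  then show "U k (?s f - ?c \<odot> f) = (e \<circ> tp i (Suc i)) k \<odot> (?s f - ?c \<odot> f)"
  proof cases
    case 1
    have "U i (?s f - ?c \<odot> f) = e (Suc i) \<odot> ?s f + kappa \<odot> f - (?c * e i) \<odot> f"
      using U1 U[of i] i by simp
    also have "kappa \<odot> f = (?c * (e i - e (Suc i))) \<odot> f" unfolding c ..
    also have "e (Suc i) \<odot> ?s f + (?c * (e i - e (Suc i))) \<odot> f - (?c * e i) \<odot> f = e (Suc i) \<odot> (?s f - ?c \<odot> f)"
      by (simp only: right_diff_distrib pm.scale_left_diff_distrib pm.scale_right_diff_distrib pm.scale_scale mult.commute[of _ ?c]) simp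
    finally show ?thesis using 1 by simp
  next
    case 2
    have "U (Suc i) (?s f - ?c \<odot> f) = e i \<odot> ?s f - kappa \<odot> f - (?c * e (Suc i)) \<odot> f"
      using U2 U[of "Suc i"] i by simp
    also have "kappa \<odot> f = (?c * (e i - e (Suc i))) \<odot> f" unfolding c ..
    also have "e i \<odot> ?s f - (?c * (e i - e (Suc i))) \<odot> f - (?c * e (Suc i)) \<odot> f = e i \<odot> (?s f - ?c \<odot> f)"
      by (simp only: right_diff_distrib pm.scale_left_diff_distrib pm.scale_right_diff_distrib pm.scale_scale mult.commute[of _ ?c]) simp
    finally show ?thesis using 2 by simp
  next
    case 3
    then have "U k (?s f) = e k \<odot> ?s f" using sw_Uop_other[OF i k 3, of f] U[OF k] by simp
    moreover have "tp i (Suc i) k = k" using 3 by simp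
    ultimately show ?thesis using U[OF k] by (simp add: pm.scale_right_diff_distrib mult.commute)
  qed
qed

lemma rk_swap:
  assumes i: "1 \<le> i" "Suc i \<le> N" and ne: "lk a i \<noteq> lk a (Suc i)"
  shows "rk (rename_exp (tp i (Suc i)) a) = rk a \<circ> tp i (Suc i)"
proof (rule rk_comp)
  show "tp i (Suc i) permutes {1..N}" using i by auto
  show "bef (rename_exp (tp i (Suc i)) a) j k = bef a (tp i (Suc i) j) (tp i (Suc i) k)" for j k
    unfolding bef_def lookup_rename_tp using ne by (auto simp: transpose_def)
qed

lemma ev_swap:
  assumes i: "1 \<le> i" "Suc i \<le> N" and ne: "lk a i \<noteq> lk a (Suc i)"
  shows "ev (rename_exp (tp i (Suc i)) a) T = ev a T \<circ> tp i (Suc i)"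
  by (rule ext) (simp add: ev_def rk_swap[OF assms])

text \<open>The raised exponent does not occur in \<open>Z a T\<close>, so its coefficient comes
  from the reflected leading term alone and is normalized to 1.\<close>

lemma sw_Z_raise:
  assumes a: "a \<in> EXP" and T: "T \<in> R" and i: "1 \<le> i" "Suc i \<le> N" and less: "lk a i < lk a (Suc i)"
  shows "\<exists>c. sw i (Suc i) (Z a T) = Z (rename_exp (tp i (Suc i)) a) T + c \<odot> Z a T"
proof -
  let ?s = "tp i (Suc i)" and ?b = "rename_exp (tp i (Suc i)) a"
  let ?c = "kappa / (ev a T i - ev a T (Suc i))"
  let ?f = "A ?s (Z a T) - ?c \<odot> Z a T"
  have s: "?s permutes {1..N}" using i by auto
  have b: "?b \<in> EXP" by (rule EXP_rename[OF s a])
  have "ev a T i \<noteq> ev a T (Suc i)" using spectral_inj less unfolding ev_def by force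
  from sw_eigen[OF eigen_Z[OF a T] i this] have f: "eigen (ev ?b T) ?f"
    using ev_swap[of i a T] i less by simp
  have ZP: "Z a T \<in> P" using a T by auto
  have "lt a ?b" using i less by (intro lt_swap) auto
  then have "?b \<notin> supp (Z a T)" using supp_Z[OF a T] lt_trans lt_irrefl by metis
  then have tv0: "tv (Z a T) ?b = (\<lambda>T. 0)" using tv_eq_0_iff[OF ZP] by blast
  have "tv (A ?s (Z a T)) ?b = tau_perm tau (rk a \<circ> ?s) (tau_perm tau ?s (cf (Z a T) a))"
    unfolding tv_def cf_act[OF s ZP] using rk_swap[of i a] i less by simp
  also have "\<dots> = tau_perm tau (rk a \<circ> ?s \<circ> ?s) (cf (Z a T) a)"
    using ZP s by (intro tau_perm_comp permutes_compose) auto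
  also have "rk a \<circ> ?s \<circ> ?s = rk a" by (simp add: comp_assoc)
  also have "tau_perm tau (rk a) (cf (Z a T) a) = basisv T" using tv_Z[OF a T] unfolding tv_def .
  finally have "tv ?f ?b T = 1" using tv0 by (simp add: basisv_def)
  then have "?f = Z ?b T" using eigen_unique[OF f b T] by simp
  then have "A ?s (Z a T) = Z ?b T + ?c \<odot> Z a T" by (simp add: algebra_simps)
  then show ?thesis by blast
qed

text \<open>Equal adjacent entries have consecutive ranks \<open>j\<close> and \<open>Suc j\<close>,
  so on leading coefficients the reflection acts as the generator \<open>j\<close> of the tableau
  representation.\<close>

lemma sw_Z_equal:
  assumes a: "a \<in> EXP" and T: "T \<in> R" and i: "1 \<le> i" "Suc i \<le> N" and eq: "lk a i = lk a (Suc i)"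
  shows "sw i (Suc i) (Z a T) \<in> pm.span (Z a ` R)"
proof -
  let ?s = "tp i (Suc i)"
  define j where "j = rk a i"
  have iN: "i \<in> {1..N}" "Suc i \<in> {1..N}" using i by auto
  have s: "?s permutes {1..N}" using i by auto
  have ZP: "Z a T \<in> P" using a T by auto
  have rS: "rk a (Suc i) = Suc j"
  proof -
    have "{k \<in> {1..N}. bef a k (Suc i) \<or> k = Suc i} = insert (Suc i) {k \<in> {1..N}. bef a k i \<or> k = i}"
      using iN eq by (auto simp: bef_def)
    moreover have "Suc i \<notin> {k \<in> {1..N}. bef a k i \<or> k = i}" using eq by (auto simp: bef_def)
    ultimately show ?thesis unfolding j_def rk_eq_card[OF iN(1)] rk_eq_card[OF iN(2)] by simp
  qed
  have j: "1 \<le> j" "Suc j \<le> N" using rk_in[OF iN(1), of a] rk_in[OF iN(2), of a] rS unfolding j_def by auto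
  define b where "b = content j T - content (Suc j) T"
  have b0: "b \<noteq> 0" using content_distinct[OF T j] unfolding b_def by simp
  have evd: "ev a T i - ev a T (Suc i) = kappa * of_int b"
    unfolding ev_def rS j_def[symmetric] b_def eq by (simp add: algebra_simps)
  define f where "f = A ?s (Z a T) - (1 / of_int b) \<odot> Z a T"
  have "ev a T i \<noteq> ev a T (Suc i)" using evd b0 by auto
  from sw_eigen[OF eigen_Z[OF a T] i this] have "eigen (ev a T \<circ> ?s) f"
    using b0 unfolding f_def evd by simp
  moreover have "ev a T \<circ> ?s = (\<lambda>k. of_nat (lk a k + 1) + kappa * of_int (content (rk a (?s k)) T))"
    by (rule ext) (auto simp: ev_def transpose_def eq)
  ultimately have ef: "eigen (\<lambda>k. of_nat (lk a k + 1) + kappa * of_int (content (rk a (?s k)) T)) f" by simp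
  have conj: "rk a \<circ> ?s = tp j (Suc j) \<circ> rk a"
    using tp_comp_conj[OF permutes_bij[OF rk_permutes], of a i "Suc i"] unfolding rS j_def[symmetric] .
  have "cf (A ?s (Z a T)) (rename_exp ?s a) = tau_perm tau ?s (cf (Z a T) a)" by (rule cf_act[OF s ZP])
  moreover have "rename_exp ?s a = a" using eq by (intro poly_mapping_eqI) (auto simp: transpose_def)
  ultimately have "tv (A ?s (Z a T)) a = tau_perm tau (rk a) (tau_perm tau ?s (cf (Z a T) a))"
    unfolding tv_def by simp
  also have "\<dots> = tau_perm tau (tp j (Suc j)) (tv (Z a T) a)"
    using ZP s j conj unfolding tv_def by (simp add: tau_perm_comp)
  also have "\<dots> = sg j (basisv T)"
    unfolding tv_Z[OF a T] using T j by (intro tau_perm_adjacent) auto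
  finally have tvf: "tv f a = (\<lambda>S. sg j (basisv T) S - (1 / of_int b) * basisv T S)"
    unfolding f_def by (simp add: tv_Z[OF a T])
  have "swapT j T \<noteq> T"
    using content_swapT[of j j T] content_distinct[OF T j] by (metis transpose_apply_first)
  then have tvf': "tv f a = (\<lambda>S. gfac b * (if S = swapT j T then 1 else 0))"
  proof -
    have "sg j (basisv T) S - (1 / of_int b) * basisv T S = gfac b * (if S = swapT j T then 1 else 0)" for S
    proof -
      consider "S = T" | "S = swapT j T" | "S \<noteq> T" "swapT j S \<noteq> T" by (metis swapT_swapT)
      then show ?thesis
      proof cases
        case 1
        then show ?thesis using \<open>swapT j T \<noteq> T\<close> by (auto simp: sg_def basisv_def b_def)
      next
        case 2
        then show ?thesis using \<open>swapT j T \<noteq> T\<close> by (simp add: sg_def basisv_def b_def)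
      next
        case 3
        then have "S \<noteq> swapT j T" by auto
        with 3 show ?thesis by (simp add: sg_def basisv_def)
      qed
    qed
    then show ?thesis unfolding tvf by simp
  qed
  have "f \<in> pm.span (Z a ` R)"
  proof (cases "swapT j T \<in> R")
    case True
    let ?T = "swapT j T"
    have "content (rk a (?s k)) T = content (rk a k) ?T" for k
      using fun_cong[OF conj, of k] by simp
    then have "eigen (ev a ?T) f" using ef unfolding ev_fun by simp
    from eigen_unique[OF this a True] have "f = tv f a ?T \<odot> Z a ?T" .
    moreover have "tv f a ?T \<odot> Z a ?T \<in> pm.span (Z a ` R)"
      using True by (intro pm.span_scale pm.span_base) auto
    ultimately show ?thesis by metis
  next
    \<comment> \<open>The swapped tableau is not standard: \<open>gfac\<close> vanishes, and the
      intertwined vector is zero.\<close>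
    case False
    then have "tv f a = (\<lambda>S. 0)" unfolding tvf' b_def using swapT_notin_R(1)[OF T j] by simp
    then have "f = 0" using eigen_zero[OF ef a] by simp
    then show ?thesis by (simp add: pm.span_zero)
  qed
  moreover have "(1 / of_int b) \<odot> Z a T \<in> pm.span (Z a ` R)" using T by (intro pm.span_scale pm.span_base) auto
  ultimately have "f + (1 / of_int b) \<odot> Z a T \<in> pm.span (Z a ` R)" by (rule pm.span_add)
  then show ?thesis unfolding f_def by simp
qed

lemma Xop_inj: "Xop i f = 0 \<Longrightarrow> f = 0"
proof -
  assume "Xop i f = 0"
  then have "Xop i f T = 0" for T by (simp add: fun_apply)
  then have "Xv i * f T = 0" for T unfolding Xop_def .
  moreover have "Xv i \<noteq> 0" unfolding Xv_def by (metis lookup_single_eq lookup_zero zero_neq_one)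
  ultimately show ?thesis by (auto simp: fun_eq_iff fun_apply)
qed

text \<open>Descending induction on \<open>j\<close>. At \<open>N\<close> the rank is
  \<open>N\<close>, its content 0 and the eigenvalue 1, so \<open>x_N D_N\<close> annihilates the
  polynomial. For smaller \<open>j\<close> the operator is conjugated to \<open>D (Suc j)\<close> by
  a reflection that preserves the span over all tableaux; hence the generality in
  \<open>T\<close>.\<close>

lemma Dunkl_Z_zero:
  assumes a: "a \<in> EXP" and j: "j \<in> {1..N}" and zero: "\<And>k. j \<le> k \<Longrightarrow> k \<le> N \<Longrightarrow> lk a k = 0"
    and T: "T \<in> R"
  shows "D j (Z a T) = 0"
  using j zero T
proof (induction "N - j" arbitrary: j T)
  case 0
  then have j: "j = N" by auto
  have ZP: "Z a T \<in> P" using a 0 by auto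
  have "{k \<in> {1..N}. bef a k N \<or> k = N} = {1..N}" using 0 j by (auto simp: bef_def)
  then have "rk a N = N" using rk_eq_card[of N a] 0 j by simp
  then have "ev a T N = 1" using content_N[of T] 0 j by (simp add: ev_def)
  then have "U N (Z a T) = Z a T" using U_Z[OF a, of T N] 0 j by simp
  moreover have "U N (Z a T) = Xop N (D N (Z a T)) + Z a T"
    using Uop_alt[of N "Z a T"] 0 j by (simp add: JMP_def)
  ultimately have "Xop N (D N (Z a T)) = 0" by simp
  then show ?case using Xop_inj j by blast
next
  case (Suc n)
  then have i: "1 \<le> j" "Suc j \<le> N" by auto
  have ZP: "Z a T \<in> P" using a Suc by auto
  have "D (Suc j) x = 0" if "x \<in> pm.span (Z a ` R)" for x
  proof -
    have "D (Suc j) x \<in> pm.span {}"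
    proof (rule span_image[OF linop_Dunkl _ that])
      fix x assume "x \<in> Z a ` R"
      then obtain S where "x = Z a S" "S \<in> R" by auto
      then have "D (Suc j) x = 0" using Suc.hyps(1)[of "Suc j" S] Suc.hyps(2) Suc.prems i by auto
      then show "D (Suc j) x \<in> pm.span {}" by simp
    qed
    then show ?thesis by simp
  qed
  moreover have "sw j (Suc j) (Z a T) \<in> pm.span (Z a ` R)"
    using Suc.prems i by (intro sw_Z_equal a) auto
  ultimately have "D (Suc j) (sw j (Suc j) (Z a T)) = 0" by blast
  then have "sw j (Suc j) (D j (Z a T)) = 0" using act_Dunkl[of "tp j (Suc j)" j] i by simp
  then have "sw j (Suc j) (sw j (Suc j) (D j (Z a T))) = 0" by simp
  then show ?case using ZP i by simp
qed

section \<open>Cyclic shifts of the Cherednik-Dunkl operators\<close>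

lemma U_theta_1: "1 \<le> m \<Longrightarrow> m \<le> N \<Longrightarrow> U 1 (A (theta m) g) = A (theta m) (D m (Xop m g))"
  using act_DX[of "theta m" m g] by (simp add: Uop_eq lowJM_def)

text \<open>The cycle raises the indices below \<open>m\<close> by one and sends \<open>m\<close> to
  1. The transposition of \<open>Suc k\<close> with 1 therefore comes from \<open>(k, m)\<close>,
  which has no counterpart in \<open>lowJM k\<close>.\<close>

lemma U_theta_Suc:
  assumes "1 \<le> k" "k < m" "m \<le> N"
  shows "U (Suc k) (A (theta m) g) = A (theta m) (U k g - kappa \<odot> sw k m g)"
proof -
  let ?t = "theta m"
  have t: "?t permutes {1..N}" using assms by auto
  have "lowJM (Suc k) (A ?t g) = sw (Suc k) 1 (A ?t g) + (\<Sum>j\<in>{1..<k}. sw (Suc k) (Suc j) (A ?t g))"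
    unfolding lowJM_def using assms sum.atLeast_Suc_lessThan[of 1 "Suc k" "\<lambda>j. sw (Suc k) j (A ?t g)"]
      sum.shift_bounds_Suc_ivl[of "\<lambda>j. sw (Suc k) j (A ?t g)" 1 k] by simp
  also have "sw (Suc k) 1 (A ?t g) = A ?t (sw k m g)" using act_sw[OF t, of k m g] assms by simp
  also have "(\<Sum>j\<in>{1..<k}. sw (Suc k) (Suc j) (A ?t g)) = A ?t (lowJM k g)"
    unfolding lowJM_def act_linear using assms by (intro sum.cong) (auto simp: act_sw[OF t])
  finally have "lowJM (Suc k) (A ?t g) = A ?t (sw k m g) + A ?t (lowJM k g)" .
  then show ?thesis using act_DX[OF t, of k g] assms unfolding Uop_eq
    by (simp add: pm.scale_right_distrib)
qed

text \<open>The subtracted reflection is the one that appears in \<open>U_theta_Suc\<close>; after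
  the cyclic shift the eigenvalue passes unchanged from \<open>k\<close> to
  \<open>Suc k\<close>.\<close>

lemma U_Dunkl_less:
  assumes f: "f \<in> P" and k: "1 \<le> k" "k < m" "m \<le> N"
  shows "U k (D m f) - kappa \<odot> sw k m (D m f) = D m (U k f)"
proof -
  have km: "k \<in> {1..N}" "m \<in> {1..N}" "k \<noteq> m" using k by auto
  have s: "D k (sw k m f) = sw k m (D m f)" using act_Dunkl[of "tp k m" m f] km by simp
  have "Xop k (D m f) = D m (Xop k f) + kappa \<odot> sw k m f"
    using Dunkl_Xop_diff[OF km(2,1), of f] km by (simp add: transpose_commute[of m k])
  then have "D k (Xop k (D m f)) = D m (D k (Xop k f)) + kappa \<odot> sw k m (D m f)"
    using Dunkl_commute[of "Xop k f" k m] f km by (simp add: s)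
  moreover have "lowJM k (D m f) = D m (lowJM k f)"
    unfolding lowJM_def Dunkl_linear
  proof (rule sum.cong)
    fix j assume "j \<in> {1..<k}"
    then show "sw k j (D m f) = D m (sw k j f)" using act_Dunkl[of "tp k j" m f] k by auto
  qed simp
  ultimately show ?thesis unfolding Uop_eq by simp
qed

text \<open>The error is governed by \<open>D k f\<close> with \<open>m < k\<close>, which vanishes
  for the polynomials in question by \<open>Dunkl_Z_zero\<close>.\<close>

lemma U_Dunkl_greater:
  assumes f: "f \<in> P" and k: "1 \<le> m" "m < k" "k \<le> N"
  shows "U k (D m f) = D m (U k f) + kappa \<odot> sw k m (D k f)"
proof -
  have km: "k \<in> {1..N}" "m \<in> {1..N}" "k \<noteq> m" using k by auto
  have s: "D k (sw k m f) = sw k m (D m f)" "D m (sw k m f) = sw k m (D k f)"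
    using act_Dunkl[of "tp k m" m f] act_Dunkl[of "tp k m" k f] km by auto
  have "Xop k (D m f) = D m (Xop k f) + kappa \<odot> sw k m f"
    using Dunkl_Xop_diff[OF km(2,1), of f] km by (simp add: transpose_commute[of m k])
  then have 1: "D k (Xop k (D m f)) = D m (D k (Xop k f)) + kappa \<odot> sw k m (D m f)"
    using Dunkl_commute[of "Xop k f" k m] f km by (simp add: s)
  have "sw k j (D m f) = D m (sw k j f) + (if j = m then sw k m (D m f) - sw k m (D k f) else 0)" if "j \<in> {1..<k}" for j
    using that act_Dunkl[of "tp k j" m f] k s by auto
  then have "lowJM k (D m f) = (\<Sum>j\<in>{1..<k}. D m (sw k j f) + (if j = m then sw k m (D m f) - sw k m (D k f) else 0))"
    unfolding lowJM_def by simp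
  also have "\<dots> = D m (lowJM k f) + (sw k m (D m f) - sw k m (D k f))"
    unfolding lowJM_def using k by (simp add: sum.distrib)
  finally show ?thesis unfolding Uop_eq 1 by (simp add: pm.scale_right_distrib pm.scale_right_diff_distrib)
qed

text \<open>The exponent \<open>(b_2, ..., b_N, b_1 + 1)\<close> of the affine step.\<close>

definition ups :: "(nat \<Rightarrow>\<^sub>0 nat) \<Rightarrow> nat \<Rightarrow>\<^sub>0 nat" where
  "ups b = sgl N 1 + rename_exp (inv (theta N)) b"

definition hat :: "(nat \<Rightarrow>\<^sub>0 nat) \<Rightarrow> nat \<Rightarrow> nat \<Rightarrow>\<^sub>0 nat" where
  "hat a m = rename_exp (theta m) (a - sgl m 1)"

lemma lookup_ups: "lk (ups b) k = lk b (theta N k) + (if k = N then 1 else 0)"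
proof -
  have "lk (rename_exp (inv (theta N)) b) (inv (theta N) (theta N k)) = lk b (theta N k)"
    by (intro lookup_rename permutes_bij[OF inv_theta_permutes_N]) simp
  then show ?thesis unfolding ups_def lookup_add lookup_single
    by (simp add: permutes_inverses(2)[OF theta_permutes_N[OF order_refl]] when_def)
qed

lemma lookup_hat: "m \<le> N \<Longrightarrow> lk (hat a m) (theta m k) = lk a k - (if k = m then 1 else 0)"
  unfolding hat_def by (subst lookup_rename) (auto intro: permutes_bij simp: lookup_minus lookup_single when_def)

lemma EXP_ups: "b \<in> EXP \<Longrightarrow> 0 < N \<Longrightarrow> ups b \<in> EXP"
  using EXP_rename[OF inv_theta_permutes_N[OF order_refl], of b] keys_add[of "sgl N 1" "rename_exp (inv (theta N)) b"]
  unfolding ups_def EXP_def by fastforce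

lemma EXP_hat: "a \<in> EXP \<Longrightarrow> m \<le> N \<Longrightarrow> hat a m \<in> EXP"
  unfolding hat_def by (rule EXP_rename) (auto simp: EXP_def in_keys_iff lookup_minus subset_iff)

text \<open>Moving the first entry to the end loses its advantage in ties, and raising it by one
  restores exactly this advantage.\<close>

lemma rk_ups:
  assumes N: "0 < N" shows "rk (ups b) = rk b \<circ> theta N"
proof (rule rk_comp)
  fix j k assume "j \<in> {1..N}" "k \<in> {1..N}"
  then consider "j < N" "k < N" | "j = N" "k < N" | "j < N" "k = N" | "j = N" "k = N" by fastforce
  then show "bef (ups b) j k = bef b (theta N j) (theta N k)"
    using \<open>j \<in> {1..N}\<close> \<open>k \<in> {1..N}\<close> unfolding bef_def lookup_ups by cases auto
qed (rule theta_permutes_N, simp)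

text \<open>Against the entries before \<open>m\<close>, the loss of one unit is made up by winning
  ties from the front. The entries after \<open>m\<close> are 0 and still come later, because
  \<open>lk a m - 1\<close> is at least 0 and now stands first.\<close>

lemma rk_hat:
  assumes m: "1 \<le> m" "m \<le> N" and pos: "0 < lk a m" and zero: "\<And>k. m < k \<Longrightarrow> k \<le> N \<Longrightarrow> lk a k = 0"
  shows "rk a = rk (hat a m) \<circ> theta m"
proof (rule rk_comp)
  fix j k assume jk: "j \<in> {1..N}" "k \<in> {1..N}"
  have t: "theta m i = (if i < m then Suc i else if i = m then 1 else i)" if "i \<in> {1..N}" for i
    using that m by (simp add: theta_apply)
  show "bef a j k = bef (hat a m) (theta m j) (theta m k)"
    unfolding bef_def lookup_hat[OF m(2)] unfolding t[OF jk(1)] t[OF jk(2)]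
    using jk pos zero[of j] zero[of k] by (cases j m rule: linorder_cases; cases k m rule: linorder_cases) auto
qed (use m in auto)

text \<open>Multiplication by \<open>x_N\<close> and the inverse cycle each produce the reflection
  \<open>(k, N)\<close>, and these cancel. So the spectrum is shifted cyclically, the last
  eigenvalue growing by one, and the leading coefficient stays normalized.\<close>

lemma Xop_Z:
  assumes b: "b \<in> EXP" and T: "T \<in> R" and N: "0 < N"
  shows "Xop N (A (inv (theta N)) (Z b T)) = Z (ups b) T"
proof -
  let ?t = "theta N" and ?g = "A (inv (theta N)) (Z b T)"
  have t: "?t permutes {1..N}" by auto
  have ZP: "Z b T \<in> P" using b T by auto
  have gP: "?g \<in> P" using ZP by auto
  have tg: "A ?t ?g = Z b T" using act_inv(1)[OF ZP t] .
  have U: "U k (Xop N ?g) = Xop N (ev b T (Suc k) \<odot> ?g)" if k: "1 \<le> k" "k < N" for k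
  proof -
    have "A ?t (U k ?g - kappa \<odot> sw k N ?g) = ev b T (Suc k) \<odot> Z b T"
      using U_theta_Suc[of k N ?g] U_Z[OF b T, of "Suc k"] k unfolding tg by simp
    then have "A (inv ?t) (A ?t (U k ?g - kappa \<odot> sw k N ?g)) = ev b T (Suc k) \<odot> ?g" by simp
    then have 1: "U k ?g - kappa \<odot> sw k N ?g = ev b T (Suc k) \<odot> ?g"
      using act_inv(2)[OF _ t, of "U k ?g - kappa \<odot> sw k N ?g"] gP k by simp
    have "lowJM k (Xop N ?g) = Xop N (lowJM k ?g)"
      unfolding lowJM_def Xop_linear using k by (intro sum.cong) (auto simp: act_Xop)
    moreover have "D k (Xop k (Xop N ?g)) = Xop N (D k (Xop k ?g)) - kappa \<odot> Xop N (sw k N ?g)"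
      using Dunkl_Xop_diff[of k N "Xop k ?g"] k by (simp add: Xop_commute[of k N] act_Xop)
    ultimately have "U k (Xop N ?g) = Xop N (U k ?g - kappa \<odot> sw k N ?g)" unfolding Uop_eq by simp
    then show ?thesis unfolding 1 .
  qed
  have "A ?t (D N (Xop N ?g)) = ev b T 1 \<odot> Z b T"
    using U_theta_1[of N ?g] U_Z[OF b T, of 1] N unfolding tg by simp
  then have "A (inv ?t) (A ?t (D N (Xop N ?g))) = ev b T 1 \<odot> ?g" by simp
  then have 2: "D N (Xop N ?g) = ev b T 1 \<odot> ?g"
    using act_inv(2)[OF _ t, of "D N (Xop N ?g)"] gP N by simp
  have UN: "U N (Xop N ?g) = Xop N (ev b T 1 \<odot> ?g) + Xop N ?g"
    using Uop_alt[of N "Xop N ?g"] N unfolding 2 by (simp add: JMP_def)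
  have eig: "eigen (ev (ups b) T) (Xop N ?g)" unfolding eigen_def
  proof (intro conjI ballI)
    show "Xop N ?g \<in> P" using gP N by auto
    fix k assume k: "k \<in> {1..N}"
    show "U k (Xop N ?g) = ev (ups b) T k \<odot> Xop N ?g"
    proof (cases "k = N")
      case True
      have "ev (ups b) T N = ev b T 1 + 1" using N by (simp add: ev_def lookup_ups rk_ups)
      then show ?thesis using UN True by (simp add: pm.scale_left_distrib)
    next
      case False
      then have "ev (ups b) T k = ev b T (Suc k)" using k by (simp add: ev_def lookup_ups rk_ups)
      then show ?thesis using U[of k] False k by simp
    qed
  qed
  have "cf (Xop N ?g) (ups b) = cf ?g (rename_exp (inv ?t) b)"
  proof
    fix S
    have "lk (Xv N * p) (sgl N 1 + e) = lk p e" for p :: mpoly and e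
      by (induction p rule: mpoly_single_induct)
        (auto simp: Xv_mult_single lookup_single distrib_left lookup_add)
    then show "cf (Xop N ?g) (ups b) S = cf ?g (rename_exp (inv ?t) b) S"
      by (simp add: cf_def Xop_def ups_def)
  qed
  also have "\<dots> = tau_perm tau (inv ?t) (cf (Z b T) b)" by (rule cf_act[OF _ ZP]) auto
  finally have "tv (Xop N ?g) (ups b) = tau_perm tau (rk b \<circ> ?t) (tau_perm tau (inv ?t) (cf (Z b T) b))"
    unfolding tv_def rk_ups[OF N] by simp
  also have "\<dots> = tau_perm tau (rk b \<circ> ?t \<circ> inv ?t) (cf (Z b T) b)"
    using ZP by (intro tau_perm_comp permutes_compose) auto
  also have "rk b \<circ> ?t \<circ> inv ?t = rk b" using permutes_inv_o(1)[OF t] by (simp add: comp_assoc)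
  also have "tau_perm tau (rk b) (cf (Z b T) b) = basisv T" using tv_Z[OF b T] unfolding tv_def .
  finally have "tv (Xop N ?g) (ups b) T = 1" by (simp add: basisv_def)
  then show ?thesis using eigen_unique[OF eig EXP_ups[OF b N] T] by simp
qed

lemma Dunkl_Z_eigen:
  assumes a: "a \<in> EXP" and T: "T \<in> R" and m: "1 \<le> m" "m \<le> N" and pos: "0 < lk a m"
    and zero: "\<And>k. m < k \<Longrightarrow> k \<le> N \<Longrightarrow> lk a k = 0"
  shows "eigen (ev (hat a m) T) (A (theta m) (D m (Z a T)))"
  unfolding eigen_def
proof (intro conjI ballI)
  let ?t = "theta m" and ?h = "D m (Z a T)"
  have t: "?t permutes {1..N}" using m by auto
  have ZP: "Z a T \<in> P" using a T by auto
  have hP: "?h \<in> P" using ZP m by auto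
  then show "A ?t ?h \<in> P" using t by auto
  have Dk: "D k (Z a T) = 0" if "m < k" "k \<le> N" for k
    using that zero m by (intro Dunkl_Z_zero a T) auto
  have evh: "ev (hat a m) T (?t k) = ev a T k - (if k = m then 1 else 0)" for k
    using rk_hat[OF m pos zero] pos m by (simp add: ev_def lookup_hat of_nat_diff)
  fix i assume i: "i \<in> {1..N}"
  define k where "k = inv ?t i"
  have k: "i = ?t k" "k \<in> {1..N}" unfolding k_def
    using permutes_inverses(1)[OF t] permutes_in_image[OF permutes_inv[OF t]] i by auto
  consider "k < m" | "k = m" | "m < k" by linarith
  then show "U i (A ?t ?h) = ev (hat a m) T i \<odot> A ?t ?h"
  proof cases
    case 1
    have "U i (A ?t ?h) = A ?t (U k ?h - kappa \<odot> sw k m ?h)"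
      using U_theta_Suc[of k m ?h] 1 k m by simp
    also have "U k ?h - kappa \<odot> sw k m ?h = D m (U k (Z a T))"
      using 1 k m by (intro U_Dunkl_less ZP) auto
    finally show ?thesis using U_Z[OF a T k(2)] 1 evh[of k] k(1) by simp
  next
    case 2
    \<comment> \<open>Moving the reflection out turns \<open>D m\<close> into \<open>D j\<close>
      with \<open>m < j\<close>, which kills the polynomial.\<close>
    have j: "D m (sw m j (Z a T)) = 0" if "j \<in> {Suc m..N}" for j
      using act_Dunkl[of "tp m j" j "Z a T"] that m Dk[of j] by auto
    have "U i (A ?t ?h) = A ?t (D m (Xop m ?h))" using U_theta_1[OF m, of ?h] 2 k m by simp
    also have "Xop m ?h = U m (Z a T) - Z a T - kappa \<odot> JMP m (Z a T)"
      using Uop_alt[of m "Z a T"] m by simp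
    also have "D m \<dots> = ev a T m \<odot> ?h - ?h"
      using U_Z[OF a T, of m] m j by (simp add: JMP_def)
    finally show ?thesis using 2 evh[of k] k(1) by (simp add: pm.scale_left_diff_distrib)
  next
    case 3
    have "U i (A ?t ?h) = A ?t (U k ?h)"
      using 3 k m t by (subst act_Uop) (auto intro: permutes_subset[OF theta_permutes])
    also have "U k ?h = D m (U k (Z a T)) + kappa \<odot> sw k m (D k (Z a T))"
      using 3 k m by (intro U_Dunkl_greater ZP) auto
    finally show ?thesis using U_Z[OF a T k(2)] 3 evh[of k] k Dk[of k] by simp
  qed
qed

lemma Dunkl_Z:
  assumes "a \<in> EXP" "T \<in> R" "1 \<le> m" "m \<le> N" "0 < lk a m" "\<And>k. m < k \<Longrightarrow> k \<le> N \<Longrightarrow> lk a k = 0"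
  shows "\<exists>c. D m (Z a T) = c \<odot> A (inv (theta m)) (Z (hat a m) T)"
proof -
  have ZP: "Z a T \<in> P" using assms by auto
  obtain c where "A (theta m) (D m (Z a T)) = c \<odot> Z (hat a m) T"
    using eigen_unique[OF Dunkl_Z_eigen[OF assms] EXP_hat[OF assms(1,4)] assms(2)] by blast
  then have "A (inv (theta m)) (A (theta m) (D m (Z a T))) = c \<odot> A (inv (theta m)) (Z (hat a m) T)" by simp
  then show ?thesis using act_inv(2)[of "D m (Z a T)" "theta m"] ZP assms by auto
qed

text \<open>With \<open>F\<^sub>k = x\<^sub>k \<theta>\<^sub>k\<^sup>-\<^sup>1 \<zeta>\<close> one has \<open>F\<^sub>k = s\<^sub>k F\<^sub>k\<^sub>+\<^sub>1\<close>, and \<open>F\<^sub>N\<close> is the affine step. Each \<open>s\<^sub>k\<close> moves the entry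
  \<open>\<alpha>\<^sub>m\<close> one place to the left, with leading coefficient 1.\<close>

lemma lowering_chain:
  assumes a: "a \<in> EXP" and T: "T \<in> R" and m: "1 \<le> m" "m \<le> N" and pos: "0 < lk a m"
    and zero: "\<And>k. m < k \<Longrightarrow> k \<le> N \<Longrightarrow> lk a k = 0"
  shows "Xop m (A (inv (theta m)) (Z (hat a m) T)) - Z a T
    \<in> pm.span (\<Union>j\<in>{Suc m..N}. Z (rename_exp (tp m j) a) ` R)"
proof -
  let ?d = "\<lambda>k. rename_exp (tp m k) a"
  let ?h = "Z (hat a m) T"
  define F where "F k = Xop k (A (inv (theta k)) ?h)" for k
  have hE: "hat a m \<in> EXP" by (rule EXP_hat[OF a m(2)])
  have hP: "?h \<in> P" using hE T by auto
  have dE: "?d k \<in> EXP" if "m \<le> k" "k \<le> N" for k using that m by (intro EXP_rename a) auto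
  have step: "F k = sw k (Suc k) (F (Suc k))" if k: "1 \<le> k" "Suc k \<le> N" for k
  proof -
    have "inv (theta (Suc k)) = tp k (Suc k) \<circ> inv (theta k)"
      unfolding theta_Suc[OF k(1)] using k
      by (subst o_inv_distrib) (auto intro: permutes_bij[OF theta_permutes])
    then have "tp k (Suc k) \<circ> inv (theta (Suc k)) = inv (theta k)" by (simp add: comp_assoc[symmetric])
    then show ?thesis unfolding F_def using k by (simp add: act_Xop act_comp)
  qed
  \<comment> \<open>Both steps together carry \<open>lk a m\<close> to the last place. The entries
    after \<open>m\<close> are 0, so the result is \<open>a\<close> with the places \<open>m\<close>
    and \<open>N\<close> exchanged.\<close>
  have top: "ups (hat a m) = ?d N"
  proof (rule EXP_eqI)
    show "ups (hat a m) \<in> EXP" using hE m by (intro EXP_ups) auto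
    show "?d N \<in> EXP" using m by (intro dE) auto
    fix k assume k: "k \<in> {1..N}"
    have "theta N k = theta m (if k = N then m else if k < m then k else Suc k)"
      using k m by (auto simp: theta_apply)
    then have "lk (ups (hat a m)) k = lk a (if k = N then m else if k < m then k else Suc k)
        - (if (if k = N then m else if k < m then k else Suc k) = m then 1 else 0) + (if k = N then 1 else 0)"
      unfolding lookup_ups using lookup_hat[OF m(2)] by simp
    also have "\<dots> = lk a (tp m N k)" using k m pos zero[of k] zero[of "Suc k"] zero[of N] by (auto simp: transpose_def)
    finally show "lk (ups (hat a m)) k = lk (?d N) k" by simp
  qed
  have "F k - Z (?d k) T \<in> pm.span (\<Union>j\<in>{Suc k..N}. Z (?d j) ` R)" if "m \<le> k" "k \<le> N" for k
    using that
  proof (induction "N - k" arbitrary: k)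
    case 0
    then have "k = N" by simp
    then show ?case using Xop_Z[OF hE T] m unfolding F_def top by (simp add: pm.span_zero)
  next
    case (Suc n)
    then have k: "1 \<le> k" "Suc k \<le> N" "m \<le> k" using m by auto
    let ?S = "\<Union>j\<in>{Suc k..N}. Z (?d j) ` R"
    have IH: "F (Suc k) - Z (?d (Suc k)) T \<in> pm.span (\<Union>j\<in>{Suc (Suc k)..N}. Z (?d j) ` R)"
      using Suc.hyps(2) k by (intro Suc.hyps(1)) auto
    have "sw k (Suc k) (F (Suc k) - Z (?d (Suc k)) T) \<in> pm.span ?S"
    proof (rule span_image[OF linop_act _ IH])
      fix x assume "x \<in> (\<Union>j\<in>{Suc (Suc k)..N}. Z (?d j) ` R)"
      then obtain j S where j: "j \<in> {Suc (Suc k)..N}" "x = Z (?d j) S" "S \<in> R" by auto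
      \<comment> \<open>The nonzero entry has moved to \<open>j\<close>, beyond
        \<open>Suc k\<close>, so the two places touched by the reflection are equal and
        \<open>sw_Z_equal\<close> applies.\<close>
      have "lk (?d j) k = 0" "lk (?d j) (Suc k) = 0"
        using j k zero[of k] zero[of "Suc k"] zero[of j] by (auto simp: transpose_def)
      then have "sw k (Suc k) x \<in> pm.span (Z (?d j) ` R)"
        unfolding j(2) using j k by (intro sw_Z_equal dE) auto
      moreover have "j \<in> {Suc k..N}" using j by auto
      then have "pm.span (Z (?d j) ` R) \<subseteq> pm.span ?S" by (intro pm.span_mono) blast
      ultimately show "sw k (Suc k) x \<in> pm.span ?S" by auto
    qed
    moreover have "rename_exp (tp k (Suc k)) (?d (Suc k)) = ?d k"
      using k zero[of k] zero[of "Suc k"] by (intro poly_mapping_eqI) (auto simp: transpose_def)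
    moreover have "lk (?d (Suc k)) k < lk (?d (Suc k)) (Suc k)"
      using k pos zero[of k] zero[of "Suc k"] by (auto simp: transpose_def)
    then obtain c where "sw k (Suc k) (Z (?d (Suc k)) T) = Z (rename_exp (tp k (Suc k)) (?d (Suc k))) T + c \<odot> Z (?d (Suc k)) T"
      using sw_Z_raise[OF dE[of "Suc k"] T k(1,2)] k by auto
    moreover have "c \<odot> Z (?d (Suc k)) T \<in> pm.span ?S" using T k by (intro pm.span_scale pm.span_base) auto
    ultimately have "sw k (Suc k) (F (Suc k) - Z (?d (Suc k)) T) + (sw k (Suc k) (Z (?d (Suc k)) T) - Z (?d k) T) \<in> pm.span ?S"
      by (intro pm.span_add) auto
    moreover have "sw k (Suc k) (F (Suc k) - Z (?d (Suc k)) T) + (sw k (Suc k) (Z (?d (Suc k)) T) - Z (?d k) T) = F k - Z (?d k) T"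
      using step[OF k(1,2)] by simp
    ultimately show ?case by metis
  qed
  from this[of m] m have "F m - Z (?d m) T \<in> pm.span (\<Union>j\<in>{Suc m..N}. Z (?d j) ` R)" by simp
  moreover have "?d m = a" by (rule poly_mapping_eqI) (subst lookup_rename_tp, simp)
  ultimately show ?thesis unfolding F_def by simp
qed

end

section \<open>The contravariant form\<close>

context partition_shape
begin

lemma formV_linear:
  "formV (\<lambda>T. u T + v T) w = formV u w + formV v w" "formV (\<lambda>T. c * u T) w = c * formV u w"
  "formV w (\<lambda>T. u T + v T) = formV w u + formV w v" "formV w (\<lambda>T. c * u T) = c * formV w u"
  "formV (\<lambda>T. 0) w = 0" "formV w (\<lambda>T. 0) = 0"
  unfolding formV_def by (simp_all add: algebra_simps sum.distrib sum_distrib_left)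

definition Dmon :: "(nat \<Rightarrow>\<^sub>0 nat) \<Rightarrow> ptau \<Rightarrow> ptau" where
  "Dmon a = foldr (\<lambda>j. D j ^^ lk a j) [1..<Suc N]"

lemma linop_funpow: "linop h \<Longrightarrow> linop (h ^^ n)"
proof (induction n)
  case 0
  show ?case by (rule linopI) auto
next
  case (Suc n)
  then show ?case using linop_simps[OF Suc.prems] linop_simps[OF Suc.IH[OF Suc.prems]]
    by (intro linopI) auto
qed

lemma linop_foldr: "linop (foldr (\<lambda>j. D j ^^ c j) xs)"
proof (induction xs)
  case Nil
  show ?case by (rule linopI) auto
next
  case (Cons j xs)
  then show ?case using linop_simps[OF linop_funpow[OF linop_Dunkl]] linop_simps[OF Cons]
    by (intro linopI) auto
qed

lemma linop_Dmon: "linop (Dmon a)"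
  unfolding Dmon_def by (rule linop_foldr)

lemmas Dmon_linear [simp] = linop_simps[OF linop_Dmon]

lemma P_funpow: "f \<in> P \<Longrightarrow> j \<in> {1..N} \<Longrightarrow> (D j ^^ n) f \<in> P"
  by (induction n) auto

lemma P_foldr: "f \<in> P \<Longrightarrow> set xs \<subseteq> {1..N} \<Longrightarrow> foldr (\<lambda>j. D j ^^ c j) xs f \<in> P"
proof (induction xs)
  case (Cons j xs)
  then show ?case using P_funpow[of "foldr (\<lambda>j. D j ^^ c j) xs f" j] by simp
qed simp

lemma set_upt_N: "set [1..<Suc N] = {1..N}" by auto

lemma P_Dmon [simp, intro]: "f \<in> P \<Longrightarrow> Dmon a f \<in> P"
  unfolding Dmon_def by (rule P_foldr) (simp_all only: set_upt_N order_refl)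

lemma funpow_Dunkl_commute:
  "f \<in> P \<Longrightarrow> i \<in> {1..N} \<Longrightarrow> j \<in> {1..N} \<Longrightarrow> (D j ^^ n) (D i f) = D i ((D j ^^ n) f)"
  by (induction n) (use P_funpow Dunkl_commute in auto)

lemma foldr_Dunkl_commute:
  assumes "f \<in> P" "i \<in> {1..N}" "set xs \<subseteq> {1..N}"
  shows "foldr (\<lambda>j. D j ^^ c j) xs (D i f) = D i (foldr (\<lambda>j. D j ^^ c j) xs f)"
  using assms(3)
proof (induction xs)
  case (Cons j xs)
  then show ?case
    using funpow_Dunkl_commute[of "foldr (\<lambda>j. D j ^^ c j) xs f" i j] P_foldr[OF assms(1), of xs c] assms by simp
qed simp

lemma foldr_Dunkl_Suc:
  assumes "f \<in> P" "distinct xs" "set xs \<subseteq> {1..N}" "i \<in> set xs"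
  shows "foldr (\<lambda>j. D j ^^ lk (sgl i 1 + a) j) xs f = D i (foldr (\<lambda>j. D j ^^ lk a j) xs f)"
  using assms(2-4)
proof (induction xs)
  case (Cons j xs)
  let ?g = "foldr (\<lambda>j. D j ^^ lk a j) xs f"
  have g: "?g \<in> P" using Cons.prems assms(1) by (intro P_foldr) auto
  show ?case
  proof (cases "i = j")
    case True
    have "foldr (\<lambda>j. D j ^^ lk (sgl i 1 + a) j) xs f = ?g"
      using Cons.prems True by (intro foldr_cong) (auto simp: lookup_add lookup_single when_def)
    moreover have "lk (sgl i 1 + a) j = Suc (lk a j)" using True by (simp add: lookup_add)
    ultimately show ?thesis using True by simp
  next
    case False
    then have "foldr (\<lambda>j. D j ^^ lk (sgl i 1 + a) j) xs f = D i ?g" using Cons by auto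
    moreover have "lk (sgl i 1 + a) j = lk a j" using False by (simp add: lookup_add lookup_single)
    ultimately show ?thesis using funpow_Dunkl_commute[OF g, of i j] Cons.prems by auto
  qed
qed simp

lemma Dmon_Suc: "f \<in> P \<Longrightarrow> i \<in> {1..N} \<Longrightarrow> Dmon (sgl i 1 + a) f = Dmon a (D i f)"
  unfolding Dmon_def
  by (subst foldr_Dunkl_Suc) (simp_all only: set_upt_N order_refl distinct_upt foldr_Dunkl_commute)

lemma Dmon_0 [simp]: "Dmon 0 f = f"
proof -
  have "foldr (\<lambda>j. D j ^^ lk 0 j) xs f = f" for xs by (induction xs) auto
  then show ?thesis unfolding Dmon_def .
qed

text \<open>\<open>\<langle>f, x\<^sup>a \<otimes> v\<rangle>\<close> is the pairing of \<open>v\<close> with the constant term of \<open>D\<^sup>a f\<close>. Only its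
  symmetry is not immediate.\<close>

definition Bk :: "ptau \<Rightarrow> ptau \<Rightarrow> K" where
  "Bk f g = (\<Sum>a\<in>supp g. formV (cf (Dmon a f) 0) (cf g a))"

lemma Bk_superset: "finite S \<Longrightarrow> supp g \<subseteq> S \<Longrightarrow> Bk f g = (\<Sum>a\<in>S. formV (cf (Dmon a f) 0) (cf g a))"
  unfolding Bk_def by (intro sum.mono_neutral_left) (auto simp: supp_iff formV_linear)

lemma Bk_add_left: "Bk (f + h) g = Bk f g + Bk h g"
  and Bk_scale_left: "Bk (c \<odot> f) g = c * Bk f g"
  and Bk_0_left: "Bk 0 g = 0"
  unfolding Bk_def by (simp_all add: formV_linear sum.distrib sum_distrib_left)

lemma Bk_add_right: "g \<in> P \<Longrightarrow> h \<in> P \<Longrightarrow> Bk f (g + h) = Bk f g + Bk f h"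
  using Bk_superset[of "supp g \<union> supp h" g f] Bk_superset[of "supp g \<union> supp h" h f]
    Bk_superset[of "supp g \<union> supp h" "g + h" f] supp_add[of g h] finite_supp
  by (simp add: formV_linear sum.distrib)

lemma Bk_scale_right: "g \<in> P \<Longrightarrow> Bk f (c \<odot> g) = c * Bk f g"
  using Bk_superset[of "supp g" "c \<odot> g" f] supp_scale[of c g] finite_supp[of g]
  by (simp add: formV_linear sum_distrib_left Bk_def)

lemma Bk_0_right [simp]: "Bk f 0 = 0"
  by (simp add: Bk_def supp_iff[of _ 0] cong: sum.cong)
    (rule sum.neutral, simp add: formV_linear)

lemma Bk_diff_right: "g \<in> P \<Longrightarrow> h \<in> P \<Longrightarrow> Bk f (g - h) = Bk f g - Bk f h"
  using Bk_add_right[of g "(-1) \<odot> h" f] Bk_scale_right[of h f "-1"] by simp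

lemma Bk_sum_right: "(\<And>x. x \<in> B \<Longrightarrow> h x \<in> P) \<Longrightarrow> Bk f (\<Sum>x\<in>B. h x) = (\<Sum>x\<in>B. Bk f (h x))"
  by (induction B rule: infinite_finite_induct) (auto simp: Bk_add_right)

lemma Bk_sum_left: "Bk (\<Sum>x\<in>B. h x) g = (\<Sum>x\<in>B. Bk (h x) g)"
  by (induction B rule: infinite_finite_induct) (auto simp: Bk_add_left Bk_0_left)

lemma Bk_xpow: "Bk f (ten (xpow a) v) = formV (cf (Dmon a f) 0) v"
  using Bk_superset[of "{a}" "ten (xpow a) v" f] supp_ten[of a v] by (simp add: cf_ten)

lemma Bk_cst: "Bk f (cst v) = formV (cf f 0) v"
  using Bk_xpow[of f 0 v] by simp

lemma Bk_Xop_right: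
  assumes f: "f \<in> P" and g: "g \<in> P" and i: "i \<in> {1..N}" shows "Bk f (Xop i g) = Bk (D i f) g"
proof -
  have m: "ten (xpow a) (cf g a) \<in> P" if "a \<in> supp g" for a using supp_EXP[OF g] g that by auto
  have "Bk f (Xop i g) = Bk f (\<Sum>a\<in>supp g. Xop i (ten (xpow a) (cf g a)))"
    by (subst monomial_expansion[OF g]) simp
  also have "\<dots> = (\<Sum>a\<in>supp g. Bk f (Xop i (ten (xpow a) (cf g a))))"
    using m i by (intro Bk_sum_right) auto
  also have "\<dots> = (\<Sum>a\<in>supp g. formV (cf (Dmon a (D i f)) 0) (cf g a))"
    by (simp add: Xop_ten Xv_mult_single Bk_xpow Dmon_Suc[OF f i])
  finally show ?thesis unfolding Bk_def .
qed

lemma lookup_Xv_add: "lk (Xv i * p) (sgl i 1 + e) = lk p e"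
  by (induction p rule: mpoly_single_induct) (auto simp: Xv_mult_single lookup_single distrib_left lookup_add)

lemma lookup_Xv_0: "lk (Xv i * p) 0 = 0"
proof (induction p rule: mpoly_single_induct)
  case (single a c)
  have "lk (sgl i 1 + a) i \<noteq> lk 0 i" by (simp add: lookup_add)
  then have "sgl i 1 + a \<noteq> 0" by metis
  then show ?case by (simp add: Xv_mult_single lookup_single when_def)
qed (simp add: distrib_left lookup_add)

lemma cf_Xop_0: "cf (Xop i f) 0 = (\<lambda>T. 0)"
  by (simp add: cf_def Xop_def lookup_Xv_0)

text \<open>A variable on the right becomes a Dunkl operator on the left, compatibly with the
  action. What remains is a constant, where the invariance of \<open>formV\<close> applies.\<close>

lemma Bk_invariant:
  assumes w: "w permutes {1..N}" and f: "f \<in> P" and g: "g \<in> P"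
  shows "Bk (A w f) (A w g) = Bk f g"
  using g f
proof (induction g arbitrary: f rule: P_induct)
  case (cst v)
  have "cf (A w f) 0 = tau_perm tau w (cf f 0)" using cf_act[OF w cst(2), of 0] by simp
  then show ?case using cst w by (simp add: act_cst Bk_cst formV_invariant cf_V)
next
  case (X i g)
  have wi: "w i \<in> {1..N}" using permutes_in_image[OF w, of i] X.hyps(1) by (rule iffD2)
  have "Bk (A w f) (A w (Xop i g)) = Bk (D (w i) (A w f)) (A w g)"
    unfolding act_Xop using X w wi by (intro Bk_Xop_right P_act)
  also have "\<dots> = Bk (A w (D i f)) (A w g)" using X w by (simp add: act_Dunkl)
  also have "\<dots> = Bk (D i f) g" using X by (intro X.IH) auto
  also have "\<dots> = Bk f (Xop i g)" using X by (intro Bk_Xop_right[symmetric])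
  finally show ?case .
next
  case (add g h)
  then show ?case using w by (simp add: Bk_add_right)
qed

lemma Bk_sw:
  assumes "f \<in> P" "g \<in> P" "i \<in> {1..N}" "j \<in> {1..N}" shows "Bk (sw i j f) g = Bk f (sw i j g)"
  using Bk_invariant[of "tp i j" f "sw i j g"] assms by simp

text \<open>Adjointness in the other slot. The commutators of Dunkl operators with variables are
  combinations of reflections and the identity, hence self-adjoint, so they agree on both
  sides.\<close>

lemma Bk_Xop_left:
  assumes f: "f \<in> P" and g: "g \<in> P" and i: "i \<in> {1..N}" shows "Bk (Xop i f) g = Bk f (D i g)"
  using g f
proof (induction g arbitrary: f rule: P_induct)
  case (cst v)
  then show ?case using i by (simp add: Dunkl_cst Bk_cst cf_Xop_0 formV_linear)
next
  case (X j g)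
  note fP = X.prems and gP = X.hyps(2) and j = X.hyps(1)
  \<comment> \<open>The induction hypothesis is applied to \<open>D j f\<close>, which is why
    \<open>f\<close> is kept arbitrary.\<close>
  have main: "Bk (Xop i (D j f)) g = Bk f (Xop j (D i g))"
    using X.IH[of "D j f"] Bk_Xop_right[of f "D i g" j] fP gP i j by simp
  have "Bk (Xop i f) (Xop j g) = Bk (D j (Xop i f)) g" using fP gP i j by (intro Bk_Xop_right) auto
  also have "\<dots> = Bk f (D i (Xop j g))"
  proof (cases "i = j")
    case True
    have s: "(\<Sum>k\<in>{1..N} - {j}. Bk (sw j k f) g) = (\<Sum>k\<in>{1..N} - {j}. Bk f (sw j k g))"
      using fP gP j by (intro sum.cong Bk_sw) auto
    have sP: "(\<Sum>k\<in>{1..N} - {j}. sw j k g) \<in> P" using gP j by (intro P_sum P_act) auto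
    have "Bk f (\<Sum>k\<in>{1..N} - {j}. sw j k g) = (\<Sum>k\<in>{1..N} - {j}. Bk f (sw j k g))"
      using gP j by (intro Bk_sum_right P_act) auto
    then show ?thesis using main s fP gP j sP unfolding True Dunkl_Xop_same[OF j]
      by (simp add: Bk_add_left Bk_add_right Bk_scale_left Bk_scale_right Bk_sum_left)
  next
    case False
    have "Bk (Xop i (D j f) - kappa \<odot> sw i j f) g = Bk (Xop i (D j f)) g + Bk ((- kappa) \<odot> sw i j f) g"
      unfolding Bk_add_left[symmetric] by simp
    then have 1: "Bk (Xop i (D j f) - kappa \<odot> sw i j f) g = Bk (Xop i (D j f)) g - kappa * Bk (sw i j f) g"
      unfolding Bk_scale_left by simp
    have D1: "D j (Xop i f) = Xop i (D j f) - kappa \<odot> sw i j f"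
      using Dunkl_Xop_diff[OF j i] False by (simp add: transpose_commute[of j i])
    have D2: "D i (Xop j g) = Xop j (D i g) - kappa \<odot> sw i j g"
      using Dunkl_Xop_diff[OF i j] False by simp
    show ?thesis unfolding D1 D2 1 using main Bk_sw[OF fP gP i j] fP gP i j
      by (simp add: Bk_diff_right Bk_scale_right)
  qed
  finally show ?case .
next
  case (add g h)
  then show ?case using i by (simp add: Bk_add_right)
qed

text \<open>With both adjunctions a variable can be traded for a Dunkl operator on either side,
  until one argument is constant and the symmetry of \<open>formV\<close> decides.\<close>

lemma Bk_sym:
  assumes f: "f \<in> P" and g: "g \<in> P" shows "Bk f g = Bk g f"
  using f g
proof (induction f arbitrary: g rule: P_induct)
  case (cst v)
  from cst(2) have "Bk (cst v) g = formV (cf g 0) v"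
  proof (induction g rule: P_induct)
    case (cst u)
    show ?case unfolding Bk_cst by (simp add: cf_ten formV_sym[of v u])
  next
    case (X i g)
    have "cst v \<in> P" using \<open>v \<in> V\<close> by (intro ten_P) (use PV_const[of 1] in auto)
    then have "Bk (cst v) (Xop i g) = Bk (D i (cst v)) g" using X by (intro Bk_Xop_right) auto
    then show ?case using X \<open>v \<in> V\<close> by (simp add: Dunkl_cst Bk_0_left cf_Xop_0 formV_linear)
  next
    case (add g h)
    then show ?case by (simp add: Bk_add_right formV_linear)
  qed
  then show ?case unfolding Bk_cst .
next
  case (X i f)
  have "Bk (Xop i f) g = Bk f (D i g)" using X by (intro Bk_Xop_left) auto
  also have "\<dots> = Bk (D i g) f" using X by auto
  also have "\<dots> = Bk g (Xop i f)" using X by (intro Bk_Xop_right[symmetric]) auto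
  finally show ?case .
next
  case (add f h)
  then show ?case by (simp add: Bk_add_left Bk_add_right)
qed

section \<open>Uniqueness of the contravariant form\<close>

lemma basisP_eq: "basisP T = cst (basisv T)"
  by (rule ext) (simp add: basisP_def ten_def basisv_def)

lemma basisP_P [simp, intro]: "T \<in> R \<Longrightarrow> basisP T \<in> P"
  unfolding basisP_eq by (intro ten_P) (use PV_const[of 1] in auto)

lemma P_basis_induct [consumes 1, case_names zero basis scale X add]:
  assumes f: "f \<in> P" and Q0: "Q 0" and Qb: "\<And>T. T \<in> R \<Longrightarrow> Q (basisP T)"
    and Qs: "\<And>c f. f \<in> P \<Longrightarrow> Q f \<Longrightarrow> Q (c \<odot> f)"
    and QX: "\<And>i f. i \<in> {1..N} \<Longrightarrow> f \<in> P \<Longrightarrow> Q f \<Longrightarrow> Q (Xop i f)"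
    and Qa: "\<And>f g. f \<in> P \<Longrightarrow> g \<in> P \<Longrightarrow> Q f \<Longrightarrow> Q g \<Longrightarrow> Q (f + g)"
  shows "Q f"
  using f
proof (induction f rule: P_induct)
  case (cst v)
  have "cst v = (\<Sum>T\<in>R. v T \<odot> basisP T)"
  proof
    fix S
    have "(\<Sum>T\<in>R. const (v T) * const (basisv T S)) = const (\<Sum>T\<in>R. v T * basisv T S)"
      by (simp add: const_sum const_mult)
    also have "\<dots> = const (v S)" using fun_cong[OF basisv_expand[OF cst], of S] by simp
    finally show "cst v S = (\<Sum>T\<in>R. v T \<odot> basisP T) S"
      by (simp add: sum_fun_apply psmul_apply basisP_eq ten_def)
  qed
  moreover have "Q (\<Sum>T\<in>B. v T \<odot> basisP T) \<and> (\<Sum>T\<in>B. v T \<odot> basisP T) \<in> P" if "B \<subseteq> R" for B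
    using finite_subset[OF that finite_R] that
  proof (induction B rule: finite_induct)
    case (insert T B)
    then show ?case by (auto intro!: Qa Qs Qb)
  qed (simp add: Q0)
  ultimately show ?case by auto
qed (auto intro: QX Qa)

definition isform :: "(ptau \<Rightarrow> ptau \<Rightarrow> K) \<Rightarrow> bool" where
  "isform B \<longleftrightarrow>
       (\<forall>f g. f \<notin> Ptau tau \<or> g \<notin> Ptau tau \<longrightarrow> B f g = 0)
     \<and> (\<forall>f\<in>Ptau tau. \<forall>g\<in>Ptau tau. B f g = B g f)
     \<and> (\<forall>f1\<in>Ptau tau. \<forall>f2\<in>Ptau tau. \<forall>g\<in>Ptau tau. B (padd f1 f2) g = B f1 g + B f2 g)
     \<and> (\<forall>c. \<forall>f\<in>Ptau tau. \<forall>g\<in>Ptau tau. B (psmul c f) g = c * B f g)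
     \<and> (\<forall>w. w permutes {1..sum_list tau} \<longrightarrow>
           (\<forall>f\<in>Ptau tau. \<forall>g\<in>Ptau tau. B (act tau w f) (act tau w g) = B f g))
     \<and> (\<forall>T\<in>RSYT tau. \<forall>T'\<in>RSYT tau. B (basisP T) (basisP T') = form0 tau T T')
     \<and> (\<forall>i\<in>{1..sum_list tau}. \<forall>f\<in>Ptau tau. \<forall>g\<in>Ptau tau.
           B (Dunkl tau i f) g = B f (\<lambda>T. Xv i * g T))"

lemma isform_Bk: "isform (\<lambda>f g. if f \<in> P \<and> g \<in> P then Bk f g else 0)"
  unfolding isform_def padd_eq Xop_def[symmetric]
proof (intro conjI ballI allI impI)
  fix T S assume T: "T \<in> R" "S \<in> R"
  have "Bk (basisP T) (basisP S) = form0 tau T S"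
    unfolding basisP_eq Bk_cst using T by (simp add: cf_ten formV_basisv)
  then show "(if basisP T \<in> P \<and> basisP S \<in> P then Bk (basisP T) (basisP S) else 0) = form0 tau T S"
    using T by simp
next
  fix i f g assume a: "i \<in> {1..N}" "f \<in> P" "g \<in> P"
  then show "(if D i f \<in> P \<and> g \<in> P then Bk (D i f) g else 0) = (if f \<in> P \<and> Xop i g \<in> P then Bk f (Xop i g) else 0)"
    using Bk_Xop_right[OF a(2,3,1)] by (simp only: P_Dunkl P_Xop simp_thms if_True)
next
  fix w f g assume "w permutes {1..N}" "f \<in> P" "g \<in> P"
  then show "(if A w f \<in> P \<and> A w g \<in> P then Bk (A w f) (A w g) else 0) = (if f \<in> P \<and> g \<in> P then Bk f g else 0)"
    using Bk_invariant by simp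
next
  fix f g assume "f \<in> P" "g \<in> P"
  then show "(if f \<in> P \<and> g \<in> P then Bk f g else 0) = (if g \<in> P \<and> f \<in> P then Bk g f else 0)"
    using Bk_sym by simp
qed (auto simp: Bk_add_left Bk_scale_left)

text \<open>Variables in the second argument move to the first as Dunkl operators. Against a
  constant, symmetry moves the remaining variables the other way, where \<open>D i\<close>
  annihilates the constant, so only the prescribed values on tableaux are left.\<close>

lemma isform_unique:
  assumes "isform B" "isform B'" shows "B = B'"
proof (intro ext)
  fix f g
  have fsym: "C f g = C g f" and fadd: "C (f + h) g = C f g + C h g" and fscale: "C (c \<odot> f) g = c * C f g"
    and fX: "i \<in> {1..N} \<Longrightarrow> C (D i f) g = C f (Xop i g)"
    if "isform C" "f \<in> P" "g \<in> P" "h \<in> P" for C f g h i c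
    using that unfolding isform_def padd_eq Xop_def by blast+
  have fzero: "C 0 g = 0" if "isform C" "g \<in> P" for C g
    using fscale[OF that(1) P_zero that(2) P_zero, of 0] by simp
  have base: "B f (basisP T) = B' f (basisP T)" if f: "f \<in> P" and T: "T \<in> R" for f T
    using f
  proof (induction f rule: P_basis_induct)
    case zero
    then show ?case using \<open>T \<in> R\<close> assms by (simp add: fzero)
  next
    case (basis S)
    then show ?case using assms T unfolding isform_def by simp
  next
    case (scale c f)
    then show ?case using \<open>T \<in> R\<close> assms fscale
      by (metis basisP_P)
  next
    case (X i f)
    have "C (Xop i f) (basisP T) = 0" if C: "isform C" for C
    proof -
      have "C (Xop i f) (basisP T) = C (basisP T) (Xop i f)"
        using C X T by (intro fsym[where h = 0]) auto
      also have "\<dots> = C (D i (basisP T)) f"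
        using C X T fX
        by (metis basisP_P)
      also have "D i (basisP T) = 0" using X T by (simp add: basisP_eq Dunkl_cst)
      finally show ?thesis using fzero C X by simp
    qed
    from this[OF assms(1)] this[OF assms(2)] show ?case by simp
  next
    case (add f h)
    then show ?case using \<open>T \<in> R\<close> assms fadd
      by (metis basisP_P)
  qed
  show "B f g = B' f g"
  proof (cases "f \<in> P \<and> g \<in> P")
    case True
    then have "g \<in> P" "f \<in> P" by auto
    then show ?thesis
    proof (induction g arbitrary: f rule: P_basis_induct)
      case zero
      then show ?case using fsym[OF assms(1) zero P_zero P_zero] fsym[OF assms(2) zero P_zero P_zero]
        fzero[OF assms(1) zero] fzero[OF assms(2) zero] by simp
    next
      case (basis T)
      then show ?case by (intro base)
    next
      case (scale c g)
      have "C f (c \<odot> g) = c * C f g" if C: "isform C" for C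
        using fsym[OF C scale.prems P_scale[OF scale.hyps] P_zero] fsym[OF C scale.prems scale.hyps P_zero]
          fscale[OF C scale.hyps scale.prems P_zero]
        by simp
      from this[OF assms(1)] this[OF assms(2)] show ?case using scale by simp
    next
      case (X i g)
      have "C f (Xop i g) = C (D i f) g" if C: "isform C" for C
        using fX[OF C X.prems X.hyps(2) P_zero X.hyps(1)]
        by simp
      from this[OF assms(1)] this[OF assms(2)] show ?case using X by simp
    next
      case (add g h)
      have "C f (g + h) = C f g + C f h" if C: "isform C" for C
        using fsym[OF C add.prems P_add[OF add.hyps] P_zero] fsym[OF C add.prems add.hyps(1) P_zero]
          fsym[OF C add.prems add.hyps(2) P_zero]
          fadd[OF C add.hyps(1) add.prems add.hyps(2)]
        by simp
      from this[OF assms(1)] this[OF assms(2)] show ?case using add by simp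
    qed
  next
    case False
    then show ?thesis using assms unfolding isform_def by metis
  qed
qed

lemma form_kappa_eq: "f \<in> P \<Longrightarrow> g \<in> P \<Longrightarrow> form_kappa tau f g = Bk f g"
proof -
  assume "f \<in> P" "g \<in> P"
  have "form_kappa tau = (THE B. isform B)" unfolding form_kappa_def isform_def ..
  also have "\<dots> = (\<lambda>f g. if f \<in> P \<and> g \<in> P then Bk f g else 0)"
    by (rule the_equality[where P = isform, OF isform_Bk]) (rule isform_unique[OF _ isform_Bk])
  finally show ?thesis using \<open>f \<in> P\<close> \<open>g \<in> P\<close> by simp
qed

end

section \<open>Nonvanishing of the norms and the lowering formula\<close>

context partition_shape
begin

lemma Uop_selfadjoint:
  assumes f: "f \<in> P" and g: "g \<in> P" and i: "i \<in> {1..N}" shows "Bk (U i f) g = Bk f (U i g)"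
proof -
  have "Bk (lowJM i f) g = (\<Sum>j\<in>{1..<i}. Bk f (sw i j g))"
    unfolding lowJM_def Bk_sum_left using f g i by (intro sum.cong Bk_sw) auto
  also have "\<dots> = Bk f (lowJM i g)"
    unfolding lowJM_def using g i by (intro Bk_sum_right[symmetric] P_act) auto
  finally have low: "Bk (lowJM i f) g = Bk f (lowJM i g)" .
  have "Bk (D i (Xop i f)) g = Bk (Xop i f) (Xop i g)"
    using f g i by (intro Bk_Xop_right[symmetric]) auto
  also have "\<dots> = Bk f (D i (Xop i g))" using f g i by (intro Bk_Xop_left) auto
  finally have dx: "Bk (D i (Xop i f)) g = Bk f (D i (Xop i g))" .
  have "U i f = D i (Xop i f) + (- kappa) \<odot> lowJM i f" unfolding Uop_eq by simp
  then have "Bk (U i f) g = Bk (D i (Xop i f)) g - kappa * Bk (lowJM i f) g"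
    by (simp add: Bk_add_left Bk_scale_left del: pm.scale_minus_left)
  moreover have "Bk f (U i g) = Bk f (D i (Xop i g)) - kappa * Bk f (lowJM i g)"
    unfolding Uop_eq using g i by (simp add: Bk_diff_right Bk_scale_right)
  ultimately show ?thesis using low dx by simp
qed

text \<open>Self-adjoint operators with distinct joint spectra: the part free of \<kappa> determines
  the exponent, and with it the rank, whereupon the contents determine the tableau.\<close>

lemma Z_orthogonal:
  assumes a: "a \<in> EXP" "T \<in> R" and b: "b \<in> EXP" "S \<in> R" and ne: "(a, T) \<noteq> (b, S)"
  shows "Bk (Z a T) (Z b S) = 0"
proof -
  have "\<exists>i\<in>{1..N}. ev a T i \<noteq> ev b S i"
  proof (rule ccontr)
    assume "\<not> ?thesis"
    then have "ev a T i = ev b S i" if "i \<in> {1..N}" for i using that by blast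
    then have e: "lk a i = lk b i \<and> content (rk a i) T = content (rk b i) S" if "i \<in> {1..N}" for i
      using that spectral_inj[of "lk a i + 1" "content (rk a i) T" "lk b i + 1" "content (rk b i) S"]
      unfolding ev_def by simp
    then have ab: "a = b" using EXP_eqI[OF a(1) b(1)] by auto
    have "content j T = content j S" if j: "j \<in> {1..N}" for j
    proof -
      have "inv (rk a) j \<in> {1..N}" using permutes_in_image[OF inv_rk_permutes, of a j] j by (rule iffD2)
      from e[OF this] show ?thesis unfolding ab by (simp add: permutes_inverses(1)[OF rk_permutes])
    qed
    then have "T = S" using content_inj[OF a(2) b(2)] by blast
    with ab ne show False by simp
  qed
  then obtain i where i: "i \<in> {1..N}" "ev a T i \<noteq> ev b S i" by auto
  have "Bk (U i (Z a T)) (Z b S) = Bk (Z a T) (U i (Z b S))"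
    using a b i by (intro Uop_selfadjoint) auto
  then have "ev a T i * Bk (Z a T) (Z b S) = ev b S i * Bk (Z a T) (Z b S)"
    unfolding U_Z[OF a i(1)] U_Z[OF b i(1)] using a b by (simp add: Bk_scale_left Bk_scale_right)
  then show ?thesis using i by simp
qed

lemma Z_span_deg:
  assumes "f \<in> P" "\<And>b. b \<in> supp f \<Longrightarrow> deg b = n"
  shows "f \<in> pm.span ((\<lambda>(b, S). Z b S) ` ({b \<in> EXP. deg b = n} \<times> R))"
proof (rule Z_span)
  show "supp f \<subseteq> {b \<in> EXP. deg b = n}" using supp_EXP[OF assms(1)] assms(2) by blast
qed (use assms(1) finite_deg lt_deg in auto)

lemma orthogonal_span:
  assumes "f \<in> pm.span C" "\<And>x. x \<in> C \<Longrightarrow> x \<in> P \<and> Bk g x = 0" shows "f \<in> P \<and> Bk g f = 0"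
proof -
  have "pm.subspace {x. x \<in> P \<and> Bk g x = 0}"
    by (rule pm.subspaceI) (auto simp: Bk_add_right Bk_scale_right)
  then show ?thesis using pm.span_induct[OF assms(1), of "\<lambda>x. x \<in> P \<and> Bk g x = 0"] assms(2) by simp
qed

text \<open>The Okounkov-Vershik argument: if \<open>l k \<noteq> l (k+1)\<close>, then \<open>s\<^sub>k f\<close> is either proportional to \<open>f\<close>, and the
  two eigenvalues differ by 1, or it yields an eigenvector with the two eigenvalues interchanged.\<close>

lemma JMP_integral:
  assumes "f \<in> P" "f \<noteq> 0" "1 \<le> k" "k \<le> N" "\<And>i. i \<in> {k..N} \<Longrightarrow> JMP i f = l i \<odot> f"
  shows "\<forall>i\<in>{k..N}. \<exists>z::int. l i = of_int z"
  using assms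
proof (induction "N - k" arbitrary: k f l)
  case 0
  then have "k = N" by simp
  then have "l N \<odot> f = 0" using 0(6)[of N] by (simp add: JMP_def)
  then have "l N = 0" using \<open>f \<noteq> 0\<close> by simp
  then show ?case using \<open>k = N\<close> by (auto intro!: exI[of _ 0])
next
  case (Suc n)
  then have k: "1 \<le> k" "Suc k \<le> N" by auto
  have fP: "f \<in> P" by (rule Suc.prems(1))
  have tail: "\<forall>i\<in>{Suc k..N}. \<exists>z::int. l i = of_int z"
    using Suc.hyps(2) k Suc.prems by (intro Suc.hyps(1)[of "Suc k" f l]) auto
  let ?s = "sw k (Suc k)"
  have "\<exists>z::int. l k = of_int z"
  proof (cases "l k = l (Suc k)")
    case True
    then show ?thesis using tail k by auto
  next
    case False
    \<comment> \<open>The constant of the intertwiner for Jucys-Murphy elements, as in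
      \<open>sw_eigen\<close> with \<open>JMP\<close> in place of \<open>U\<close> and
      \<open>sw_JMP\<close> in place of \<open>sw_Uop\<close>.\<close>
    define c where "c = 1 / (l k - l (Suc k))"
    define f' where "f' = ?s f - c \<odot> f"
    have cl: "c * l k = 1 + c * l (Suc k)" using False unfolding c_def by (simp add: field_simps)
    have f'P: "f' \<in> P" unfolding f'_def using fP k by auto
    have "JMP (Suc k) (?s f) = l k \<odot> ?s f - f"
      using sw_JMP[OF fP k] Suc.prems(5)[of k] k by simp
    then have "JMP (Suc k) f' = l k \<odot> ?s f - f - (c * l (Suc k)) \<odot> f"
      unfolding f'_def using Suc.prems(5)[of "Suc k"] k by simp
    also have "\<dots> = l k \<odot> ?s f - (c * l k) \<odot> f" unfolding cl by (simp add: pm.scale_left_distrib)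
    also have "\<dots> = l k \<odot> f'" unfolding f'_def by (simp add: pm.scale_right_diff_distrib mult.commute)
    finally have J1: "JMP (Suc k) f' = l k \<odot> f'" .
    have J2: "JMP i f' = l i \<odot> f'" if i: "i \<in> {Suc k..N}" "i \<noteq> Suc k" for i
    proof -
      have "?s (JMP i f) = JMP i (?s f)"
        unfolding JMP_def act_linear using i k
        by (intro sum.cong refl) (subst act_sw, auto)
      then show ?thesis unfolding f'_def using Suc.prems(5)[of i] i k
        by (simp add: pm.scale_right_diff_distrib mult.commute)
    qed
    show ?thesis
    proof (cases "f' = 0")
      \<comment> \<open>The reflection is an involution, so its eigenvalue \<open>c\<close> is 1 or
        -1 and the two eigenvalues differ by one.\<close>
      case True
      then have s: "?s f = c \<odot> f" unfolding f'_def by simp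
      have "f = ?s (?s f)" using fP k by simp
      also have "\<dots> = (c * c) \<odot> f" unfolding s by (simp add: s)
      finally have "(c * c - 1) \<odot> f = 0" by (simp add: pm.scale_left_diff_distrib)
      then have "c * c = 1" using \<open>f \<noteq> 0\<close> by simp
      then have "c = 1 \<or> c = -1" by (simp add: square_eq_1_iff)
      then have "l k = l (Suc k) + 1 \<or> l k = l (Suc k) - 1"
        using cl by (auto simp: algebra_simps)
      moreover have "Suc k \<in> {Suc k..N}" using k by simp
      then obtain z :: int where "l (Suc k) = of_int z" using tail by blast
      ultimately have "l k = of_int (z + 1) \<or> l k = of_int (z - 1)" by auto
      then show ?thesis by blast
    next
      \<comment> \<open>In the eigenvector \<open>f'\<close> the eigenvalue \<open>l k\<close>
        stands at \<open>Suc k\<close>, within reach of the induction hypothesis.\<close>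
      case False
      have "\<forall>i\<in>{Suc k..N}. \<exists>z::int. (l(Suc k := l k)) i = of_int z"
        using Suc.hyps(2) k f'P False J1 J2 by (intro Suc.hyps(1)[of "Suc k" f']) auto
      moreover have "Suc k \<in> {Suc k..N}" using k by simp
      ultimately have "\<exists>z::int. (l(Suc k := l k)) (Suc k) = of_int z" by blast
      then show ?thesis by simp
    qed
  qed
  moreover have "{k..N} = insert k {Suc k..N}" using k by auto
  ultimately show ?case using tail by auto
qed

lemma deg_add_single: "i \<in> {1..N} \<Longrightarrow> deg (sgl i 1 + a) = deg a + 1"
  unfolding deg_def lookup_add by (simp add: sum.distrib lookup_single when_def)

lemma supp_sw_deg:
  assumes f: "f \<in> P" and ij: "i \<in> {1..N}" "j \<in> {1..N}" and d: "\<And>b. b \<in> supp f \<Longrightarrow> deg b = n"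
    and c: "c \<in> supp (sw i j f)"
  shows "deg c = n"
proof -
  let ?b = "rename_exp (tp i j) c"
  have "rename_exp (tp i j) ?b = c" by (intro poly_mapping_eqI) simp
  then have "cf (sw i j f) c = tau_perm tau (tp i j) (cf f ?b)"
    using cf_act[OF tp_permutes[OF ij] f, of ?b] by simp
  then have "?b \<in> supp f" using c tau_perm_0 unfolding supp_iff by metis
  then show ?thesis using d deg_swap[OF ij] by metis
qed

text \<open>Multiplied by \<open>x_i\<close>, the image is expressed through the eigenvalue equation
  by reflections of the polynomial itself, and these preserve the degree.\<close>

lemma supp_Dunkl_Z_deg:
  assumes a: "a \<in> EXP" "T \<in> R" and i: "i \<in> {1..N}" and c: "c \<in> supp (D i (Z a T))"
  shows "deg c + 1 = deg a"
proof -
  have ZP: "Z a T \<in> P" using a by auto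
  have Zd: "deg b = deg a" if "b \<in> supp (Z a T)" for b using supp_Z[OF a that] lt_deg by auto
  have "sgl i 1 + c \<in> supp (Xop i (D i (Z a T)))"
    using c unfolding supp_iff cf_def Xop_def by (simp add: lookup_Xv_add)
  also have "Xop i (D i (Z a T)) = (ev a T i - 1) \<odot> Z a T - kappa \<odot> JMP i (Z a T)"
    using Uop_alt[OF i, of "Z a T"] U_Z[OF a i] by (simp add: pm.scale_left_diff_distrib)
  finally have "sgl i 1 + c \<in> supp (Z a T) \<or> sgl i 1 + c \<in> supp (JMP i (Z a T))"
    using supp_diff[of "(ev a T i - 1) \<odot> Z a T" "kappa \<odot> JMP i (Z a T)"] supp_scale by blast
  moreover have "deg x = deg a" if "x \<in> supp (JMP i (Z a T))" for x
  proof -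
    have "\<exists>j\<in>{Suc i..N}. x \<in> supp (sw i j (Z a T))"
    proof (rule ccontr)
      assume "\<not> ?thesis"
      then have "cf (JMP i (Z a T)) x = (\<lambda>T. 0)"
        unfolding JMP_def cf_sum supp_iff by (intro ext sum.neutral) auto
      then show False using that by (simp add: supp_iff)
    qed
    then obtain j where "j \<in> {Suc i..N}" "x \<in> supp (sw i j (Z a T))" by auto
    then show ?thesis using supp_sw_deg[OF ZP i, of j "deg a" x] Zd i by auto
  qed
  ultimately have "deg (sgl i 1 + c) = deg a" using Zd by auto
  then show ?thesis using deg_add_single[OF i] by simp
qed

text \<open>For exponent 0 the leading coefficient is the constant term, and pairing with constants
  recovers it because the norms of tableaux do not vanish.\<close>

lemma Z_0_norm:
  assumes "a \<in> EXP" "T \<in> R" "\<And>g. g \<in> P \<Longrightarrow> Bk (Z a T) g = 0" shows "a \<noteq> 0"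
proof
  assume "a = 0"
  have ZP: "Z a T \<in> P" using assms by auto
  have "cf (Z a T) 0 S = 0" if S: "S \<in> R" for S
  proof -
    have "formV (cf (Z a T) 0) (basisv S) = 0"
      using assms(3)[OF basisP_P[OF S]] unfolding basisP_eq Bk_cst .
    moreover have "formV (cf (Z a T) 0) (basisv S) = (\<Sum>Q\<in>R. if Q = S then cf (Z a T) 0 S * nrm S else 0)"
      unfolding formV_def by (rule sum.cong) (auto simp: basisv_def)
    ultimately show ?thesis using S by simp
  qed
  then have "cf (Z a T) 0 = (\<lambda>T. 0)" using V_eqI[OF cf_V[OF ZP], of "\<lambda>T. 0" 0] by (auto simp: V_def)
  then have "tv (Z a T) a = (\<lambda>T. 0)" using \<open>a = 0\<close> by (simp add: tv_def)
  then have "basisv T = (\<lambda>T. 0)" using tv_Z[OF assms(1,2)] by simp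
  then show False by (metis basisv_def zero_neq_one)
qed

text \<open>A \<open>\<zeta>\<^sub>\<alpha>\<close> of minimal degree with vanishing norm lies in the radical, hence is killed by all \<open>D\<^sub>i\<close>. Then
  \<open>U\<^sub>i = 1 + \<kappa> JM\<^sub>i\<close> on it, so the Jucys-Murphy eigenvalues \<open>\<alpha>\<^sub>i/\<kappa> + c\<close> are integers and \<open>\<alpha> = 0\<close>.\<close>

lemma Z_norm_nonzero:
  assumes "a \<in> EXP" "T \<in> R" shows "Bk (Z a T) (Z a T) \<noteq> 0"
  using assms
proof (induction "deg a" arbitrary: a T rule: less_induct)
  case less
  note a = less.prems
  have ZP: "Z a T \<in> P" using a by auto
  show ?case
  proof
    assume norm0: "Bk (Z a T) (Z a T) = 0"
    have ortho: "Bk (Z a T) (Z b S) = 0" if "b \<in> EXP" "S \<in> R" for b S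
      using Z_orthogonal[OF a that] norm0 by (cases "(a, T) = (b, S)") auto
    have rad: "Bk (Z a T) g = 0" if g: "g \<in> P" for g
    proof -
      let ?B = "{c \<in> EXP. \<exists>b\<in>supp g. deg c = deg b}"
      have "?B = (\<Union>b\<in>supp g. {c \<in> EXP. deg c = deg b})" by auto
      then have "finite ?B" using finite_supp[OF g] finite_deg by auto
      then have "g \<in> pm.span ((\<lambda>(b, S). Z b S) ` (?B \<times> R))"
      proof (rule Z_span)
        show "c \<in> ?B" if "b \<in> ?B" "c \<in> EXP" "lt c b" for b c using that lt_deg[OF that(3)] by simp
      qed (use g supp_EXP[OF g] in auto)
      then have "g \<in> P \<and> Bk (Z a T) g = 0" by (rule orthogonal_span) (use ortho in auto)
      then show ?thesis by simp
    qed
    \<comment> \<open>The image has degree one less, so it expands in Jack polynomials of nonzero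
      norm by the induction hypothesis. By adjointness it inherits orthogonality to everything, so
      all coefficients vanish.\<close>
    have D0: "D i (Z a T) = 0" if i: "i \<in> {1..N}" for i
    proof (cases "deg a = 0")
      case True
      have "supp (D i (Z a T)) = {}" using supp_Dunkl_Z_deg[OF a i] True by auto
      then show ?thesis by (rule supp_empty)
    next
      case False
      let ?W = "(\<lambda>(b, S). Z b S) ` ({b \<in> EXP. deg b = deg a - 1} \<times> R)"
      let ?h = "D i (Z a T)"
      have "finite ?W" using finite_deg by auto
      have "?h \<in> pm.span ?W"
        using supp_Dunkl_Z_deg[OF a i] ZP i by (intro Z_span_deg) fastforce+
      then obtain u where u: "?h = (\<Sum>w\<in>?W. u w \<odot> w)"
        unfolding pm.span_finite[OF \<open>finite ?W\<close>] by auto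
      have "u w = 0" if w: "w \<in> ?W" for w
      proof -
        obtain b S where b: "w = Z b S" "b \<in> EXP" "deg b = deg a - 1" "S \<in> R" using w by auto
        have wP: "w \<in> P" using b by auto
        have "Bk ?h w = Bk (Z a T) (Xop i w)" using ZP wP i by (intro Bk_Xop_right[symmetric])
        also have "\<dots> = 0" using wP i by (intro rad) auto
        finally have "0 = (\<Sum>x\<in>?W. u x * Bk x w)" unfolding u Bk_sum_left Bk_scale_left by simp
        also have "\<dots> = (\<Sum>x\<in>?W. if x = w then u w * Bk w w else 0)"
        proof (rule sum.cong)
          fix x assume "x \<in> ?W"
          then obtain c Q where c: "x = Z c Q" "c \<in> EXP" "Q \<in> R" by auto
          show "u x * Bk x w = (if x = w then u w * Bk w w else 0)"
            using Z_orthogonal[of c Q b S] b c by (cases "(c, Q) = (b, S)") auto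
        qed simp
        also have "\<dots> = u w * Bk w w" using \<open>finite ?W\<close> w by simp
        finally have "u w * Bk w w = 0" by simp
        moreover have "Bk w w \<noteq> 0" unfolding b(1) using b False by (intro less.hyps) auto
        ultimately show ?thesis by simp
      qed
      then show ?thesis unfolding u by (intro sum.neutral) auto
    qed
    have Z0: "Z a T \<noteq> 0"
    proof
      assume "Z a T = 0"
      then have "basisv T = (\<lambda>T. 0)" using tv_Z[OF a] by simp
      then show False by (metis basisv_def zero_neq_one)
    qed
    have J: "JMP i (Z a T) = ((ev a T i - 1) / kappa) \<odot> Z a T" if i: "i \<in> {1..N}" for i
    proof -
      have "kappa \<odot> JMP i (Z a T) = (ev a T i - 1) \<odot> Z a T"
        using Uop_alt[OF i, of "Z a T"] U_Z[OF a i] D0[OF i] by (simp add: pm.scale_left_diff_distrib)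
      then have "(1 / kappa) \<odot> (kappa \<odot> JMP i (Z a T)) = (1 / kappa) \<odot> ((ev a T i - 1) \<odot> Z a T)" by simp
      then show ?thesis by simp
    qed
    have "lk a i = 0" if i: "i \<in> {1..N}" for i
    proof -
      have "\<forall>i\<in>{1..N}. \<exists>z::int. (ev a T i - 1) / kappa = of_int z"
        using i J by (intro JMP_integral[OF ZP Z0]) auto
      then obtain z :: int where "(ev a T i - 1) / kappa = of_int z" using i by blast
      then have "ev a T i - 1 = kappa * of_int z" by (simp add: field_simps)
      then have "kappa * of_int (z - content (rk a i) T) = of_int (int (lk a i))"
        by (simp add: ev_def algebra_simps)
      then show ?thesis using kappa_of_int by fastforce
    qed
    then have "a = 0" using EXP_eqI[OF a(1), of 0] by (simp add: EXP_def)
    then show False using Z_0_norm[OF a rad] by simp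
  qed
qed

lemma Dunkl_Z_coefficient:
  assumes a: "a \<in> EXP" and T: "T \<in> R" and m: "1 \<le> m" "m \<le> N" and pos: "0 < lk a m"
    and zero: "\<And>k. m < k \<Longrightarrow> k \<le> N \<Longrightarrow> lk a k = 0"
  shows "D m (Z a T) = (Bk (Z a T) (Z a T) / Bk (Z (hat a m) T) (Z (hat a m) T)) \<odot> A (inv (theta m)) (Z (hat a m) T)"
proof -
  let ?h = "Z (hat a m) T" and ?w = "inv (theta m)"
  obtain c where c: "D m (Z a T) = c \<odot> A ?w ?h" using Dunkl_Z[OF assms] by auto
  have hE: "hat a m \<in> EXP" by (rule EXP_hat[OF a m(2)])
  have P: "Z a T \<in> P" "?h \<in> P" "A ?w ?h \<in> P" using a T hE m by auto
  have "Bk (D m (Z a T)) (A ?w ?h) = c * Bk ?h ?h"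
    unfolding c Bk_scale_left using P m by (simp add: Bk_invariant)
  moreover have "Bk (D m (Z a T)) (A ?w ?h) = Bk (Z a T) (Xop m (A ?w ?h))"
    using P m by (intro Bk_Xop_right[symmetric]) auto
  moreover have "Bk (Z a T) (Xop m (A ?w ?h) - Z a T) = 0"
  proof -
    have "x \<in> P \<and> Bk (Z a T) x = 0" if x: "x \<in> (\<Union>j\<in>{Suc m..N}. Z (rename_exp (tp m j) a) ` R)" for x
    proof -
      obtain j S where j: "j \<in> {Suc m..N}" "S \<in> R" "x = Z (rename_exp (tp m j) a) S" using x by auto
      have dE: "rename_exp (tp m j) a \<in> EXP" using j m by (intro EXP_rename a) auto
      \<comment> \<open>The exchanged exponent has entry 0 at \<open>m\<close> whereas
        \<open>a\<close> has a positive one there, so the additional Jack polynomials are orthogonal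
        to \<open>Z a T\<close>.\<close>
      have low: "lk (rename_exp (tp m j) a) m = 0" using j zero[of j] by simp
      have "rename_exp (tp m j) a \<noteq> a"
      proof
        assume e: "rename_exp (tp m j) a = a"
        show False using low pos unfolding e by simp
      qed
      then show ?thesis using Z_orthogonal[OF a T dE j(2)] dE j by auto
    qed
    then show ?thesis using orthogonal_span[OF lowering_chain[OF assms], of "Z a T"] by blast
  qed
  then have "Bk (Z a T) (Xop m (A ?w ?h)) = Bk (Z a T) (Z a T)" using P m by (simp add: Bk_diff_right)
  ultimately have "c * Bk ?h ?h = Bk (Z a T) (Z a T)" by simp
  then have "c = Bk (Z a T) (Z a T) / Bk ?h ?h" using Z_norm_nonzero[OF hE T] by (simp add: field_simps)
  then show ?thesis using c by simp
qed

lemma expo_alpha_hat: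
  assumes al: "length al = N" and m: "1 \<le> m" "m \<le> N"
    and zero: "\<And>k. m < k \<Longrightarrow> k \<le> N \<Longrightarrow> lk (expo al) k = 0"
  shows "expo (alpha_hat al m) = hat (expo al) m" "length (alpha_hat al m) = N"
proof -
  have nth: "alpha_hat al m ! i = (if i = 0 then al ! (m - 1) - 1 else if i < m then al ! (i - 1) else 0)" if "i < N" for i
    unfolding alpha_hat_def using that al m
    by (cases i) (auto simp: nth_append min_def)
  show len: "length (alpha_hat al m) = N" unfolding alpha_hat_def using al m by simp
  show "expo (alpha_hat al m) = hat (expo al) m"
  proof (rule EXP_eqI)
    show "expo (alpha_hat al m) \<in> EXP" by (rule expo_EXP[OF len])
    show "hat (expo al) m \<in> EXP" using al m by (intro EXP_hat expo_EXP) auto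
    fix i assume i: "i \<in> {1..N}"
    define k where "k = inv (theta m) i"
    have t: "theta m permutes {1..N}" using m by auto
    have k: "i = theta m k" unfolding k_def by (simp add: permutes_inverses(1)[OF t])
    have kN: "k \<in> {1..N}" using permutes_in_image[OF t, of k] i unfolding k by simp
    have "lk (expo (alpha_hat al m)) i = alpha_hat al m ! (i - 1)" using i len by (simp add: lookup_expo)
    also have "\<dots> = (if i - 1 = 0 then al ! (m - 1) - 1 else if i - 1 < m then al ! (i - 1 - 1) else 0)"
      using i by (intro nth) auto
    also have "\<dots> = lk (expo al) k - (if k = m then 1 else 0)"
    proof -
      consider "k < m" | "k = m" | "m < k" by linarith
      then show ?thesis
      proof cases
        case 1
        then show ?thesis using k kN m al by (simp add: lookup_expo)
      next
        case 2
        then show ?thesis using k kN m al by (simp add: lookup_expo)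
      next
        case 3
        then show ?thesis using k kN m al zero[of k] by auto
      qed
    qed
    also have "\<dots> = lk (hat (expo al) m) i" unfolding k lookup_hat[OF m(2)] ..
    finally show "lk (expo (alpha_hat al m)) i = lk (hat (expo al) m) i" .
  qed
qed

end

theorem theorem6p3:
  fixes tau alpha :: "nat list" and T :: tab and m :: nat
  assumes "is_partition tau"
    and "length alpha = sum_list tau"
    and "ell alpha = m" and "0 < m" and "m < sum_list tau"
    and "T \<in> RSYT tau"
  shows "Dunkl tau m (zeta tau alpha T)
    = psmul (normsq tau (zeta tau alpha T) / normsq tau (zeta tau (alpha_hat alpha m) T))
        (act tau (inv (theta m)) (zeta tau (alpha_hat alpha m) T))"
proof -
  interpret partition_shape tau by standard (rule assms)
  let ?a = "expo alpha" and ?S = "{i \<in> {1..length alpha}. alpha ! (i - 1) > 0}"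
  \<comment> \<open>A positive \<open>ell\<close> excludes its default value 0, so it is a maximum
    over a nonempty set.\<close>
  have ex: "\<exists>i\<in>{1..length alpha}. alpha ! (i - 1) > 0"
    using assms(3,4) unfolding ell_def by (auto split: if_splits)
  then have Max: "m = Max ?S" using assms(3) unfolding ell_def by simp
  have fin: "finite ?S" by simp
  have "m \<in> ?S" unfolding Max by (rule Max_in[OF fin]) (use ex in auto)
  then have m: "1 \<le> m" "m \<le> N" and pos: "0 < lk ?a m" using assms(2) by (auto simp: lookup_expo)
  have zero: "lk ?a k = 0" if "m < k" "k \<le> N" for k
  proof (rule ccontr)
    assume "lk ?a k \<noteq> 0"
    then have "k \<in> ?S" using that assms(2) by (auto simp: lookup_expo split: if_splits)
    then have "k \<le> m" unfolding Max by (rule Max_ge[OF fin])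
    then show False using that by simp
  qed
  have a: "?a \<in> EXP" by (rule expo_EXP[OF assms(2)])
  have z: "zeta tau alpha T = Z ?a T" by (rule zeta_eq_Z[OF assms(2,6)])
  have zh: "zeta tau (alpha_hat alpha m) T = Z (hat ?a m) T"
    using zeta_eq_Z[OF expo_alpha_hat(2)[OF assms(2) m zero] assms(6)] expo_alpha_hat(1)[OF assms(2) m zero] by simp
  have P: "Z ?a T \<in> P" "Z (hat ?a m) T \<in> P" using a assms(6) EXP_hat[OF a m(2)] by auto
  show ?thesis unfolding z zh normsq_def form_kappa_eq[OF P(1) P(1)] form_kappa_eq[OF P(2) P(2)]
    by (rule Dunkl_Z_coefficient[OF a assms(6) m pos zero])
qed

end
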